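(* Let $a\ge1$ and $b>1$ be integers and $n=2ab+b^2$. Let $G(a,b)=(G_0(n)\rtimes\tilde B_n)/N(a,b)$ be the group defined in the context, let $\psi_{a,b}:G(a,b)\to S_n$ be the homomorphism $\psi_{a,b}(\alpha,\beta)=\psi(\beta)$, and put $H_{a,b}=\ker\psi_{a,b}$ and $(H_{a,b})_0=\ker\big(H_{a,b}\to Ab(G(a,b))\big)$. Then: 1) $H_{a,b}/(H_{a,b})_0\simeq\mathbb Z$. 2) $H_{a,b}'=(H_{a,b})_0'\simeq\begin{cases}\mathbb Z_2 & \text{if } b\text{ is even and } a \text{ is odd},\\ 1 & \text{otherwise,}\end{cases}$ and $H_{a,b}'\subset\mathrm{Center}(G(a,b))$. 3) $Ab\big((H_{a,b})_0\big)\simeq(\mathbb Z_{b-2a})^{n-1}$.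
   Context: Notation: $[g,h]=ghg^{-1}h^{-1}$ and $g_h=h^{-1}gh$; $K'$ is the commutator subgroup of a group $K$ and $Ab(K)=K/K'$; $\mathbb Z_k=\mathbb Z/k\mathbb Z$ for every integer $k$ (so $\mathbb Z_{-k}=\mathbb Z_k$, $\mathbb Z_0=\mathbb Z$); $S_n$ is the symmetric group; $\lambda(k)=\frac{k(k-1)}2$. The group $\tilde B_n$: let $B_n$ be the braid group with standard generators $x_1,\dots,x_{n-1}$ (relations $x_ix_j=x_jx_i$ for $|i-j|>1$ and $x_ix_{i+1}x_i=x_{i+1}x_ix_{i+1}$). $\tilde B_n$ is the quotient of $B_n$ by the normal closure of $[x_2,(x_2)_{x_1x_3}]$; the images of the generators are still denoted $x_i$. Let $\psi:\tilde B_n\to S_n$ be induced by the standard homomorphism $B_n\to S_n$ and let $\tilde\delta:\tilde B_n\to\mathbb Z$ be the degree homomorphism ($\tilde\delta(x_i)=1$). Put $\tilde P_n=\ker\psi$ and $\tilde P_{n,0}=\ker\psi\cap\ker\tilde\delta$. Elements of $\tilde B_n$: let $u=(x_1^2)_{x_2^{-1}}x_2^{-2}=[x_1^{-1},x_2^2]\in\tilde P_{n,0}$ and $c=[x_1^2,x_2^2]\in\tilde P_{n,0}$. (It is known that $c^2=1$, that $c$ is central in $\tilde B_n$, that $c$ generates $\tilde P_n'=\tilde P_{n,0}'$, and that $\tilde P_{n,0}$ is generated by the $\tilde B_n$-conjugates of $u$.) The group $G_0(n)$: it is a copy of $\tilde P_{n,0}$, on which $\tilde B_n$ acts by automorphisms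 via conjugation, $g\mapsto g_\beta$ for $\beta\in\tilde B_n$. Denote by $B_{1,1}\in G_0(n)$ the element corresponding to $u$, and by $\tau\in G_0(n)$ the element corresponding to $c$. The semidirect product $G_0(n)\rtimes\tilde B_n$ is formed with respect to this action, so that $\beta^{-1}g\beta=g_\beta$ for $g\in G_0(n)$ and $\beta\in\tilde B_n$. The group $N(a,b)$: it is the normal subgroup of $G_0(n)\rtimes\tilde B_n$ normally generated by the four elements $$n_1=B_{1,1}^{\,b}\,u^{2-b}\,c\,(c\tau)^{\lambda(b+1)},\qquad n_2=(c\tau)^b,$$ $$n_3=(B_{1,1}u^{-1})^{a-b}\,u^{-1}\,c\,(c\tau)^{\lambda(b-a+1)},\qquad n_4=(B_{1,1}u^{-1})^{a-b}\,u^{-1}\,\tau\,(c\tau)^{\lambda(b-a)},$$ where $B_{1,1},\tau$ are regarded as elements of the factor $G_0(n)$ and $u,c$ as elements of the factor $\tilde B_n$. The map $(\alpha,\beta)\mapsto\psi(\beta)$ on $G_0(n)\rtimes\tilde B_n$ is trivial on $N(a,b)$, so $\psi_{a,b}$ is well defined. *)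

theory Defs
  imports "HOL-Algebra.Product_Groups" "HOL-Algebra.Sym_Groups"
begin

section \<open>General group theory\<close>

text \<open>Conjugation \<open>g\<^sub>h = h\<^sup>-\<^sup>1 g h\<close>, a right action.\<close>
definition conjg :: "('a, 'b) monoid_scheme \<Rightarrow> 'a \<Rightarrow> 'a \<Rightarrow> 'a" where
  "conjg G g h = inv\<^bsub>G\<^esub> h \<otimes>\<^bsub>G\<^esub> g \<otimes>\<^bsub>G\<^esub> h"

definition commutator :: "('a, 'b) monoid_scheme \<Rightarrow> 'a \<Rightarrow> 'a \<Rightarrow> 'a" where
  "commutator G g h = g \<otimes>\<^bsub>G\<^esub> h \<otimes>\<^bsub>G\<^esub> inv\<^bsub>G\<^esub> g \<otimes>\<^bsub>G\<^esub> inv\<^bsub>G\<^esub> h"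

definition normal_closure :: "('a, 'b) monoid_scheme \<Rightarrow> 'a set \<Rightarrow> 'a set" where
  "normal_closure G S = \<Inter>{N. N \<lhd> G \<and> S \<subseteq> N}"

definition center :: "('a, 'b) monoid_scheme \<Rightarrow> 'a set" where
  "center G = {z \<in> carrier G. \<forall>g \<in> carrier G. z \<otimes>\<^bsub>G\<^esub> g = g \<otimes>\<^bsub>G\<^esub> z}"

definition abelianization :: "('a, 'b) monoid_scheme \<Rightarrow> 'a set monoid" where
  "abelianization K = K Mod derived K (carrier K)"

definition abelianization_map :: "('a, 'b) monoid_scheme \<Rightarrow> 'a \<Rightarrow> 'a set" where
  "abelianization_map K g = derived K (carrier K) #>\<^bsub>K\<^esub> g"

text \<open>The map induced by \<open>h\<close> on a quotient of its domain: a coset on which \<open>h\<close> is constant is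
  sent to the common value of \<open>h\<close> on it.\<close>
definition induced_map :: "('a \<Rightarrow> 'b) \<Rightarrow> 'a set \<Rightarrow> 'b" where
  "induced_map h C = the_elem (h ` C)"

text \<open>For \<open>k = 0\<close> this is the infinite cyclic group, and \<open>Zmod (- k) = Zmod k\<close>.\<close>
definition Zmod :: "int \<Rightarrow> int monoid" where
  "Zmod k = integer_mod_group (nat \<bar>k\<bar>)"

text \<open>The action \<open>act g \<beta>\<close> of \<open>B\<close> on \<open>A\<close> is written on the right, and \<open>(g, \<beta>)\<close> stands for the
  product \<open>g \<beta>\<close>. The rule \<open>\<beta>\<^sup>-\<^sup>1 g \<beta> = act g \<beta>\<close> then forces
  \<open>g \<beta> h \<gamma> = g (act h \<beta>\<^sup>-\<^sup>1) \<beta> \<gamma>\<close>.\<close>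
definition semidirect_product ::
    "('a, 'c) monoid_scheme \<Rightarrow> ('b, 'd) monoid_scheme \<Rightarrow> ('a \<Rightarrow> 'b \<Rightarrow> 'a) \<Rightarrow> ('a \<times> 'b) monoid" where
  "semidirect_product A B act =
    \<lparr>carrier = carrier A \<times> carrier B,
     monoid.mult = (\<lambda>(g, \<beta>) (h, \<gamma>). (g \<otimes>\<^bsub>A\<^esub> act h (inv\<^bsub>B\<^esub> \<beta>), \<beta> \<otimes>\<^bsub>B\<^esub> \<gamma>)),
     one = (\<one>\<^bsub>A\<^esub>, \<one>\<^bsub>B\<^esub>)\<rparr>"


section \<open>Groups given by generators and relations\<close>

text \<open>A word is a list of letters; \<open>(s, True)\<close> stands for the generator \<open>s\<close> and \<open>(s, False)\<close>
  for its inverse. A relation \<open>v = w\<close> is represented by the pair \<open>(v, w)\<close>.\<close>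

type_synonym 'g word = "('g \<times> bool) list"

inductive word_eq :: "'g set \<Rightarrow> ('g word \<times> 'g word) set \<Rightarrow> 'g word \<Rightarrow> 'g word \<Rightarrow> bool"
  for S :: "'g set" and R :: "('g word \<times> 'g word) set" where
  refl: "v \<in> lists (S \<times> UNIV) \<Longrightarrow> word_eq S R v v"
| sym: "word_eq S R v w \<Longrightarrow> word_eq S R w v"
| trans: "word_eq S R v w \<Longrightarrow> word_eq S R w z \<Longrightarrow> word_eq S R v z"
| cancel: "p \<in> lists (S \<times> UNIV) \<Longrightarrow> q \<in> lists (S \<times> UNIV) \<Longrightarrow> s \<in> S \<Longrightarrow>
    word_eq S R (p @ [(s, e), (s, \<not> e)] @ q) (p @ q)"
| relation: "p \<in> lists (S \<times> UNIV) \<Longrightarrow> q \<in> lists (S \<times> UNIV) \<Longrightarrow> (v, w) \<in> R \<Longrightarrow>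
    v \<in> lists (S \<times> UNIV) \<Longrightarrow> w \<in> lists (S \<times> UNIV) \<Longrightarrow> word_eq S R (p @ v @ q) (p @ w @ q)"

definition word_class :: "'g set \<Rightarrow> ('g word \<times> 'g word) set \<Rightarrow> 'g word \<Rightarrow> 'g word set" where
  "word_class S R v = {w. word_eq S R v w}"

definition presented_group :: "'g set \<Rightarrow> ('g word \<times> 'g word) set \<Rightarrow> 'g word set monoid" where
  "presented_group S R =
    \<lparr>carrier = word_class S R ` lists (S \<times> UNIV),
     monoid.mult = (\<lambda>V W. \<Union>v \<in> V. \<Union>w \<in> W. word_class S R (v @ w)),
     one = word_class S R []\<rparr>"

text \<open>Value of a word in \<open>G\<close> under the assignment \<open>f\<close> of the generators; if \<open>f\<close> respects the
  relations, \<open>induced_map (eval_word G f)\<close> is the homomorphism from the presented group to \<open>G\<close>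
  extending \<open>f\<close>.\<close>
fun eval_word :: "('a, 'b) monoid_scheme \<Rightarrow> ('g \<Rightarrow> 'a) \<Rightarrow> 'g word \<Rightarrow> 'a" where
  "eval_word G f [] = \<one>\<^bsub>G\<^esub>"
| "eval_word G f ((s, e) # w) = (if e then f s else inv\<^bsub>G\<^esub> (f s)) \<otimes>\<^bsub>G\<^esub> eval_word G f w"


section \<open>The braid group and its quotient \<open>\<tilde>B\<^sub>n\<close>\<close>

definition braid_relations :: "nat \<Rightarrow> (nat word \<times> nat word) set" where
  "braid_relations n =
    {([(i, True), (j, True)], [(j, True), (i, True)]) | i j.
       i \<in> {1..<n} \<and> j \<in> {1..<n} \<and> \<bar>int i - int j\<bar> > 1} \<union>
    {([(i, True), (i + 1, True), (i, True)], [(i + 1, True), (i, True), (i + 1, True)]) | i.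
       i \<in> {1..<n} \<and> i + 1 \<in> {1..<n}}"

definition braid_group :: "nat \<Rightarrow> nat word set monoid" where
  "braid_group n = presented_group {1..<n} (braid_relations n)"

definition braid_gen :: "nat \<Rightarrow> nat \<Rightarrow> nat word set" where
  "braid_gen n i = word_class {1..<n} (braid_relations n) [(i, True)]"

definition braid_perm :: "nat \<Rightarrow> nat word set \<Rightarrow> nat \<Rightarrow> nat" where
  "braid_perm n = induced_map (eval_word (sym_group n) (\<lambda>i. transpose i (i + 1)))"

definition braid_degree :: "nat \<Rightarrow> nat word set \<Rightarrow> int" where
  "braid_degree n = induced_map (eval_word integer_group (\<lambda>i. 1))"

definition Bt_kernel :: "nat \<Rightarrow> nat word set set" where
  "Bt_kernel n = (let B = braid_group n; x = braid_gen n in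
     normal_closure B {commutator B (x 2) (conjg B (x 2) (x 1 \<otimes>\<^bsub>B\<^esub> x 3))})"

definition Bt :: "nat \<Rightarrow> nat word set set monoid" where
  "Bt n = braid_group n Mod Bt_kernel n"

definition Bt_gen :: "nat \<Rightarrow> nat \<Rightarrow> nat word set set" where
  "Bt_gen n i = Bt_kernel n #>\<^bsub>braid_group n\<^esub> braid_gen n i"

definition psi :: "nat \<Rightarrow> nat word set set \<Rightarrow> nat \<Rightarrow> nat" where
  "psi n = induced_map (braid_perm n)"

definition Bt_degree :: "nat \<Rightarrow> nat word set set \<Rightarrow> int" where
  "Bt_degree n = induced_map (braid_degree n)"

definition Pt0 :: "nat \<Rightarrow> nat word set set set" where
  "Pt0 n = kernel (Bt n) (sym_group n) (psi n) \<inter> kernel (Bt n) integer_group (Bt_degree n)"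

definition u_elt :: "nat \<Rightarrow> nat word set set" where
  "u_elt n = conjg (Bt n) (Bt_gen n 1 [^]\<^bsub>Bt n\<^esub> (2::int)) (inv\<^bsub>Bt n\<^esub> Bt_gen n 2)
     \<otimes>\<^bsub>Bt n\<^esub> Bt_gen n 2 [^]\<^bsub>Bt n\<^esub> (- 2::int)"

definition c_elt :: "nat \<Rightarrow> nat word set set" where
  "c_elt n = commutator (Bt n) (Bt_gen n 1 [^]\<^bsub>Bt n\<^esub> (2::int)) (Bt_gen n 2 [^]\<^bsub>Bt n\<^esub> (2::int))"


section \<open>The group \<open>G(a, b)\<close>\<close>

definition G0 :: "nat \<Rightarrow> nat word set set monoid" where
  "G0 n = (Bt n)\<lparr>carrier := Pt0 n\<rparr>"

type_synonym sd = "nat word set set \<times> nat word set set"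

definition SD :: "nat \<Rightarrow> sd monoid" where
  "SD n = semidirect_product (G0 n) (Bt n) (conjg (Bt n))"

definition lam :: "int \<Rightarrow> int" where
  "lam k = k * (k - 1) div 2"

definition N_gens :: "nat \<Rightarrow> int \<Rightarrow> int \<Rightarrow> sd set" where
  "N_gens n a b =
    (let S = SD n;
         B11 = (u_elt n, \<one>\<^bsub>Bt n\<^esub>);
         \<tau> = (c_elt n, \<one>\<^bsub>Bt n\<^esub>);
         u = (\<one>\<^bsub>G0 n\<^esub>, u_elt n);
         c = (\<one>\<^bsub>G0 n\<^esub>, c_elt n)
     in {B11 [^]\<^bsub>S\<^esub> b \<otimes>\<^bsub>S\<^esub> u [^]\<^bsub>S\<^esub> (2 - b) \<otimes>\<^bsub>S\<^esub> c \<otimes>\<^bsub>S\<^esub> (c \<otimes>\<^bsub>S\<^esub> \<tau>) [^]\<^bsub>S\<^esub> lam (b + 1),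
         (c \<otimes>\<^bsub>S\<^esub> \<tau>) [^]\<^bsub>S\<^esub> b,
         (B11 \<otimes>\<^bsub>S\<^esub> inv\<^bsub>S\<^esub> u) [^]\<^bsub>S\<^esub> (a - b) \<otimes>\<^bsub>S\<^esub> inv\<^bsub>S\<^esub> u \<otimes>\<^bsub>S\<^esub> c
           \<otimes>\<^bsub>S\<^esub> (c \<otimes>\<^bsub>S\<^esub> \<tau>) [^]\<^bsub>S\<^esub> lam (b - a + 1),
         (B11 \<otimes>\<^bsub>S\<^esub> inv\<^bsub>S\<^esub> u) [^]\<^bsub>S\<^esub> (a - b) \<otimes>\<^bsub>S\<^esub> inv\<^bsub>S\<^esub> u \<otimes>\<^bsub>S\<^esub> \<tau>
           \<otimes>\<^bsub>S\<^esub> (c \<otimes>\<^bsub>S\<^esub> \<tau>) [^]\<^bsub>S\<^esub> lam (b - a)})"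

definition N_sub :: "nat \<Rightarrow> int \<Rightarrow> int \<Rightarrow> sd set" where
  "N_sub n a b = normal_closure (SD n) (N_gens n a b)"

text \<open>In the intended use \<open>n = 2 a b + b\<^sup>2\<close>; \<open>n\<close> is kept as a separate parameter.\<close>
definition Gab :: "nat \<Rightarrow> int \<Rightarrow> int \<Rightarrow> sd set monoid" where
  "Gab n a b = SD n Mod N_sub n a b"

definition psi_ab :: "nat \<Rightarrow> sd set \<Rightarrow> nat \<Rightarrow> nat" where
  "psi_ab n = induced_map (\<lambda>(\<alpha>, \<beta>). psi n \<beta>)"

definition Hab :: "nat \<Rightarrow> int \<Rightarrow> int \<Rightarrow> sd set set" where
  "Hab n a b = kernel (Gab n a b) (sym_group n) (psi_ab n)"

definition Hab0 :: "nat \<Rightarrow> int \<Rightarrow> int \<Rightarrow> sd set set" where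
  "Hab0 n a b = kernel ((Gab n a b)\<lparr>carrier := Hab n a b\<rparr>) (abelianization (Gab n a b))
     (abelianization_map (Gab n a b))"

end

theory Submission
  imports Defs "HOL-Algebra.Zassenhaus" "HOL.Complex" "HOL-Algebra.FiniteProduct"
begin

text \<open>
  The transversality relation says that \<open>x\<^sub>3\<close> commutes with the conjugates of \<open>x\<^sub>1\<close> by
  \<open>x\<^sub>2\<^sup>2\<close> and \<open>x\<^sub>2\<^sup>-\<^sup>2\<close>. It follows that \<open>c = [x\<^sub>1\<^sup>2, x\<^sub>2\<^sup>2]\<close> is inverse to
  \<open>[x\<^sub>3\<^sup>2, x\<^sub>4\<^sup>2]\<close>, so \<open>c\<close> commutes with all generators, and the half turn \<open>x\<^sub>1 x\<^sub>2 x\<^sub>1\<close>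
  shows \<open>c\<^sup>2 = 1\<close>. Let \<open>u\<^sub>i\<close> be the conjugate of \<open>u\<close> supported on \<open>x\<^sub>i\<close>. The \<open>u\<^sub>i\<close> and \<open>c\<close>
  generate a normal subgroup modulo which the squares \<open>x\<^sub>i\<^sup>2\<close> agree; by the Coxeter presentation
  of the symmetric group it is all of the degree zero part of the pure subgroup, and modulo \<open>c\<close>
  it is a root lattice of type \<open>A\<^sub>n\<^sub>-\<^sub>1\<close> with the \<open>u\<^sub>i\<close> as simple roots.

  The map \<open>(g, \<beta>) \<mapsto> (g \<beta>, \<beta>)\<close> turns the semidirect product into a fibre product, where
  \<open>n\<^sub>3 = (u\<^sup>-\<^sup>1 c, u\<^sup>b\<^sup>-\<^sup>a\<^sup>-\<^sup>1 \<dots>)\<close>. Its commutators with \<open>u\<^sub>2\<close> in either factor kill \<open>\<tau>\<close> and, together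
  with \<open>n\<^sub>2\<close>, kill \<open>c\<close> unless \<open>b\<close> is even and \<open>a\<close> is odd. What is left of the abelianised kernel is
  generated by the classes of \<open>B\<^sub>i u\<^sub>i\<^sup>-\<^sup>1\<close> with \<open>1 \<le> i < n\<close>, where \<open>B\<^sub>i\<close> is the copy of \<open>u\<^sub>i\<close> in
  \<open>G\<^sub>0(n)\<close>, and the determinant \<open>b - 2 a\<close> of the relations in \<open>B\<^sub>i, u\<^sub>i\<close> annihilates them.

  Nothing more collapses: the lattice is detected in the wreath product of \<open>\<int>\<close> with \<open>S\<^sub>n\<close>. For \<open>b\<close>
  even and \<open>a\<close> odd, \<open>c\<close> survives in the spin representation \<open>x\<^sub>i \<mapsto> 1 + J\<^sub>i\<close> of the second factor,
  in which \<open>u\<^sup>2 = c = -1\<close>.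
\<close>

section \<open>Half-twists with transversal commutation\<close>

text \<open>The computations take place in an abstract group with generators \<open>x i\<close>; the
  presentation of \<open>Bt n\<close> enters only through a list of relations and a universal
  property for maps out of it. The shape of the relators is explained by the two projections of the
  fibre product. \<open>proj\<close> identifies \<open>B11\<close> with \<open>U\<close> and \<tau>
  with \<open>C\<close>, hence kills \<open>B11 U^-1\<close> and \<open>C\<close> \<tau>, while
  \<open>snd\<close> kills \<open>B11\<close> and \<tau>. So \<open>proj n3\<close> is
  \<open>u^-1 c\<close> whatever a and b are, \<tau> dies unconditionally, and only
  \<open>snd\<close> can still see \<open>c\<close>. There \<open>n2\<close> is \<open>c^b\<close>,
  and the commutator of \<open>n3\<close> with \<open>u 2\<close> is \<open>c^(a-b+1)\<close>: this
  is the parity condition. The triangular numbers \<open>lam\<close> are the exponents for which all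
  relators vanish once \<open>u^2 = c = -1\<close>. Modulo \<open>c\<close>, with \<gamma> = B - u
  written additively, \<open>n3\<close> gives u = (a-b) \<gamma> and B = (a-b+1) \<gamma>, and then
  \<open>n1\<close> reads -(b-2a) \<gamma> = 0. The functional (a-b+1) \<open>proj\<close> -
  \<open>snd\<close> has exactly these values on B and u, so it shows that the order b-2a is not
  smaller than expected.\<close>

context group
begin

lemma inv_cancel_left [simp]:
  "x \<in> carrier G \<Longrightarrow> y \<in> carrier G \<Longrightarrow> inv x \<otimes> (x \<otimes> y) = y"
  "x \<in> carrier G \<Longrightarrow> y \<in> carrier G \<Longrightarrow> x \<otimes> (inv x \<otimes> y) = y"
  by (simp_all flip: m_assoc)

lemma conjg_closed [simp]: "x \<in> carrier G \<Longrightarrow> g \<in> carrier G \<Longrightarrow> conjg G x g \<in> carrier G"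
  by (simp add: conjg_def)

lemma commutator_closed [simp]:
  "x \<in> carrier G \<Longrightarrow> y \<in> carrier G \<Longrightarrow> commutator G x y \<in> carrier G"
  by (simp add: commutator_def)

lemma conjg_mult:
  "x \<in> carrier G \<Longrightarrow> y \<in> carrier G \<Longrightarrow> g \<in> carrier G \<Longrightarrow>
    conjg G (x \<otimes> y) g = conjg G x g \<otimes> conjg G y g"
  by (simp add: conjg_def m_assoc)

lemma conjg_inv:
  "x \<in> carrier G \<Longrightarrow> g \<in> carrier G \<Longrightarrow> conjg G (inv x) g = inv (conjg G x g)"
  by (simp add: conjg_def m_assoc inv_mult_group)

lemma conjg_one [simp]: "g \<in> carrier G \<Longrightarrow> conjg G \<one> g = \<one>"
  by (simp add: conjg_def)

lemma conjg_by_one [simp]: "x \<in> carrier G \<Longrightarrow> conjg G x \<one> = x"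
  by (simp add: conjg_def)

lemma conjg_conjg:
  "x \<in> carrier G \<Longrightarrow> g \<in> carrier G \<Longrightarrow> h \<in> carrier G \<Longrightarrow>
    conjg G (conjg G x g) h = conjg G x (g \<otimes> h)"
  by (simp add: conjg_def m_assoc inv_mult_group)

lemma conjg_conjg_inv [simp]:
  assumes "x \<in> carrier G" "g \<in> carrier G"
  shows "conjg G (conjg G x g) (inv g) = x" "conjg G (conjg G x (inv g)) g = x"
  using assms by (simp_all add: conjg_conjg)

lemma conjg_commutator:
  "x \<in> carrier G \<Longrightarrow> y \<in> carrier G \<Longrightarrow> g \<in> carrier G \<Longrightarrow>
    conjg G (commutator G x y) g = commutator G (conjg G x g) (conjg G y g)"
  by (simp add: commutator_def conjg_mult conjg_inv)

lemma inv_commutator: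
  "x \<in> carrier G \<Longrightarrow> y \<in> carrier G \<Longrightarrow> inv (commutator G x y) = commutator G y x"
  by (simp add: commutator_def m_assoc inv_mult_group)

lemma conjg_eq_iff_commute:
  assumes "x \<in> carrier G" "g \<in> carrier G"
  shows "conjg G x g = x \<longleftrightarrow> x \<otimes> g = g \<otimes> x"
proof
  assume "conjg G x g = x"
  then have "g \<otimes> (inv g \<otimes> x \<otimes> g) = g \<otimes> x" by (simp add: conjg_def)
  then show "x \<otimes> g = g \<otimes> x" using assms by (simp add: m_assoc)
qed (use assms in \<open>simp add: conjg_def m_assoc\<close>)

lemma conjg_fixed_inv:
  assumes "x \<in> carrier G" "g \<in> carrier G" "conjg G x g = x"
  shows "conjg G x (inv g) = x"
  by (metis assms conjg_conjg_inv(1))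

lemma commute_inv:
  "x \<in> carrier G \<Longrightarrow> y \<in> carrier G \<Longrightarrow> x \<otimes> y = y \<otimes> x \<Longrightarrow> x \<otimes> inv y = inv y \<otimes> x"
  using conjg_eq_iff_commute conjg_fixed_inv by auto

lemma commute_mult:
  assumes "x \<in> carrier G" "y \<in> carrier G" "z \<in> carrier G"
    and "x \<otimes> y = y \<otimes> x" "x \<otimes> z = z \<otimes> x"
  shows "x \<otimes> (y \<otimes> z) = y \<otimes> z \<otimes> x"
  using assms by (metis m_assoc)

lemma commute_conjg:
  assumes "x \<in> carrier G" "y \<in> carrier G" "g \<in> carrier G" "x \<otimes> y = y \<otimes> x"
  shows "conjg G x g \<otimes> conjg G y g = conjg G y g \<otimes> conjg G x g"
  using assms by (simp flip: conjg_mult)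

text \<open>The braid relation in the form used from here on: conjugating \<open>x\<close> by
  \<open>y\<close> is traded for conjugating \<open>y\<close> by \<open>inv x\<close>, so that
  conjugators can be pushed from one half-twist to its neighbour.\<close>

lemma braid_conjg:
  assumes "x \<in> carrier G" "y \<in> carrier G" "x \<otimes> y \<otimes> x = y \<otimes> x \<otimes> y"
  shows "conjg G x y = conjg G y (inv x)" "conjg G y x = conjg G x (inv y)"
proof -
  have 1: "y \<otimes> (x \<otimes> y) = x \<otimes> (y \<otimes> x)" using assms by (simp add: m_assoc)
  have "y \<otimes> (inv y \<otimes> x \<otimes> y) \<otimes> x = y \<otimes> (x \<otimes> y \<otimes> inv x) \<otimes> x"
    using assms 1 by (simp add: m_assoc)
  then show "conjg G x y = conjg G y (inv x)"
    unfolding conjg_def using assms(1,2) by simp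
  have "x \<otimes> (inv x \<otimes> y \<otimes> x) \<otimes> y = x \<otimes> (y \<otimes> x \<otimes> inv y) \<otimes> y"
    using assms 1 by (simp add: m_assoc)
  then show "conjg G y x = conjg G x (inv y)"
    unfolding conjg_def using assms(1,2) by simp
qed

end

text \<open>Three consecutive half-twists, with the defining relation of the quotient as the last
  clause. The predicate is stable under reversal and conjugation, which spreads it from
  \<open>x 1, x 2, x 3\<close> to every consecutive triple.\<close>

definition transversal_triple :: "('a, 'b) monoid_scheme \<Rightarrow> 'a \<Rightarrow> 'a \<Rightarrow> 'a \<Rightarrow> bool" where
  "transversal_triple G a b d \<longleftrightarrow> a \<in> carrier G \<and> b \<in> carrier G \<and> d \<in> carrier G \<and>
    a \<otimes>\<^bsub>G\<^esub> d = d \<otimes>\<^bsub>G\<^esub> a \<and>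
    a \<otimes>\<^bsub>G\<^esub> b \<otimes>\<^bsub>G\<^esub> a = b \<otimes>\<^bsub>G\<^esub> a \<otimes>\<^bsub>G\<^esub> b \<and> b \<otimes>\<^bsub>G\<^esub> d \<otimes>\<^bsub>G\<^esub> b = d \<otimes>\<^bsub>G\<^esub> b \<otimes>\<^bsub>G\<^esub> d \<and>
    b \<otimes>\<^bsub>G\<^esub> conjg G b (a \<otimes>\<^bsub>G\<^esub> d) = conjg G b (a \<otimes>\<^bsub>G\<^esub> d) \<otimes>\<^bsub>G\<^esub> b"

context group
begin

lemma transversal_swap: "transversal_triple G a b d \<Longrightarrow> transversal_triple G d b a"
  unfolding transversal_triple_def by metis

lemma transversal_conjg:
  assumes "transversal_triple G a b d" "g \<in> carrier G"
  shows "transversal_triple G (conjg G a g) (conjg G b g) (conjg G d g)"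
proof -
  note t = assms(1)[unfolded transversal_triple_def]
  have [simp]: "a \<in> carrier G" "b \<in> carrier G" "d \<in> carrier G" using t by auto
  have "conjg G (conjg G b (a \<otimes> d)) g = conjg G (conjg G b g) (conjg G a g \<otimes> conjg G d g)"
    using assms(2) by (simp add: conjg_def m_assoc inv_mult_group)
  moreover have "conjg G b g \<otimes> conjg G (conjg G b (a \<otimes> d)) g
      = conjg G (conjg G b (a \<otimes> d)) g \<otimes> conjg G b g"
    using t assms(2) by (intro commute_conjg) auto
  ultimately show ?thesis
    unfolding transversal_triple_def using t assms(2)
    by (auto intro: commute_conjg simp flip: conjg_mult)
qed

text \<open>Conjugating the defining relation by \<open>a\<^sup>-\<^sup>1 b\<close>, respectively by \<open>a b\<^sup>-\<^sup>1\<close>,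
  turns it into a commutation with \<open>d\<close>.\<close>

lemma transversal_commute:
  assumes "transversal_triple G a b d"
  shows "d \<otimes> conjg G a (b \<otimes> b) = conjg G a (b \<otimes> b) \<otimes> d"
    and "d \<otimes> conjg G a (inv (b \<otimes> b)) = conjg G a (inv (b \<otimes> b)) \<otimes> d"
proof -
  note t = assms[unfolded transversal_triple_def]
  from t have [simp]: "a \<in> carrier G" "b \<in> carrier G" "d \<in> carrier G" by auto
  have ab: "conjg G a b = conjg G b (inv a)" "conjg G b a = conjg G a (inv b)"
    and bd: "conjg G b d = conjg G d (inv b)" "conjg G d b = conjg G b (inv d)"
    using braid_conjg t by auto
  have y: "conjg G b (a \<otimes> d) = conjg G (conjg G b d) a"
    using t by (simp add: conjg_conjg)
  have "conjg G (conjg G b (a \<otimes> d)) (inv a \<otimes> b) = d"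
    unfolding y bd by (simp add: conjg_conjg m_assoc)
  moreover have "conjg G b (inv a \<otimes> b) = conjg G a (b \<otimes> b)"
    using ab by (simp flip: conjg_conjg)
  moreover have "conjg G b (inv a \<otimes> b) \<otimes> conjg G (conjg G b (a \<otimes> d)) (inv a \<otimes> b)
      = conjg G (conjg G b (a \<otimes> d)) (inv a \<otimes> b) \<otimes> conjg G b (inv a \<otimes> b)"
    using t by (intro commute_conjg) auto
  ultimately show "d \<otimes> conjg G a (b \<otimes> b) = conjg G a (b \<otimes> b) \<otimes> d" by simp
  \<comment> \<open>One element in two forms: \<open>inv (a d) a inv b\<close> strips the conjugator
    \<open>a d\<close> from the second factor of the relation, and \<open>inv d inv b\<close>
    carries \<open>b\<close> to \<open>d\<close>.\<close>
  define h where "h = inv (a \<otimes> d) \<otimes> a \<otimes> inv b"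
  have h [simp]: "h \<in> carrier G" by (simp add: h_def)
  have h': "h = inv d \<otimes> inv b" by (simp add: h_def inv_mult_group m_assoc)
  have "conjg G b h = conjg G (conjg G d b) (inv b)"
    unfolding h' using bd by (simp flip: conjg_conjg)
  then have "conjg G b h = d" by simp
  moreover have "conjg G (conjg G b (a \<otimes> d)) h = conjg G a (inv (b \<otimes> b))"
  proof -
    have "conjg G (conjg G b (a \<otimes> d)) h = conjg G (conjg G b a) (inv b)"
      unfolding h_def by (simp add: conjg_conjg m_assoc)
    then show ?thesis using ab by (simp add: conjg_conjg inv_mult_group)
  qed
  moreover have "conjg G b h \<otimes> conjg G (conjg G b (a \<otimes> d)) h = conjg G (conjg G b (a \<otimes> d)) h \<otimes> conjg G b h"
    using t by (intro commute_conjg) auto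
  ultimately show "d \<otimes> conjg G a (inv (b \<otimes> b)) = conjg G a (inv (b \<otimes> b)) \<otimes> d" by simp
qed

text \<open>Only \<open>a\<close> and one conjugate of \<open>a\<close> occur on the right, and
  \<open>transversal_commute\<close> applies to both kinds of factor.\<close>

lemma commutator_sq_conjg:
  assumes "a \<in> carrier G" "b \<in> carrier G"
  shows "commutator G (a \<otimes> a) (b \<otimes> b)
    = a \<otimes> a \<otimes> inv (conjg G a (inv (b \<otimes> b)) \<otimes> conjg G a (inv (b \<otimes> b)))"
  using assms by (simp add: commutator_def conjg_def m_assoc inv_mult_group)

text \<open>Each commutator is a product of powers of \<open>a\<close> and of its conjugates by
  \<open>b^2\<close> or \<open>b^-2\<close>, all of which commute with \<open>d\<close>.\<close>

lemma transversal_fixes: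
  assumes "transversal_triple G a b d"
  shows "conjg G (commutator G (a \<otimes> a) (b \<otimes> b)) d = commutator G (a \<otimes> a) (b \<otimes> b)"
    and "conjg G (commutator G (inv a) (b \<otimes> b)) d = commutator G (inv a) (b \<otimes> b)"
    and "conjg G (commutator G (inv a) (inv (b \<otimes> b))) d = commutator G (inv a) (inv (b \<otimes> b))"
proof -
  note t = assms[unfolded transversal_triple_def]
  from t have [simp]: "a \<in> carrier G" "b \<in> carrier G" "d \<in> carrier G" by auto
  have da: "d \<otimes> a = a \<otimes> d" using t by simp
  note dc = transversal_commute(2)[OF assms]
  have "d \<otimes> commutator G (a \<otimes> a) (b \<otimes> b) = commutator G (a \<otimes> a) (b \<otimes> b) \<otimes> d"
    unfolding commutator_sq_conjg[OF \<open>a \<in> carrier G\<close> \<open>b \<in> carrier G\<close>]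
    using da dc by (intro commute_mult commute_inv) auto
  then show "conjg G (commutator G (a \<otimes> a) (b \<otimes> b)) d = commutator G (a \<otimes> a) (b \<otimes> b)"
    by (simp add: conjg_eq_iff_commute)
  have "commutator G (inv a) (b \<otimes> b) = inv a \<otimes> conjg G a (inv (b \<otimes> b))"
    by (simp add: commutator_def conjg_def m_assoc inv_mult_group)
  moreover have "d \<otimes> (inv a \<otimes> conjg G a (inv (b \<otimes> b))) = inv a \<otimes> conjg G a (inv (b \<otimes> b)) \<otimes> d"
    using da dc by (intro commute_mult commute_inv) auto
  ultimately show "conjg G (commutator G (inv a) (b \<otimes> b)) d = commutator G (inv a) (b \<otimes> b)"
    by (simp add: conjg_eq_iff_commute)
  have "commutator G (inv a) (inv (b \<otimes> b)) = inv a \<otimes> conjg G a (b \<otimes> b)"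
    by (simp add: commutator_def conjg_def m_assoc inv_mult_group)
  moreover have "d \<otimes> (inv a \<otimes> conjg G a (b \<otimes> b)) = inv a \<otimes> conjg G a (b \<otimes> b) \<otimes> d"
    using da transversal_commute(1)[OF assms] by (intro commute_mult commute_inv) auto
  ultimately show "conjg G (commutator G (inv a) (inv (b \<otimes> b))) d
      = commutator G (inv a) (inv (b \<otimes> b))"
    by (simp add: conjg_eq_iff_commute)
qed

text \<open>The first commutator is fixed by \<open>d\<close>, so conjugating it by \<open>b\<close>
  is the same as conjugating it by \<open>d b\<close>. That sends \<open>a\<close> and
  \<open>b\<close> to the conjugates of \<open>b\<close> and \<open>d\<close> by
  \<open>inv a\<close>, and the second commutator is fixed by \<open>a\<close>. The same argument
  with \<open>inv b\<close> gives the way back, so \<open>b\<close> exchanges the two.\<close>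

lemma transversal_shift:
  assumes "transversal_triple G a b d"
  shows "conjg G (commutator G (a \<otimes> a) (b \<otimes> b)) b = commutator G (b \<otimes> b) (d \<otimes> d)"
    and "conjg G (commutator G (b \<otimes> b) (d \<otimes> d)) b = commutator G (a \<otimes> a) (b \<otimes> b)"
proof -
  note t = assms[unfolded transversal_triple_def]
  from t have [simp]: "a \<in> carrier G" "b \<in> carrier G" "d \<in> carrier G" by auto
  have ab: "conjg G a b = conjg G b (inv a)" "conjg G b a = conjg G a (inv b)"
    and bd: "conjg G b d = conjg G d (inv b)" "conjg G d b = conjg G b (inv d)"
    using braid_conjg t by auto
  let ?c = "commutator G (a \<otimes> a) (b \<otimes> b)" and ?c' = "commutator G (b \<otimes> b) (d \<otimes> d)"
  have ad: "conjg G a d = a" "conjg G a (inv d) = a" "conjg G d a = d" "conjg G d (inv a) = d"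
    using t by (simp_all add: conjg_eq_iff_commute commute_inv conjg_fixed_inv)
  have c: "conjg G ?c d = ?c" using transversal_fixes[OF assms] by simp
  then have ci: "conjg G ?c (inv d) = ?c" by (simp add: conjg_fixed_inv)
  have c': "conjg G ?c' a = ?c'"
    using transversal_fixes(1)[OF transversal_swap[OF assms]]
    by (simp flip: inv_commutator[of "d \<otimes> d" "b \<otimes> b"] add: conjg_inv)
  then have ci': "conjg G ?c' (inv a) = ?c'" by (simp add: conjg_fixed_inv)
  have "conjg G ?c b = conjg G (conjg G ?c d) b" by (simp add: c)
  also have "\<dots> = conjg G ?c' (inv a)"
    by (simp add: conjg_commutator conjg_mult ad bd(1) ab(1))
  finally show "conjg G ?c b = ?c'" by (simp add: ci')
  have "conjg G ?c (inv b) = conjg G (conjg G ?c (inv d)) (inv b)" by (simp add: ci)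
  also have "\<dots> = conjg G ?c' a"
    by (simp add: conjg_commutator conjg_mult ad flip: bd(2) ab(2))
  finally have "conjg G ?c (inv b) = ?c'" by (simp add: c')
  then have "conjg G ?c' b = conjg G (conjg G ?c (inv b)) b" by simp
  then show "conjg G ?c' b = ?c" by simp
qed

lemma commutator_mult_left:
  assumes "x \<in> carrier G" "y \<in> carrier G" "z \<in> carrier G"
  shows "y \<otimes> z = z \<otimes> y \<Longrightarrow> commutator G (x \<otimes> y) z = commutator G x z"
    and "x \<otimes> z = z \<otimes> x \<Longrightarrow> commutator G (x \<otimes> y) z = conjg G (commutator G y z) (inv x)"
proof -
  have A: "commutator G (x \<otimes> y) z = x \<otimes> (y \<otimes> z) \<otimes> inv y \<otimes> inv x \<otimes> inv z"
    using assms by (simp add: commutator_def m_assoc inv_mult_group)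
  show "commutator G (x \<otimes> y) z = commutator G x z" if "y \<otimes> z = z \<otimes> y"
    unfolding A that using assms by (simp add: commutator_def m_assoc)
  assume "x \<otimes> z = z \<otimes> x"
  then have "inv z \<otimes> inv x = inv x \<otimes> inv z" using assms by (simp flip: inv_mult_group)
  then show "commutator G (x \<otimes> y) z = conjg G (commutator G y z) (inv x)"
    using assms by (simp add: commutator_def conjg_def m_assoc inv_mult_group)
qed

text \<open>Evaluating \<open>[u, y\<^sup>2]\<close> for \<open>u = [a\<^sup>-\<^sup>1, b\<^sup>2] = [a\<^sup>-\<^sup>1, y\<^sup>2]\<close> and \<open>y = d\<^sup>-\<^sup>1 b d\<close>
  in two ways.\<close>

lemma transversal_inverse:
  assumes "transversal_triple G a b d"
  shows "conjg G (commutator G (b \<otimes> b) (d \<otimes> d)) d = inv (commutator G (a \<otimes> a) (b \<otimes> b))"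
proof -
  note t = assms[unfolded transversal_triple_def]
  from t have [simp]: "a \<in> carrier G" "b \<in> carrier G" "d \<in> carrier G" by auto
  have ab: "conjg G a b = conjg G b (inv a)" "conjg G b a = conjg G a (inv b)"
    and bd: "conjg G b d = conjg G d (inv b)" "conjg G d b = conjg G b (inv d)"
    using braid_conjg t by auto
  let ?c = "commutator G (a \<otimes> a) (b \<otimes> b)" and ?c' = "commutator G (b \<otimes> b) (d \<otimes> d)"
  define y where "y = conjg G b d"
  define u where "u = commutator G (inv a) (b \<otimes> b)"
  have [simp]: "y \<in> carrier G" "u \<in> carrier G" by (simp_all add: y_def u_def)
  have u1: "u = conjg G (b \<otimes> b) a \<otimes> inv (b \<otimes> b)"
    by (simp add: u_def commutator_def conjg_def m_assoc)
  have ud: "conjg G u (inv d) = u"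
    using transversal_fixes(2)[OF assms] by (simp add: u_def conjg_fixed_inv)
  \<comment> \<open>First evaluation: \<open>u\<close> commutes with \<open>d\<close>, so
    conjugating by \<open>inv d\<close> turns \<open>y\<close> back into \<open>b\<close> without
    touching \<open>u\<close>.\<close>
  have "conjg G (commutator G u (y \<otimes> y)) (inv d) = commutator G u (b \<otimes> b)"
    by (simp add: conjg_commutator ud conjg_mult y_def)
  also have "\<dots> = commutator G (conjg G (b \<otimes> b) a) (b \<otimes> b)"
    unfolding u1 by (rule commutator_mult_left(1)) simp_all
  also have "\<dots> = conjg G ?c (inv b)"
    by (simp add: conjg_mult ab(2) conjg_commutator) (simp add: conjg_def m_assoc)
  also have "\<dots> = ?c'"
    using transversal_shift(2)[OF assms] by (metis conjg_conjg_inv(1) \<open>b \<in> carrier G\<close> \<open>d \<in> carrier G\<close> commutator_closed m_closed)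
  finally have L: "commutator G u (y \<otimes> y) = conjg G ?c' d"
    by (metis conjg_conjg_inv(2) \<open>d \<in> carrier G\<close> \<open>u \<in> carrier G\<close> \<open>y \<in> carrier G\<close> commutator_closed m_closed)
  \<comment> \<open>Second evaluation: \<open>u\<close> and \<open>y y\<close> are both conjugates
    by \<open>inv b\<close>, of \<open>a^2 b^-2\<close> and of \<open>d^2\<close>. As
    \<open>a\<close> commutes with \<open>d\<close>, only \<open>[b^-2, d^2]\<close>
    contributes.\<close>
  have u2: "u = conjg G (a \<otimes> a \<otimes> inv (b \<otimes> b)) (inv b)"
    unfolding u1 by (simp add: conjg_mult ab(2)) (simp add: conjg_def m_assoc inv_mult_group)
  have y2: "y \<otimes> y = conjg G (d \<otimes> d) (inv b)"
    by (simp add: y_def bd(1) conjg_mult)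
  have da: "d \<otimes> a = a \<otimes> d" using t by simp
  have aadd: "a \<otimes> a \<otimes> (d \<otimes> d) = d \<otimes> d \<otimes> (a \<otimes> a)"
    using da by (intro commute_mult) (simp_all add: commute_mult[symmetric])
  have cb: "conjg G ?c' (b \<otimes> b) = ?c'"
    using transversal_shift[OF assms] by (simp flip: conjg_conjg)
  have ca: "conjg G ?c' a = ?c'"
    using transversal_fixes(1)[OF transversal_swap[OF assms]]
    by (simp flip: inv_commutator[of "d \<otimes> d" "b \<otimes> b"] add: conjg_inv)
  have caa: "conjg G ?c' (inv (a \<otimes> a)) = ?c'"
    using ca by (intro conjg_fixed_inv) (simp_all flip: conjg_conjg)
  have "commutator G (inv (b \<otimes> b)) (d \<otimes> d) = inv (conjg G ?c' (b \<otimes> b))"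
    by (simp add: commutator_def conjg_def m_assoc inv_mult_group)
  then have e: "commutator G (inv (b \<otimes> b)) (d \<otimes> d) = inv ?c'" by (simp add: cb)
  have "commutator G u (y \<otimes> y)
      = conjg G (commutator G (a \<otimes> a \<otimes> inv (b \<otimes> b)) (d \<otimes> d)) (inv b)"
    unfolding u2 y2 by (simp add: conjg_commutator)
  also have "\<dots> = conjg G (inv ?c') (inv b)"
    using aadd by (simp add: commutator_mult_left(2) e conjg_inv caa)
  also have "\<dots> = inv ?c"
    using transversal_shift(1)[OF assms] by (simp add: conjg_inv flip: transversal_shift(1)[OF assms])
  finally show ?thesis using L by simp
qed

end

section \<open>Two adjacent half-twists and their elements \<open>u\<close>,
  \<open>u'\<close>\<close>

locale braid_pair = group G for G (structure) +
  fixes a b c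
  assumes a [simp]: "a \<in> carrier G" and b [simp]: "b \<in> carrier G"
    and braid: "a \<otimes> b \<otimes> a = b \<otimes> a \<otimes> b"
    and c_def: "c = commutator G (a \<otimes> a) (b \<otimes> b)"
    and ca: "conjg G c a = c" and cb: "conjg G c b = c"
begin

lemma c_closed [simp]: "c \<in> carrier G"
  by (simp add: c_def)

lemma a_conjg_b: "conjg G a b = conjg G b (inv a)" "conjg G b a = conjg G a (inv b)"
  using braid_conjg[OF a b braid] by auto

text \<open>Conjugation by the half turn \<open>a b a\<close> exchanges \<open>a\<close> and \<open>b\<close>, hence inverts \<open>c\<close>.\<close>

lemma c_involution: "c \<otimes> c = \<one>"
proof -
  have 1: "conjg G a (a \<otimes> (b \<otimes> a)) = b"
  proof -
    have "conjg G a (a \<otimes> (b \<otimes> a)) = conjg G (conjg G (conjg G a a) b) a"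
      by (simp add: conjg_conjg m_assoc)
    also have "conjg G a a = a" by (simp add: conjg_def)
    finally show ?thesis by (simp add: a_conjg_b(1))
  qed
  have 2: "conjg G b (a \<otimes> (b \<otimes> a)) = a"
  proof -
    have "conjg G b (a \<otimes> (b \<otimes> a)) = conjg G (conjg G (conjg G b a) b) a"
      by (simp add: conjg_conjg m_assoc)
    also have "\<dots> = conjg G a a" by (simp add: a_conjg_b(2))
    finally show ?thesis by (simp add: conjg_def)
  qed
  have "conjg G c (a \<otimes> (b \<otimes> a)) = c"
    using ca cb by (simp flip: conjg_conjg)
  moreover have "conjg G c (a \<otimes> (b \<otimes> a)) = commutator G (b \<otimes> b) (a \<otimes> a)"
    unfolding c_def by (simp add: conjg_commutator conjg_mult 1 2)
  ultimately have "c = inv c" by (simp add: c_def inv_commutator)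
  then have "c \<otimes> c = c \<otimes> inv c" by simp
  then show ?thesis by simp
qed

lemma c_inv [simp]: "inv c = c"
  using c_involution by (simp add: inv_equality)

lemma c_cancel [simp]: "z \<in> carrier G \<Longrightarrow> c \<otimes> (c \<otimes> z) = z"
  using c_involution by (simp flip: m_assoc)

text \<open>Oriented as rewrite rules that collect every \<open>c\<close> at the left end of a
  right-nested product, where \<open>c_cancel\<close> removes pairs.\<close>

lemma c_left:
  assumes "g \<in> generate G {a, b}"
  shows "g \<otimes> c = c \<otimes> g" "z \<in> carrier G \<Longrightarrow> g \<otimes> (c \<otimes> z) = c \<otimes> (g \<otimes> z)"
proof -
  have g: "g \<in> carrier G" using assms generate_in_carrier[of "{a, b}"] by auto
  have "subgroup {g \<in> carrier G. c \<otimes> g = g \<otimes> c} G"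
    by (rule subgroupI) (auto simp: commute_inv commute_mult)
  moreover have "{a, b} \<subseteq> {g \<in> carrier G. c \<otimes> g = g \<otimes> c}"
    using ca cb by (auto simp: conjg_eq_iff_commute)
  ultimately have "g \<in> {g \<in> carrier G. c \<otimes> g = g \<otimes> c}"
    using assms(1) generate_subgroup_incl by blast
  then show *: "g \<otimes> c = c \<otimes> g" by simp
  show "g \<otimes> (c \<otimes> z) = c \<otimes> (g \<otimes> z)" if "z \<in> carrier G"
    using g that * by (metis c_closed m_assoc)
qed

lemma ab_generate [simp]:
  "a \<in> generate G {a, b}" "b \<in> generate G {a, b}"
  "inv a \<in> generate G {a, b}" "inv b \<in> generate G {a, b}"
  by (auto intro: generate.intros)

lemmas c_moves = c_left[OF ab_generate(1)] c_left[OF ab_generate(2)]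
  c_left[OF ab_generate(3)] c_left[OF ab_generate(4)]

text \<open>The definition of \<open>c\<close> as a rewrite rule: moving \<open>a^2\<close> past
  \<open>b^2\<close> or \<open>b^-2\<close> costs one \<open>c\<close>. The trailing
  \<open>z\<close> lets the rule act inside right-nested products.\<close>

lemma sq_swap:
  assumes "z \<in> carrier G"
  shows "a \<otimes> (a \<otimes> (b \<otimes> (b \<otimes> z))) = c \<otimes> (b \<otimes> (b \<otimes> (a \<otimes> (a \<otimes> z))))"
    and "a \<otimes> (a \<otimes> (inv b \<otimes> (inv b \<otimes> z))) = c \<otimes> (inv b \<otimes> (inv b \<otimes> (a \<otimes> (a \<otimes> z))))"
proof -
  have A: "c \<otimes> (b \<otimes> b) \<otimes> (a \<otimes> a) = (a \<otimes> a) \<otimes> (b \<otimes> b)"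
    by (simp add: c_def commutator_def m_assoc inv_mult_group)
  then have "a \<otimes> a \<otimes> (b \<otimes> b) \<otimes> z = c \<otimes> (b \<otimes> b) \<otimes> (a \<otimes> a) \<otimes> z" by simp
  then show "a \<otimes> (a \<otimes> (b \<otimes> (b \<otimes> z))) = c \<otimes> (b \<otimes> (b \<otimes> (a \<otimes> (a \<otimes> z))))"
    using assms by (simp add: m_assoc)
  have "inv (b \<otimes> b) \<otimes> (c \<otimes> (b \<otimes> b) \<otimes> (a \<otimes> a)) \<otimes> inv (b \<otimes> b) \<otimes> z
      = inv (b \<otimes> b) \<otimes> (a \<otimes> a \<otimes> (b \<otimes> b)) \<otimes> inv (b \<otimes> b) \<otimes> z"
    by (simp add: A)
  then have "c \<otimes> (a \<otimes> (a \<otimes> (inv b \<otimes> (inv b \<otimes> z)))) = inv b \<otimes> (inv b \<otimes> (a \<otimes> (a \<otimes> z)))"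
    using assms by (simp add: m_assoc inv_mult_group c_moves)
  then have "c \<otimes> (c \<otimes> (a \<otimes> (a \<otimes> (inv b \<otimes> (inv b \<otimes> z))))) = c \<otimes> (inv b \<otimes> (inv b \<otimes> (a \<otimes> (a \<otimes> z))))"
    by simp
  then show "a \<otimes> (a \<otimes> (inv b \<otimes> (inv b \<otimes> z))) = c \<otimes> (inv b \<otimes> (inv b \<otimes> (a \<otimes> (a \<otimes> z))))"
    using assms by simp
qed

text \<open>\<open>u\<close> belongs to \<open>a\<close> and \<open>u'\<close> to \<open>b\<close>.
  That \<open>u'\<close> is the conjugate of \<open>u\<close> by \<open>b a\<close>, as the
  transport along the chain requires, is shown in \<open>u_conjg_ba\<close>.\<close>

definition u where "u = commutator G (inv a) (b \<otimes> b)"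
definition u' where "u' = commutator G (inv b) (inv (a \<otimes> a))"

lemma u_closed [simp]: "u \<in> carrier G" "u' \<in> carrier G"
  by (simp_all add: u_def u'_def)

lemma u_eq: "u = b \<otimes> a \<otimes> a \<otimes> inv b \<otimes> inv b \<otimes> inv b"
proof -
  have "u = conjg G (b \<otimes> b) a \<otimes> inv (b \<otimes> b)"
    by (simp add: u_def commutator_def conjg_def m_assoc)
  also have "conjg G (b \<otimes> b) a = conjg G (a \<otimes> a) (inv b)"
    by (simp add: conjg_mult a_conjg_b)
  finally show ?thesis by (simp add: conjg_def m_assoc inv_mult_group)
qed

lemma u'_eq: "u' = a \<otimes> inv b \<otimes> inv b \<otimes> a"
proof -
  have "u' = inv (conjg G (a \<otimes> a) b) \<otimes> (a \<otimes> a)"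
    by (simp add: u'_def commutator_def conjg_def m_assoc inv_mult_group)
  also have "conjg G (a \<otimes> a) b = conjg G (b \<otimes> b) (inv a)"
    by (simp add: conjg_mult a_conjg_b)
  finally show ?thesis by (simp add: conjg_def m_assoc inv_mult_group)
qed

text \<open>The pivot of the calculus: the quotient of adjacent squares is \<open>u u'\<close> up to
  \<open>c\<close>. Since \<open>u = b a^2 b^-3\<close> and \<open>u' = a b^-2 a\<close>, the
  conjugates of \<open>u\<close> by \<open>b\<close> and of \<open>u'\<close> by
  \<open>inv a\<close> are visibly this same quotient.\<close>

lemma c_u_u': "c \<otimes> (u \<otimes> u') = a \<otimes> a \<otimes> inv (b \<otimes> b)"
proof -
  have "u' = inv (conjg G (a \<otimes> a) b) \<otimes> (a \<otimes> a)"
    by (simp add: u'_def commutator_def conjg_def m_assoc inv_mult_group)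
  then have "c \<otimes> (u \<otimes> u') = c \<otimes> (b \<otimes> (a \<otimes> a \<otimes> inv b \<otimes> inv b \<otimes> inv b \<otimes> inv b \<otimes> inv a \<otimes> inv a) \<otimes> b \<otimes> a \<otimes> a)"
    by (simp add: u_eq conjg_def m_assoc inv_mult_group)
  also have "\<dots> = c \<otimes> (inv b \<otimes> inv b \<otimes> a \<otimes> a)"
    by (simp add: m_assoc sq_swap c_moves)
  also have "\<dots> = a \<otimes> a \<otimes> inv (b \<otimes> b)"
    using sq_swap(2)[of \<one>] by (simp add: m_assoc inv_mult_group)
  finally show ?thesis .
qed

lemma u_conjg_b: "conjg G u b = c \<otimes> (u \<otimes> u')"
  unfolding c_u_u' by (simp add: u_eq conjg_def m_assoc inv_mult_group)

lemma u'_conjg_a_inv: "conjg G u' (inv a) = c \<otimes> (u \<otimes> u')"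
  unfolding c_u_u' by (simp add: u'_eq conjg_def m_assoc inv_mult_group)

text \<open>The half-twist acts on its own \<open>u\<close> as a reflection; the factor
  \<open>c\<close> is the price of moving \<open>a^2\<close> past \<open>b^-2\<close>.\<close>

lemma u_conjg_a_inv: "conjg G u (inv a) = c \<otimes> inv u"
proof -
  have "c \<otimes> inv u = b \<otimes> b \<otimes> inv a \<otimes> (c \<otimes> inv b \<otimes> inv b) \<otimes> a"
    by (simp add: u_def commutator_def m_assoc inv_mult_group c_moves)
  also have "c \<otimes> inv b \<otimes> inv b = a \<otimes> a \<otimes> inv b \<otimes> inv b \<otimes> inv a \<otimes> inv a"
    by (simp add: m_assoc sq_swap)
  finally show ?thesis
    by (simp add: u_def commutator_def conjg_def m_assoc inv_mult_group)
qed

lemma u'_conjg_b_inv: "conjg G u' (inv b) = c \<otimes> inv u'"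
proof -
  have "c \<otimes> inv u' = inv a \<otimes> inv a \<otimes> inv b \<otimes> (c \<otimes> a \<otimes> a) \<otimes> b"
    by (simp add: u'_def commutator_def m_assoc inv_mult_group c_moves)
  also have "c \<otimes> a \<otimes> a = b \<otimes> b \<otimes> a \<otimes> a \<otimes> inv b \<otimes> inv b"
    using sq_swap(2)[of \<one>] by (simp add: m_assoc c_moves)
  finally show ?thesis
    by (simp add: u'_def commutator_def conjg_def m_assoc inv_mult_group)
qed

text \<open>\<open>u\<close> conjugated by \<open>b\<close> and \<open>u'\<close> conjugated by
  \<open>inv a\<close> are both equal to \<open>a^2 b^-2\<close>.\<close>

lemma u_conjg_ba: "conjg G u (b \<otimes> a) = u'"
proof -
  have "conjg G u b = conjg G u' (inv a)"
    by (simp add: u_conjg_b u'_conjg_a_inv)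
  then show ?thesis by (simp flip: conjg_conjg)
qed

lemma conjg_c [simp]: "conjg G c a = c" "conjg G c b = c" "conjg G c (inv a) = c"
    "conjg G c (inv b) = c"
  by (simp_all add: ca cb conjg_fixed_inv)

lemma conjg_c_mult: "z \<in> carrier G \<Longrightarrow> g \<in> {a, b, inv a, inv b} \<Longrightarrow>
    conjg G (c \<otimes> z) g = c \<otimes> conjg G z g"
  by (auto simp: conjg_mult)

text \<open>Here and in the next formulas, an identity for the opposite conjugator is conjugated
  back and solved for the unknown term.\<close>

lemma u_conjg_a: "conjg G u a = c \<otimes> inv u"
proof -
  have "u = c \<otimes> inv (conjg G u a)"
    using arg_cong[OF u_conjg_a_inv, of "\<lambda>z. conjg G z a"] by (simp add: conjg_c_mult conjg_inv)
  then have "c \<otimes> u = inv (conjg G u a)" using c_cancel by (metis conjg_closed inv_closed u_closed(1) a)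
  then have "inv (c \<otimes> u) = conjg G u a" by simp
  moreover have "c \<otimes> u = u \<otimes> c"
    by (simp add: u_eq c_moves m_assoc)
  ultimately show ?thesis by (simp add: inv_mult_group)
qed

lemma u'_conjg_b: "conjg G u' b = c \<otimes> inv u'"
proof -
  have "u' = c \<otimes> inv (conjg G u' b)"
    using arg_cong[OF u'_conjg_b_inv, of "\<lambda>z. conjg G z b"] by (simp add: conjg_c_mult conjg_inv)
  then have "c \<otimes> u' = inv (conjg G u' b)" using c_cancel by (metis conjg_closed inv_closed u_closed(2) b)
  then have "inv (c \<otimes> u') = conjg G u' b" by simp
  moreover have "c \<otimes> u' = u' \<otimes> c"
    by (simp add: u'_eq c_moves m_assoc)
  ultimately show ?thesis by (simp add: inv_mult_group)
qed

lemma u_c: "u \<otimes> c = c \<otimes> u" "z \<in> carrier G \<Longrightarrow> u \<otimes> (c \<otimes> z) = c \<otimes> (u \<otimes> z)"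
    "u' \<otimes> c = c \<otimes> u'" "z \<in> carrier G \<Longrightarrow> u' \<otimes> (c \<otimes> z) = c \<otimes> (u' \<otimes> z)"
  by (simp_all add: u_eq u'_eq c_moves m_assoc)

lemma u'_conjg_a: "conjg G u' a = u \<otimes> u'"
proof -
  have "u' = c \<otimes> (c \<otimes> inv u \<otimes> conjg G u' a)"
    using arg_cong[OF u'_conjg_a_inv, of "\<lambda>z. conjg G z a"]
    by (simp add: conjg_c_mult conjg_mult u_conjg_a)
  then have "u \<otimes> u' = u \<otimes> (inv u \<otimes> conjg G u' a)" by (simp add: m_assoc)
  then show ?thesis by simp
qed

lemma u_conjg_b_inv: "conjg G u (inv b) = u \<otimes> u'"
proof -
  have "u = c \<otimes> (conjg G u (inv b) \<otimes> (c \<otimes> inv u'))"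
    using arg_cong[OF u_conjg_b, of "\<lambda>z. conjg G z (inv b)"]
    by (simp add: conjg_c_mult conjg_mult u'_conjg_b_inv)
  moreover have "conjg G u (inv b) \<otimes> (c \<otimes> inv u') = c \<otimes> (conjg G u (inv b) \<otimes> inv u')"
    by (simp add: conjg_def u_eq m_assoc c_moves)
  ultimately have "u \<otimes> u' = conjg G u (inv b) \<otimes> inv u' \<otimes> u'" by simp
  then show ?thesis by (simp add: m_assoc)
qed

text \<open>\<open>u\<close> commutes with \<open>a^2\<close>, and with \<open>b^2\<close> up to a
  factor \<open>c\<close>. Hence it commutes up to \<open>c\<close> with
  \<open>a^2 b^-2 = c u u'\<close>, and cancelling \<open>u\<close> leaves the claim.\<close>

lemma commutator_u_u': "commutator G u u' = c"
proof -
  have 1: "u \<otimes> (a \<otimes> a) = a \<otimes> a \<otimes> u"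
  proof -
    have "conjg G u (a \<otimes> a) = conjg G (conjg G u a) a" by (simp add: conjg_conjg)
    also have "\<dots> = c \<otimes> inv (c \<otimes> inv u)" by (simp add: u_conjg_a conjg_c_mult conjg_inv)
    also have "\<dots> = u" by (simp add: inv_mult_group u_c)
    finally show ?thesis by (simp add: conjg_eq_iff_commute)
  qed
  have 2: "conjg G u (b \<otimes> b) = c \<otimes> u"
  proof -
    have "conjg G u (b \<otimes> b) = conjg G (conjg G u b) b" by (simp add: conjg_conjg)
    also have "\<dots> = c \<otimes> (c \<otimes> (u \<otimes> u') \<otimes> (c \<otimes> inv u'))"
      by (simp add: u_conjg_b conjg_c_mult conjg_mult u'_conjg_b)
    also have "\<dots> = c \<otimes> u" by (simp add: m_assoc u_c)
    finally show ?thesis .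
  qed
  have "conjg G u (inv (b \<otimes> b)) = c \<otimes> u"
  proof -
    have "u = c \<otimes> conjg G u (inv (b \<otimes> b))"
      using arg_cong[OF 2, of "\<lambda>z. conjg G z (inv (b \<otimes> b))"]
      by (simp add: inv_mult_group conjg_c_mult flip: conjg_conjg)
    then show ?thesis by (metis c_cancel conjg_closed inv_closed m_closed b u_closed(1))
  qed
  then have "inv (b \<otimes> b) \<otimes> conjg G u (inv (b \<otimes> b)) = inv (b \<otimes> b) \<otimes> (c \<otimes> u)" by simp
  then have 3: "u \<otimes> inv (b \<otimes> b) = c \<otimes> (inv (b \<otimes> b) \<otimes> u)"
    by (simp add: conjg_def m_assoc inv_mult_group c_moves)
  have "u \<otimes> (u \<otimes> u') = c \<otimes> (u \<otimes> u') \<otimes> u"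
  proof -
    have "c \<otimes> (u \<otimes> (u \<otimes> u')) = u \<otimes> (c \<otimes> (u \<otimes> u'))" by (simp add: u_c)
    also have "\<dots> = u \<otimes> (a \<otimes> a) \<otimes> inv (b \<otimes> b)" unfolding c_u_u' by (simp add: m_assoc)
    also have "\<dots> = a \<otimes> a \<otimes> (c \<otimes> (inv (b \<otimes> b) \<otimes> u))"
      by (simp add: 1 3[symmetric] m_assoc)
    also have "\<dots> = c \<otimes> (a \<otimes> a \<otimes> inv (b \<otimes> b) \<otimes> u)" by (simp add: m_assoc c_moves)
    also have "\<dots> = u \<otimes> u' \<otimes> u" by (simp flip: c_u_u' add: m_assoc)
    finally show ?thesis by (metis c_cancel m_assoc m_closed c_closed u_closed)
  qed
  also have "\<dots> = u \<otimes> (c \<otimes> (u' \<otimes> u))" by (simp add: m_assoc u_c)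
  finally have "u \<otimes> u' = c \<otimes> (u' \<otimes> u)" by simp
  then show ?thesis by (simp add: commutator_def m_assoc)
qed

end

section \<open>The central element \<open>c\<close> and the chain
  \<open>u 1, ..., u (n - 1)\<close>\<close>

locale tilde_braid = group G for G (structure) +
  fixes n :: nat and x :: "nat \<Rightarrow> 'a"
  assumes n: "5 \<le> n"
    and x_closed: "i \<in> {1..<n} \<Longrightarrow> x i \<in> carrier G"
    and far: "1 \<le> i \<Longrightarrow> i + 1 < j \<Longrightarrow> j < n \<Longrightarrow> x i \<otimes> x j = x j \<otimes> x i"
    and braid: "1 \<le> i \<Longrightarrow> i + 1 < n \<Longrightarrow> x i \<otimes> x (i + 1) \<otimes> x i = x (i + 1) \<otimes> x i \<otimes> x (i + 1)"
    and trans: "x 2 \<otimes> conjg G (x 2) (x 1 \<otimes> x 3) = conjg G (x 2) (x 1 \<otimes> x 3) \<otimes> x 2"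
    and generated: "carrier G = generate G (x ` {1..<n})"
begin

lemma x_carrier [simp]: "1 \<le> i \<Longrightarrow> i < n \<Longrightarrow> x i \<in> carrier G"
  using x_closed by simp

lemma far_fixed:
  assumes "i \<in> {1..<n}" "j \<in> {1..<n}" "i + 1 < j \<or> j + 1 < i"
  shows "conjg G (x i) (x j) = x i"
proof -
  have "x i \<otimes> x j = x j \<otimes> x i" using far[of i j] far[of j i] assms by auto
  then show ?thesis using assms by (simp add: conjg_eq_iff_commute)
qed

lemma commutator_fixed:
  assumes "y \<in> carrier G" "z \<in> carrier G" "g \<in> carrier G" "conjg G y g = y" "conjg G z g = z"
  shows "conjg G (commutator G y z) g = commutator G y z"
  using assms by (simp add: conjg_commutator)

lemma braid_chain:
  assumes "a \<in> carrier G" "b \<in> carrier G" "a \<otimes> b \<otimes> a = b \<otimes> a \<otimes> b"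
  shows "conjg G (conjg G a (inv b)) (inv a) = b"
  using braid_conjg(2)[OF assms] assms(1,2) by (metis conjg_conjg_inv(1))

text \<open>The relation is assumed for the first triple only; conjugation by a suitable word moves
  a triple one place up the chain.\<close>

lemma triple: "1 \<le> i \<Longrightarrow> i + 2 < n \<Longrightarrow> transversal_triple G (x i) (x (i + 1)) (x (i + 2))"
proof (induction i rule: nat_induct_at_least)
  case base
  show ?case unfolding transversal_triple_def
    using n trans braid[of 1] braid[of 2] far[of 1 3] by (simp add: numeral_eq_Suc)
next
  case (Suc i)
  define a b d e where "a = x i" and "b = x (i + 1)" and "d = x (i + 2)" and "e = x (i + 3)"
  note defs = a_def b_def d_def e_def
  have [simp]: "a \<in> carrier G" "b \<in> carrier G" "d \<in> carrier G" "e \<in> carrier G"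
    using Suc by (auto simp: defs)
  \<comment> \<open>By \<open>braid_chain\<close>, two neighbouring letters of this word carry each
    half-twist to the next one, and the other letters commute with it.\<close>
  define w where "w = inv e \<otimes> (inv d \<otimes> (inv b \<otimes> inv a))"
  have w: "conjg G y w = conjg G (conjg G (conjg G (conjg G y (inv e)) (inv d)) (inv b)) (inv a)"
    if "y \<in> carrier G" for y
    using that by (simp add: w_def conjg_conjg m_assoc)
  have fx: "conjg G a (inv d) = a" "conjg G a (inv e) = a" "conjg G b (inv e) = b"
    "conjg G d (inv a) = d" "conjg G e (inv a) = e" "conjg G e (inv b) = e"
    using Suc by (auto simp: defs intro!: conjg_fixed_inv far_fixed)
  have ch: "conjg G (conjg G a (inv b)) (inv a) = b" "conjg G (conjg G b (inv d)) (inv b) = d"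
    "conjg G (conjg G d (inv e)) (inv d) = e"
    using Suc braid[of i] braid[of "i + 1"] braid[of "i + 2"]
    by (auto simp: defs numeral_eq_Suc intro!: braid_chain)
  have "transversal_triple G a b d" using Suc by (simp add: defs)
  then have "transversal_triple G (conjg G a w) (conjg G b w) (conjg G d w)"
    by (rule transversal_conjg) (simp add: w_def)
  then show ?case by (simp add: w fx ch) (simp add: defs numeral_eq_Suc)
qed

definition c where "c = commutator G (x 1 \<otimes> x 1) (x 2 \<otimes> x 2)"

lemma c_closed [simp]: "c \<in> carrier G"
  using n by (simp add: c_def)

text \<open>\<open>c\<close> has two expressions. The one in \<open>x 1, x 2\<close> is fixed by
  \<open>x 3\<close> (transversality) and by all later generators (far commutation); the one in
  \<open>x 4, x 3\<close> is fixed by \<open>x 1\<close> (far) and \<open>x 2\<close>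
  (transversality). This is where \<open>x 4\<close>, hence \<open>5 \<le> n\<close>, is
  used.\<close>

lemma conjg_c_x: "i \<in> {1..<n} \<Longrightarrow> conjg G c (x i) = c"
proof -
  have [simp]: "x 1 \<in> carrier G" "x (Suc 0) \<in> carrier G" "x 2 \<in> carrier G" "x 3 \<in> carrier G" "x 4 \<in> carrier G"
    using n by simp_all
  let ?c34 = "commutator G (x 3 \<otimes> x 3) (x 4 \<otimes> x 4)"
  have t1: "transversal_triple G (x 1) (x 2) (x 3)" using triple[of 1] n by (simp add: numeral_eq_Suc)
  have t2: "transversal_triple G (x 2) (x 3) (x 4)" using triple[of 2] n by (simp add: numeral_eq_Suc)
  have "inv c = ?c34"
    using transversal_inverse[OF t1] transversal_shift(1)[OF t2] by (simp add: c_def)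
  then have c34: "c = inv ?c34" by (metis c_closed inv_inv)
  have c43: "c = commutator G (x 4 \<otimes> x 4) (x 3 \<otimes> x 3)" unfolding c34 by (simp add: inv_commutator)
  assume i: "i \<in> {1..<n}"
  consider "i = 1" | "i = 2" | "i = 3" | "i \<ge> 4" using i by force
  then show ?thesis
  proof cases
    case 1
    then show ?thesis unfolding c43
      using n i by (auto intro!: commutator_fixed simp: conjg_mult far_fixed)
  next
    case 2
    then show ?thesis unfolding c43
      using transversal_fixes(1)[OF transversal_swap[OF t2]] by simp
  next
    case 3
    then show ?thesis unfolding c_def using transversal_fixes(1)[OF t1] by simp
  next
    case 4
    then show ?thesis unfolding c_def
      using n i by (auto intro!: commutator_fixed simp: conjg_mult far_fixed)
  qed
qed

lemma c_central:
  assumes "g \<in> carrier G"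
  shows "g \<otimes> c = c \<otimes> g"
proof -
  have "subgroup {g \<in> carrier G. c \<otimes> g = g \<otimes> c} G"
    by (rule subgroupI) (auto simp: commute_inv commute_mult)
  moreover have "x ` {1..<n} \<subseteq> {g \<in> carrier G. c \<otimes> g = g \<otimes> c}"
    using conjg_c_x by (auto simp: conjg_eq_iff_commute)
  ultimately have "carrier G \<subseteq> {g \<in> carrier G. c \<otimes> g = g \<otimes> c}"
    unfolding generated using generate_subgroup_incl by blast
  then show ?thesis using assms by auto
qed

lemma c_moves: "g \<in> carrier G \<Longrightarrow> z \<in> carrier G \<Longrightarrow> g \<otimes> (c \<otimes> z) = c \<otimes> (g \<otimes> z)"
  by (metis c_central c_closed m_assoc)

lemma conjg_c: "g \<in> carrier G \<Longrightarrow> conjg G c g = c"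
  by (simp add: conjg_eq_iff_commute c_central)

lemma c_consecutive: "1 \<le> i \<Longrightarrow> i + 1 < n \<Longrightarrow> commutator G (x i \<otimes> x i) (x (i + 1) \<otimes> x (i + 1)) = c"
proof (induction i rule: nat_induct_at_least)
  case base
  then show ?case by (simp add: c_def numeral_eq_Suc)
next
  case (Suc i)
  then show ?case
    using transversal_shift(1)[OF triple[of i]] by (simp add: conjg_c)
qed

lemma pair: "1 \<le> i \<Longrightarrow> i + 1 < n \<Longrightarrow> braid_pair G (x i) (x (i + 1)) c"
  using braid[of i] c_consecutive[of i] by unfold_locales (auto simp: conjg_c)

lemma c_involution: "c \<otimes> c = \<one>"
  using braid_pair.c_involution[OF pair[of 1]] n by simp

lemma c_inv [simp]: "inv c = c"
  using c_involution by (simp add: inv_equality)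

text \<open>\<open>u 0\<close> is a dummy. The recursion makes all \<open>u i\<close> conjugate to
  \<open>u 1\<close> by construction; the local description by neighbouring half-twists is then
  derived in \<open>u_right\<close> and \<open>u_left\<close>.\<close>

primrec u :: "nat \<Rightarrow> 'a" where
  "u 0 = \<one>"
| "u (Suc i) = (if i = 0 then commutator G (inv (x 1)) (x 2 \<otimes> x 2) else conjg G (u i) (x (i + 1) \<otimes> x i))"

lemma u_step: "1 \<le> i \<Longrightarrow> u (i + 1) = conjg G (u i) (x (i + 1) \<otimes> x i)"
  by simp

lemma u_closed [simp]: "i < n \<Longrightarrow> u i \<in> carrier G"
proof (induction i)
  case (Suc i)
  then show ?case using n by (cases "i = 0") auto
qed simp

text \<open>Both forms are needed: the last index has no right neighbour and the first no left one.
  The left form of \<open>u (i + 1)\<close> follows from the right form of \<open>u i\<close> inside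
  the pair \<open>x i, x (i + 1)\<close>.\<close>

lemma u_right: "1 \<le> i \<Longrightarrow> i + 1 < n \<Longrightarrow> u i = commutator G (inv (x i)) (x (i + 1) \<otimes> x (i + 1))"
  and u_left: "1 \<le> i \<Longrightarrow> i + 1 < n \<Longrightarrow> u (i + 1) = commutator G (inv (x (i + 1))) (inv (x i \<otimes> x i))"
proof -
  have L: "u (i + 1) = commutator G (inv (x (i + 1))) (inv (x i \<otimes> x i))"
    if "u i = commutator G (inv (x i)) (x (i + 1) \<otimes> x (i + 1))" "1 \<le> i" "i + 1 < n" for i
  proof -
    interpret p: braid_pair G "x i" "x (Suc i)" c using pair[of i] that by simp
    show ?thesis using u_step[of i] p.u_conjg_ba that by (simp add: p.u_def p.u'_def del: u.simps)
  qed
  show R: "u i = commutator G (inv (x i)) (x (i + 1) \<otimes> x (i + 1))" if "1 \<le> i" "i + 1 < n" for i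
    using that
  proof (induction i rule: nat_induct_at_least)
    case base
    then show ?case by (simp add: numeral_eq_Suc)
  next
    case (Suc i)
    define a b d where "a = x i" and "b = x (i + 1)" and "d = x (i + 2)"
    note defs = a_def b_def d_def
    have t: "transversal_triple G a b d" using triple[of i] Suc by (simp add: defs)
    have [simp]: "a \<in> carrier G" "b \<in> carrier G" "d \<in> carrier G"
      using Suc by (auto simp: defs)
    have ui: "u i = commutator G (inv a) (b \<otimes> b)" using Suc by (simp add: defs)
    have bd: "conjg G b d = conjg G d (inv b)" and ab: "conjg G a b = conjg G b (inv a)"
      using t braid_conjg by (auto simp: transversal_triple_def)
    have ad: "conjg G a d = a" "conjg G d (inv a) = d"
      using t by (auto simp: transversal_triple_def conjg_eq_iff_commute commute_inv)
    \<comment> \<open>As \<open>d\<close> fixes \<open>u i\<close>, conjugation by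
      \<open>d b\<close> may replace conjugation by \<open>b\<close>; it carries the pair
      \<open>a, b\<close> to the pair \<open>b, d\<close> up to \<open>inv a\<close>, which the
      final factor \<open>a\<close> removes.\<close>
    have "conjg G (u i) b = conjg G (conjg G (u i) d) b"
      using transversal_fixes(2)[OF t] by (simp add: ui)
    also have "\<dots> = conjg G (commutator G (inv b) (d \<otimes> d)) (inv a)"
      unfolding ui by (simp add: conjg_commutator conjg_mult conjg_inv ad bd ab)
    finally have "conjg G (u i) (b \<otimes> a) = commutator G (inv b) (d \<otimes> d)"
      using Suc by (simp flip: conjg_conjg)
    then show ?case using u_step[of i] Suc by (simp add: defs)
  qed
  show "1 \<le> i \<Longrightarrow> i + 1 < n \<Longrightarrow> u (i + 1) = commutator G (inv (x (i + 1))) (inv (x i \<otimes> x i))"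
    using L R by blast
qed

text \<open>The commutator form of \<open>u i\<close> is taken on the side of \<open>j\<close>. At
  distance two \<open>transversal_fixes\<close> applies; further away \<open>x j\<close> commutes
  with every letter.\<close>

lemma u_far:
  assumes "i \<in> {1..<n}" "j \<in> {1..<n}" "i + 1 < j \<or> j + 1 < i"
  shows "conjg G (u i) (x j) = u i"
proof -
  consider "j = i + 2" | "j > i + 2" | "i = j + 2" | "i > j + 2" using assms by linarith
  then show ?thesis
  proof cases
    case 1
    then show ?thesis
      using assms transversal_fixes(2)[OF triple[of i]] u_right[of i] by simp
  next
    case 2
    then show ?thesis
      using assms u_right[of i]
      by (auto intro!: commutator_fixed simp: conjg_mult conjg_inv far_fixed)
  next
    case 3
    then have "1 \<le> j" "j + 2 < n" "i = Suc (Suc j)" using assms by auto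
    then show ?thesis
      using assms transversal_fixes(3)[OF transversal_swap[OF triple[of j]]] u_left[of "j + 1"]
      by simp
  next
    case 4
    then have "i = (i - 1) + 1" "1 \<le> i - 1" using assms by auto
    then obtain k where "i = k + 1" "1 \<le> k" by blast
    then show ?thesis
      using assms 4 u_left[of k]
      by (auto intro!: commutator_fixed simp: conjg_mult conjg_inv far_fixed)
  qed
qed

lemma u_adjacent:
  assumes "1 \<le> i" "i + 1 < n"
  shows "conjg G (u i) (x (i + 1)) = c \<otimes> (u i \<otimes> u (i + 1))"
    and "conjg G (u i) (inv (x (i + 1))) = u i \<otimes> u (i + 1)"
    and "conjg G (u (i + 1)) (x i) = u i \<otimes> u (i + 1)"
    and "conjg G (u (i + 1)) (inv (x i)) = c \<otimes> (u i \<otimes> u (i + 1))"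
    and "commutator G (u i) (u (i + 1)) = c"
proof -
  interpret p: braid_pair G "x i" "x (Suc i)" c using pair[of i] assms by simp
  have "u i = p.u" "u (i + 1) = p.u'"
    using u_right[of i] u_left[of i] assms by (simp_all add: p.u_def p.u'_def del: u.simps)
  then show "conjg G (u i) (x (i + 1)) = c \<otimes> (u i \<otimes> u (i + 1))"
    and "conjg G (u i) (inv (x (i + 1))) = u i \<otimes> u (i + 1)"
    and "conjg G (u (i + 1)) (x i) = u i \<otimes> u (i + 1)"
    and "conjg G (u (i + 1)) (inv (x i)) = c \<otimes> (u i \<otimes> u (i + 1))"
    and "commutator G (u i) (u (i + 1)) = c"
    using p.u_conjg_b p.u_conjg_b_inv p.u'_conjg_a p.u'_conjg_a_inv p.commutator_u_u' by (simp_all del: u.simps)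
qed

lemma u_self:
  assumes "i \<in> {1..<n}"
  shows "conjg G (u i) (x i) = c \<otimes> inv (u i)" "conjg G (u i) (inv (x i)) = c \<otimes> inv (u i)"
proof -
  have "conjg G (u i) (x i) = c \<otimes> inv (u i) \<and> conjg G (u i) (inv (x i)) = c \<otimes> inv (u i)"
  proof (cases "i + 1 < n")
    case True
    then interpret p: braid_pair G "x i" "x (Suc i)" c using pair[of i] assms by simp
    show ?thesis using u_right[of i] True assms p.u_conjg_a p.u_conjg_a_inv by (simp add: p.u_def del: u.simps)
  next
    \<comment> \<open>The last index has no right neighbour, so it is treated as the second member
      of the pair to its left.\<close>
    case False
    then have "i = (i - 1) + 1" "1 \<le> i - 1" using assms n by auto
    then obtain k where k: "i = k + 1" "1 \<le> k" by blast
    interpret p: braid_pair G "x k" "x (Suc k)" c using pair[of k] assms k by simp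
    show ?thesis using u_left[of k] k assms p.u'_conjg_b p.u'_conjg_b_inv by (simp add: p.u'_def del: u.simps)
  qed
  then show "conjg G (u i) (x i) = c \<otimes> inv (u i)" "conjg G (u i) (inv (x i)) = c \<otimes> inv (u i)"
    by auto
qed

end

lemma (in group) normalI_conjg:
  assumes "subgroup N G" "\<And>h g. h \<in> N \<Longrightarrow> g \<in> carrier G \<Longrightarrow> conjg G h g \<in> N"
  shows "N \<lhd> G"
proof -
  have "g \<otimes> h \<otimes> inv g \<in> N" if "g \<in> carrier G" "h \<in> N" for g h
    using assms(2)[of h "inv g"] that by (simp add: conjg_def)
  then show ?thesis using assms(1) normal_inv_iff by blast
qed

lemma (in normal) conjg_mem: "h \<in> H \<Longrightarrow> g \<in> carrier G \<Longrightarrow> conjg G h g \<in> H"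
  using inv_op_closed1 by (simp add: conjg_def)

lemma (in normal) commutator_mem:
  assumes "h \<in> H" "g \<in> carrier G"
  shows "commutator G h g \<in> H" "commutator G g h \<in> H"
proof -
  have h: "h \<in> carrier G" using assms by (simp add: mem_carrier)
  have "commutator G h g = h \<otimes> conjg G (inv h) (inv g)"
    using h assms by (simp add: commutator_def conjg_def m_assoc)
  then show "commutator G h g \<in> H" using assms by (simp add: conjg_mem)
  have "commutator G g h = conjg G h (inv g) \<otimes> inv h"
    using h assms by (simp add: commutator_def conjg_def m_assoc)
  then show "commutator G g h \<in> H" using assms by (simp add: conjg_mem)
qed

text \<open>Both signs of \<open>s\<close> are in the hypothesis, because a conjugation that maps a
  subgroup into itself need not map it onto itself.\<close>

lemma (in group) normal_generate_conjg:
  assumes S: "S \<subseteq> carrier G" and T: "T \<subseteq> carrier G" and G: "carrier G = generate G S"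
    and conj: "\<And>t s. t \<in> T \<Longrightarrow> s \<in> S \<Longrightarrow>
      conjg G t s \<in> generate G T \<and> conjg G t (inv s) \<in> generate G T"
  shows "generate G T \<lhd> G"
proof (rule normalI_conjg)
  show sub: "subgroup (generate G T) G" by (rule generate_is_subgroup[OF T])
  interpret sub: subgroup "generate G T" G by (rule sub)
  have step: "conjg G h g \<in> generate G T"
    if g: "g \<in> carrier G" and gen: "\<And>t. t \<in> T \<Longrightarrow> conjg G t g \<in> generate G T"
      and h: "h \<in> generate G T" for g h
    using h
  proof (induction rule: generate.induct)
    case (inv t)
    then have "t \<in> carrier G" using T by auto
    then show ?case using inv gen g by (simp add: conjg_inv)
  next
    case (eng h1 h2)
    then show ?case using g by (simp add: conjg_mult sub.mem_carrier)
  qed (use g gen in \<open>auto intro: generate.intros\<close>)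
  have "\<forall>h \<in> generate G T. conjg G h g \<in> generate G T" if "g \<in> generate G S" for g
    using that
  proof (induction rule: generate.induct)
    case (eng g1 g2)
    have "g1 \<in> carrier G" "g2 \<in> carrier G" using eng generate_in_carrier[OF S] by auto
    then show ?case using eng by (simp flip: conjg_conjg add: sub.mem_carrier)
  next
    case one
    then show ?case by (simp add: sub.mem_carrier)
  next
    case (incl g)
    then show ?case using S conj by (blast intro: step)
  next
    case (inv g)
    then show ?case using S conj by (blast intro: step)
  qed
  then show "conjg G h g \<in> generate G T" if "h \<in> generate G T" "g \<in> carrier G" for h g
    using that G by auto
qed

section \<open>The Coxeter presentation of the symmetric group\<close>

locale coxeter = group G for G (structure) +
  fixes n :: nat and s :: "nat \<Rightarrow> 'a"
  assumes s_closed: "i \<in> {1..<n} \<Longrightarrow> s i \<in> carrier G"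
    and s_sq: "i \<in> {1..<n} \<Longrightarrow> s i \<otimes> s i = \<one>"
    and s_far: "1 \<le> i \<Longrightarrow> i + 1 < j \<Longrightarrow> j < n \<Longrightarrow> s i \<otimes> s j = s j \<otimes> s i"
    and s_braid: "1 \<le> i \<Longrightarrow> i + 1 < n \<Longrightarrow> s i \<otimes> s (i + 1) \<otimes> s i = s (i + 1) \<otimes> s i \<otimes> s (i + 1)"
begin

lemma s_carrier [simp]: "1 \<le> i \<Longrightarrow> i < n \<Longrightarrow> s i \<in> carrier G"
  using s_closed by simp

lemma generate_s_closed:
  assumes "m \<le> n" "h \<in> generate G (s ` {1..<m})"
  shows "h \<in> carrier G"
  by (rule generate_in_carrier[OF _ assms(2)]) (use assms(1) in auto)

text \<open>The elements \<open>tail m k\<close> represent the right cosets of the subgroup generated by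
  \<open>s\<^sub>1, \<dots>, s\<^sub>m\<^sub>-\<^sub>1\<close> in the one generated by \<open>s\<^sub>1, \<dots>, s\<^sub>m\<close>.\<close>

primrec tail :: "nat \<Rightarrow> nat \<Rightarrow> 'a" where
  "tail m 0 = \<one>"
| "tail m (Suc k) = tail m k \<otimes> s (m - k)"

lemma tail_closed [simp]: "m < n \<Longrightarrow> k \<le> m \<Longrightarrow> tail m k \<in> carrier G"
  by (induction k) auto

lemma tail_low:
  "m < n \<Longrightarrow> 1 \<le> i \<Longrightarrow> i + k < m \<Longrightarrow> tail m k \<otimes> s i = s i \<otimes> tail m k"
proof (induction k)
  case (Suc k)
  then have "s (m - k) \<otimes> s i = s i \<otimes> s (m - k)"
    using s_far[of i "m - k"] by auto
  then have "tail m (Suc k) \<otimes> s i = (tail m k \<otimes> s i) \<otimes> s (m - k)"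
    using Suc.prems by (simp add: m_assoc)
  then show ?case using Suc by (simp add: m_assoc)
qed simp

text \<open>The letters after \<open>s (i - 1)\<close> commute with \<open>s i\<close>. At the place
  where \<open>s i s (i - 1)\<close> ends the tail, the braid relation turns \<open>s i\<close> into
  \<open>s (i - 1)\<close>, which then passes the remaining larger letters.\<close>

lemma tail_high:
  "m < n \<Longrightarrow> k \<le> m \<Longrightarrow> m + 1 < i + k \<Longrightarrow> i \<le> m \<Longrightarrow> tail m k \<otimes> s i = s (i - 1) \<otimes> tail m k"
proof (induction k)
  case (Suc k)
  show ?case
  proof (cases "m + 1 < i + k")
    case True
    then have "s (m - k) \<otimes> s i = s i \<otimes> s (m - k)"
      using s_far[of "m - k" i] Suc.prems by auto
    then have "tail m (Suc k) \<otimes> s i = (tail m k \<otimes> s i) \<otimes> s (m - k)"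
      using Suc.prems by (simp add: m_assoc)
    then show ?thesis using Suc True by (simp add: m_assoc)
  next
    case False
    then have i: "i = m + 1 - k" and k: "k = Suc (k - 1)" using Suc.prems by auto
    define j l where "j = m - k" and "l = k - 1"
    have e: "i = j + 1" "m - l = j + 1" "k = Suc l" "m - Suc l = j"
      and j: "1 \<le> j" "j + 1 < n" "j + l < m" "l \<le> m"
      using i k Suc.prems by (auto simp: j_def l_def)
    have "tail m (Suc k) \<otimes> s i = tail m l \<otimes> (s (j + 1) \<otimes> s j \<otimes> s (j + 1))"
      using e j Suc.prems by (simp add: m_assoc)
    also have "\<dots> = tail m l \<otimes> (s j \<otimes> s (j + 1) \<otimes> s j)"
      using s_braid[OF j(1,2)] by simp
    also have "\<dots> = (tail m l \<otimes> s j) \<otimes> s (j + 1) \<otimes> s j"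
      using j Suc.prems by (simp add: m_assoc)
    also have "\<dots> = s j \<otimes> tail m l \<otimes> s (j + 1) \<otimes> s j"
      using tail_low[of m j l] j Suc.prems by simp
    also have "\<dots> = s (i - 1) \<otimes> tail m (Suc k)"
      using e j Suc.prems by (simp add: m_assoc)
    finally show ?thesis .
  qed
qed simp

text \<open>The set of products is closed under right multiplication by generators:
  \<open>s i\<close> passes through the tail, unchanged or with its index lowered, or it lengthens
  or shortens the tail by one letter.\<close>

lemma generate_decomp:
  assumes m: "1 \<le> m" "m < n" and g: "g \<in> generate G (s ` {1..<m + 1})"
  shows "\<exists>h k. h \<in> generate G (s ` {1..<m}) \<and> k \<le> m \<and> g = h \<otimes> tail m k"
proof -
  let ?H = "generate G (s ` {1..<m})"
  define A where "A = {h \<otimes> tail m k | h k. h \<in> ?H \<and> k \<le> m}"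
  have sub: "subgroup ?H G" using m by (intro generate_is_subgroup) auto
  interpret H: subgroup ?H G by (rule sub)
  have sH: "s i \<in> ?H" if "i \<in> {1..<m}" for i using that by (auto intro: generate.incl)
  have A_carrier: "A \<subseteq> carrier G" using m by (auto simp: A_def)
  have step: "z \<otimes> s i \<in> A" if zi: "z \<in> A" "i \<in> {1..<m + 1}" for z i
  proof -
    from zi obtain h k where z: "z = h \<otimes> tail m k" "h \<in> ?H" "k \<le> m" by (auto simp: A_def)
    consider "i + k < m" | "i + k = m" | "i + k = m + 1" | "m + 1 < i + k" by linarith
    then show ?thesis
    proof cases
      case 1
      then have "z \<otimes> s i = (h \<otimes> s i) \<otimes> tail m k"
        using z m that tail_low[of m i k] by (simp add: m_assoc)
      moreover have "h \<otimes> s i \<in> ?H" using z(2) by (rule H.m_closed) (rule sH, use that 1 in auto)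
      ultimately show ?thesis using z(3) unfolding A_def by blast
    next
      case 2
      then have "i = m - k" "Suc k \<le> m" using that by auto
      then have "z \<otimes> s i = h \<otimes> tail m (Suc k)" using z m that by (simp add: m_assoc)
      then show ?thesis using z(2) \<open>Suc k \<le> m\<close> unfolding A_def by blast
    next
      case 3
      then obtain l where l: "k = Suc l" "i = m - l" using zi by (cases k) auto
      then have "z \<otimes> s i = h \<otimes> tail m l" using z m that by (simp add: m_assoc s_sq)
      moreover have "l \<le> m" using l z by simp
      ultimately show ?thesis using z(2) unfolding A_def by blast
    next
      case 4
      then have "z \<otimes> s i = (h \<otimes> s (i - 1)) \<otimes> tail m k"
        using z m that tail_high[of m k i] by (simp add: m_assoc)
      moreover have "h \<otimes> s (i - 1) \<in> ?H" using z(2) by (rule H.m_closed) (rule sH, use that 4 z(3) in auto)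
      ultimately show ?thesis using z(3) unfolding A_def by blast
    qed
  qed
  have "\<forall>z \<in> A. z \<otimes> g \<in> A"
    using g
  proof (induction rule: generate.induct)
    case one
    then show ?case using A_carrier by auto
  next
    case (incl h)
    then show ?case using step by auto
  next
    case (inv h)
    then obtain i where i: "h = s i" "i \<in> {1..<m + 1}" by auto
    then have "inv h = s i" using m s_sq[of i] by (simp add: inv_equality)
    then show ?case using step i by auto
  next
    case (eng h1 h2)
    have "h1 \<in> carrier G" "h2 \<in> carrier G"
      using eng(1,2) m generate_s_closed[of "m + 1"] by auto
    then have "z \<otimes> (h1 \<otimes> h2) = z \<otimes> h1 \<otimes> h2" if "z \<in> A" for z
      using that A_carrier by (auto simp: m_assoc)
    then show ?case using eng by simp
  qed
  moreover have "\<one> \<in> A"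
  proof -
    have "\<one> = \<one> \<otimes> tail m 0" by simp
    then show ?thesis unfolding A_def using H.one_closed by blast
  qed
  moreover have "g \<in> carrier G" using g m generate_s_closed[of "m + 1"] by auto
  ultimately have "g \<in> A" by force
  then show ?thesis by (auto simp: A_def)
qed

text \<open>The permutation of \<open>tail m k\<close> sends \<open>m + 1 - k\<close> to
  \<open>m + 1\<close>, which is fixed by the factor \<open>h\<close>. An element acting as the
  identity therefore has \<open>k = 0\<close> and lies in the subgroup on one generator
  fewer.\<close>

lemma trivial_kernel:
  assumes p: "p \<in> hom G (sym_group n)"
    and p_s: "\<And>i. i \<in> {1..<n} \<Longrightarrow> p (s i) = transpose i (i + 1)"
    and "m \<le> n" "g \<in> generate G (s ` {1..<m})" "p g = id"
  shows "g = \<one>"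
  using assms(3-5)
proof (induction m arbitrary: g)
  case 0
  then show ?case by (simp add: generate_empty)
next
  case (Suc m)
  show ?case
  proof (cases "m = 0")
    case True
    then show ?thesis using Suc by (simp add: generate_empty)
  next
    case False
    interpret p: group_hom G "sym_group n" p
      using p by (simp add: group_hom_def group_hom_axioms_def sym_group_is_group is_group)
    have m: "1 \<le> m" "m < n" using False Suc by auto
    obtain h k where g: "h \<in> generate G (s ` {1..<m})" "k \<le> m" "g = h \<otimes> tail m k"
      using generate_decomp[OF m, of g] Suc.prems(2) by fastforce
    have hc: "h \<in> carrier G" using g m generate_s_closed[of m] by auto
    have tail: "p (tail m k) (m + 1 - k) = m + 1" if "k \<le> m" for k
      using that
    proof (induction k)
      case 0
      then show ?case by (simp add: sym_group_one)
    next
      case (Suc k)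
      then have "m - k \<in> {1..<n}" "m + 1 - k = Suc (m - k)" using m by auto
      then have "p (s (m - k)) (m - k) = m + 1 - k" by (simp add: p_s)
      then show ?case using Suc m by (simp add: sym_group_mult)
    qed
    have "p h (m + 1) = m + 1"
      using g(1)
    proof (induction rule: generate.induct)
      case one
      then show ?case by (simp add: sym_group_one)
    next
      case (incl h)
      then show ?case using m p_s by (auto simp: transpose_def)
    next
      case (inv h)
      then obtain i where i: "h = s i" "i \<in> {1..<m}" by auto
      then have "inv h = s i" using m s_sq[of i] by (simp add: inv_equality)
      then show ?case using i m p_s by (auto simp: transpose_def)
    next
      case (eng h1 h2)
      have "h1 \<in> carrier G" "h2 \<in> carrier G"
        using eng(1,2) m generate_s_closed[of m] by auto
      then show ?case using eng by (simp add: sym_group_mult)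
    qed
    then have "p g (m + 1 - k) = m + 1"
      using g hc m tail[of k] by (simp add: sym_group_mult)
    then have "k = 0" using Suc.prems(3) g(2) by simp
    then have "g = h" using g hc by simp
    then show ?thesis using Suc g by simp
  qed
qed

end

lemma induced_map_coset:
  assumes "N \<lhd> G" "h \<in> hom G H" "group H" "\<And>g. g \<in> N \<Longrightarrow> h g = \<one>\<^bsub>H\<^esub>" "g \<in> carrier G"
  shows "induced_map h (N #>\<^bsub>G\<^esub> g) = h g"
proof -
  interpret N: normal N G by fact
  interpret H: group H by fact
  have "h ` (N #>\<^bsub>G\<^esub> g) = {h g}"
  proof
    show "h ` (N #>\<^bsub>G\<^esub> g) \<subseteq> {h g}"
      using assms(4,5) hom_mult[OF assms(2)] hom_in_carrier[OF assms(2)]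
      by (auto simp: r_coset_def N.mem_carrier)
    show "{h g} \<subseteq> h ` (N #>\<^bsub>G\<^esub> g)"
      using N.rcos_self[OF assms(5) N.subgroup_axioms] by auto
  qed
  then show ?thesis by (simp add: induced_map_def)
qed

lemma induced_map_hom:
  assumes "N \<lhd> G" "h \<in> hom G H" "group H" "\<And>g. g \<in> N \<Longrightarrow> h g = \<one>\<^bsub>H\<^esub>"
  shows "induced_map h \<in> hom (G Mod N) H"
proof -
  interpret N: normal N G by fact
  note v = induced_map_coset[OF assms]
  show ?thesis
  proof (rule homI)
    fix A B assume "A \<in> carrier (G Mod N)" "B \<in> carrier (G Mod N)"
    then obtain g g' where g: "A = N #>\<^bsub>G\<^esub> g" "g \<in> carrier G" "B = N #>\<^bsub>G\<^esub> g'" "g' \<in> carrier G"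
      by (auto simp: carrier_FactGroup)
    then show "induced_map h A \<in> carrier H" using hom_in_carrier[OF assms(2)] by (simp add: v)
    show "induced_map h (A \<otimes>\<^bsub>G Mod N\<^esub> B) = induced_map h A \<otimes>\<^bsub>H\<^esub> induced_map h B"
      using g hom_mult[OF assms(2)] by (simp add: N.rcos_sum v)
  qed
qed

context group_hom
begin

lemma hom_commutator:
  "y \<in> carrier G \<Longrightarrow> z \<in> carrier G \<Longrightarrow> h (commutator G y z) = commutator H (h y) (h z)"
  by (simp add: commutator_def)

lemma hom_conjg:
  "y \<in> carrier G \<Longrightarrow> z \<in> carrier G \<Longrightarrow> h (conjg G y z) = conjg H (h y) (h z)"
  by (simp add: conjg_def)

end

section \<open>The pure subgroup and its degree zero part\<close>

locale tilde_braid_maps = tilde_braid G n x for G (structure) and n x +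
  fixes \<pi> :: "'a \<Rightarrow> nat \<Rightarrow> nat" and \<delta> :: "'a \<Rightarrow> int"
  assumes perm_hom: "\<pi> \<in> hom G (sym_group n)"
    and perm_x: "i \<in> {1..<n} \<Longrightarrow> \<pi> (x i) = transpose i (i + 1)"
    and degree_hom: "\<delta> \<in> hom G integer_group"
    and degree_x: "i \<in> {1..<n} \<Longrightarrow> \<delta> (x i) = 1"
begin

declare u.simps [simp del]

sublocale perm: group_hom G "sym_group n" \<pi>
  using perm_hom by (simp add: group_hom_def group_hom_axioms_def sym_group_is_group is_group)

sublocale degree: group_hom G integer_group \<delta>
  using degree_hom by (simp add: group_hom_def group_hom_axioms_def is_group)

definition P0_gens where "P0_gens = insert c (u ` {1..<n})"
definition P_gens where "P_gens = insert (x 1 \<otimes> x 1) P0_gens"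
text \<open>\<open>P0\<close> and \<open>P\<close> are defined by generators, which makes normality
  and commutation checkable on generators; that they are the kernels is the content of
  \<open>perm_kernel\<close> and \<open>perm_degree_kernel\<close>.\<close>

definition P0 where "P0 = generate G P0_gens"
definition P where "P = generate G P_gens"

lemma gens_carrier: "P0_gens \<subseteq> carrier G" "P_gens \<subseteq> carrier G"
  using n by (auto simp: P0_gens_def P_gens_def)

lemma P0_subgroup: "subgroup P0 G" and P_subgroup: "subgroup P G"
  using gens_carrier by (auto simp: P0_def P_def intro: generate_is_subgroup)

lemma c_P0: "c \<in> P0" and u_P0: "i \<in> {1..<n} \<Longrightarrow> u i \<in> P0"
  by (auto simp: P0_def P0_gens_def intro: generate.incl)

lemma P0_subset_P: "P0 \<subseteq> P"
  unfolding P0_def P_def by (rule mono_generate) (auto simp: P_gens_def)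

lemma u_conjg_P0:
  assumes i: "i \<in> {1..<n}" and j: "j \<in> {1..<n}"
  shows "conjg G (u i) (x j) \<in> P0 \<and> conjg G (u i) (inv (x j)) \<in> P0"
proof -
  interpret P0: subgroup P0 G by (rule P0_subgroup)
  consider "j = i" | "j = i + 1" | "i = j + 1" | "i + 1 < j \<or> j + 1 < i" by linarith
  then show ?thesis
  proof cases
    case 1
    then show ?thesis using u_self[OF i] c_P0 u_P0 i by simp
  next
    case 2
    then show ?thesis using u_adjacent[of i] c_P0 u_P0 i j by simp
  next
    case 3
    then show ?thesis using u_adjacent[of j] c_P0 u_P0 i j by simp
  next
    case 4
    then show ?thesis using u_far[OF i j] u_P0 i j by (simp add: conjg_fixed_inv)
  qed
qed

lemma P0_normal: "P0 \<lhd> G"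
  unfolding P0_def
proof (rule normal_generate_conjg[OF _ gens_carrier(1) generated])
  show "x ` {1..<n} \<subseteq> carrier G" by auto
  fix t s assume "t \<in> P0_gens" and s: "s \<in> x ` {1..<n}"
  then consider "t = c" | i where "t = u i" "i \<in> {1..<n}" by (auto simp: P0_gens_def)
  then show "conjg G t s \<in> generate G P0_gens \<and> conjg G t (inv s) \<in> generate G P0_gens"
    unfolding P0_def[symmetric] using s by cases (auto simp: conjg_c c_P0 u_conjg_P0)
qed

sublocale P0: normal P0 G by (rule P0_normal)
sublocale P: subgroup P G by (rule P_subgroup)

lemma sq_step:
  assumes "1 \<le> i" "i + 1 < n"
  shows "x (i + 1) \<otimes> x (i + 1) = inv (c \<otimes> (u i \<otimes> u (i + 1))) \<otimes> (x i \<otimes> x i)"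
proof -
  interpret p: braid_pair G "x i" "x (Suc i)" c using pair[of i] assms by simp
  have "c \<otimes> (u i \<otimes> u (i + 1)) = x i \<otimes> x i \<otimes> inv (x (Suc i) \<otimes> x (Suc i))"
    using p.c_u_u' u_right[of i] u_left[of i] assms by (simp add: p.u_def p.u'_def)
  then show ?thesis using assms by (simp add: m_assoc inv_mult_group)
qed

lemma sq_P: "i \<in> {1..<n} \<Longrightarrow> x i \<otimes> x i \<in> P"
proof -
  assume "i \<in> {1..<n}"
  then have "1 \<le> i" "i < n" by auto
  then show ?thesis
  proof (induction i rule: nat_induct_at_least)
    case base
    then show ?case by (auto simp: P_def P_gens_def intro: generate.incl)
  next
    case (Suc i)
    have "u i \<in> P" "u (Suc i) \<in> P" "c \<in> P"
      using u_P0[of i] u_P0[of "Suc i"] c_P0 P0_subset_P Suc by auto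
    then have "inv (c \<otimes> (u i \<otimes> u (Suc i))) \<otimes> (x i \<otimes> x i) \<in> P"
      using Suc by (intro P.m_closed[OF P.m_inv_closed]) auto
    then show ?case using sq_step[of i] Suc by simp
  qed
qed

text \<open>\<open>P0\<close> being normal, only \<open>x 1 x 1\<close> has to be conjugated. By
  \<open>x 2\<close> it changes by the factor \<open>inv (u 2)\<close>, by \<open>inv (x 2)\<close>
  it becomes \<open>u 1 (x 2 x 2)\<close>, and every other generator fixes it.\<close>

lemma P_normal: "P \<lhd> G"
  unfolding P_def
proof (rule normal_generate_conjg[OF _ gens_carrier(2) generated])
  show "x ` {1..<n} \<subseteq> carrier G" by auto
  fix t s assume t: "t \<in> P_gens" and s: "s \<in> x ` {1..<n}"
  then obtain j where j: "s = x j" "j \<in> {1..<n}" by auto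
  show "conjg G t s \<in> generate G P_gens \<and> conjg G t (inv s) \<in> generate G P_gens"
    unfolding P_def[symmetric]
  proof (cases "t = x 1 \<otimes> x 1")
    case False
    then have "t \<in> P0" using t by (auto simp: P_gens_def P0_def intro: generate.incl)
    then show "conjg G t s \<in> P \<and> conjg G t (inv s) \<in> P"
      using P0.conjg_mem P0_subset_P j by auto
  next
    case True
    have tc: "t \<in> carrier G" using t gens_carrier by auto
    have [simp]: "x 1 \<in> carrier G" "x (Suc 0) \<in> carrier G" "x 2 \<in> carrier G" using n by simp_all
    consider "j = 1" | "j = 2" | "j \<ge> 3" using j by force
    then show "conjg G t s \<in> P \<and> conjg G t (inv s) \<in> P"
    proof cases
      case 1
      then have "conjg G t s = t" "conjg G t (inv s) = t"
        using True j by (simp_all add: conjg_def m_assoc)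
      then show ?thesis using True sq_P[of 1] n by simp
    next
      case 2
      interpret p: braid_pair G "x 1" "x 2" c using pair[of 1] n by (simp add: numeral_2_eq_2)
      have "u 2 = conjg G (inv t) s \<otimes> t"
        using u_left[of 1] n by (simp add: numeral_2_eq_2[symmetric])
          (simp add: True j 2 commutator_def conjg_def m_assoc inv_mult_group)
      then have "conjg G t s = t \<otimes> inv (u 2)"
        using tc j by (simp add: inv_mult_group conjg_inv)
      moreover have "conjg G t (inv s) = u 1 \<otimes> (x 2 \<otimes> x 2)"
      proof -
        have "conjg G t (inv s) = conjg G (x 2 \<otimes> x 2) (x 1)"
          using p.a_conjg_b(2) by (simp add: True j 2 conjg_mult)
        then show ?thesis
          using u_right[of 1] n by (simp add: numeral_2_eq_2[symmetric] commutator_def conjg_def m_assoc inv_mult_group)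
      qed
      moreover have "t \<in> P" "u 1 \<in> P" "u 2 \<in> P" "x 2 \<otimes> x 2 \<in> P"
        using True sq_P[of 1] sq_P[of 2] u_P0[of 1] u_P0[of 2] P0_subset_P n by auto
      ultimately show ?thesis by simp
    next
      case 3
      then have "conjg G t s = t"
        using True j far_fixed[of 1 j] n by (simp add: conjg_mult)
      then show ?thesis using True j sq_P[of 1] n by (simp add: conjg_fixed_inv)
    qed
  qed
qed

sublocale P: normal P G by (rule P_normal)

lemma P_decomp:
  assumes "p \<in> P"
  obtains q m where "q \<in> P0" "p = q \<otimes> (x 1 \<otimes> x 1) [^] (m::int)"
proof -
  let ?X = "x 1 \<otimes> x 1"
  have X: "?X \<in> carrier G" using n by simp
  have sub: "subgroup (P0 <#> generate G {?X}) G"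
    using mult_norm_subgroup[OF P0_normal, of "generate G {?X}"] generate_is_subgroup X by simp
  have "P_gens \<subseteq> P0 <#> generate G {?X}"
  proof
    fix t assume "t \<in> P_gens"
    then consider "t = \<one> \<otimes> ?X" | "t \<in> P0"
      using X by (auto simp: P_gens_def P0_def intro: generate.incl)
    then show "t \<in> P0 <#> generate G {?X}"
    proof cases
      case 1
      then show ?thesis unfolding set_mult_def using P0.one_closed generate.incl[of ?X "{?X}" G] by blast
    next
      case 2
      then have "t = t \<otimes> \<one>" by simp
      with 2 show ?thesis unfolding set_mult_def using generate.one[of G "{?X}"] by blast
    qed
  qed
  then have "p \<in> P0 <#> generate G {?X}"
    using assms generate_subgroup_incl[OF _ sub] by (auto simp: P_def)
  then show ?thesis using that X by (auto simp: set_mult_def generate_pow)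
qed

lemma perm_P: "p \<in> P \<Longrightarrow> \<pi> p = id"
proof -
  let ?K = "kernel G (sym_group n) \<pi>"
  have K_id: "\<pi> g = id" if "g \<in> ?K" for g
    using that by (simp add: kernel_def sym_group_one)
  have sq: "x i \<otimes> x i \<in> ?K" if "i \<in> {1..<n}" for i
    using that by (simp add: kernel_def perm_x sym_group_one sym_group_mult)
  interpret K: normal ?K G by (rule perm.normal_kernel)
  have "u i \<in> ?K" if i: "i \<in> {1..<n}" for i
  proof (cases "i + 1 < n")
    case True
    then show ?thesis using i u_right[of i] sq[of "i + 1"] K.commutator_mem(2) by simp
  next
    case False
    then have "i = (i - 1) + 1" "1 \<le> i - 1" using i n by auto
    then obtain k where "i = k + 1" "1 \<le> k" by blast
    then show ?thesis using i u_left[of k] sq[of k] K.commutator_mem(2) by simp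
  qed
  moreover have "c \<in> ?K" unfolding c_def using sq[of 1] n by (intro K.commutator_mem(1)) auto
  ultimately have "P_gens \<subseteq> ?K" using sq[of 1] n by (auto simp: P_gens_def P0_gens_def)
  then have "P \<subseteq> ?K" unfolding P_def using generate_subgroup_incl K.subgroup_axioms by blast
  then show "p \<in> P \<Longrightarrow> \<pi> p = id" using K_id by blast
qed

lemma degree_P0: "q \<in> P0 \<Longrightarrow> \<delta> q = 0"
proof -
  let ?K = "kernel G integer_group \<delta>"
  have K: "commutator G g h \<in> ?K" if "g \<in> carrier G" "h \<in> carrier G" for g h
    using that by (simp add: kernel_def degree.hom_commutator) (simp add: commutator_def)
  have "u i \<in> ?K" if i: "i \<in> {1..<n}" for i
  proof (cases "i + 1 < n")
    case True
    then show ?thesis using i u_right[of i] K by simp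
  next
    case False
    then have "i = (i - 1) + 1" "1 \<le> i - 1" using i n by auto
    then obtain k where "i = k + 1" "1 \<le> k" by blast
    then show ?thesis using i u_left[of k] K by simp
  qed
  moreover have "c \<in> ?K" unfolding c_def using n by (intro K) auto
  ultimately have "P0_gens \<subseteq> ?K" by (auto simp: P0_gens_def)
  then have "P0 \<subseteq> ?K" unfolding P0_def using generate_subgroup_incl degree.subgroup_kernel by blast
  then show "q \<in> P0 \<Longrightarrow> \<delta> q = 0" by (auto simp: kernel_def)
qed

lemma degree_P: "q \<in> P0 \<Longrightarrow> \<delta> (q \<otimes> (x 1 \<otimes> x 1) [^] (m::int)) = 2 * m"
  using n by (simp add: degree.hom_int_pow degree_P0 degree_x P0.mem_carrier)

text \<open>The quotient by \<open>P\<close> satisfies the Coxeter relations because it contains the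
  squares, and \<pi> descends to it; \<open>trivial_kernel\<close> then says that the descended map
  is injective.\<close>

lemma perm_kernel: "kernel G (sym_group n) \<pi> = P"
proof
  show "P \<subseteq> kernel G (sym_group n) \<pi>"
    using perm_P P.subset by (auto simp: kernel_def sym_group_one)
  show "kernel G (sym_group n) \<pi> \<subseteq> P"
  proof
    fix g assume "g \<in> kernel G (sym_group n) \<pi>"
    then have g: "g \<in> carrier G" "\<pi> g = id" by (auto simp: kernel_def sym_group_one)
    let ?M = "G Mod P" and ?r = "\<lambda>g. P #> g"
    have group_M: "group ?M" by (rule P.factorgroup_is_group)
    have hom_r: "?r \<in> hom G ?M" by (rule P.r_coset_hom_Mod)
    interpret r: group_hom G ?M ?r
      using group_M hom_r by (simp add: group_hom_def group_hom_axioms_def is_group)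
    have r_mult: "?r y \<otimes>\<^bsub>?M\<^esub> ?r z = ?r (y \<otimes> z)" if "y \<in> carrier G" "z \<in> carrier G" for y z
      using r.hom_mult[OF that] by simp
    have r_one: "?r y = \<one>\<^bsub>?M\<^esub>" if "y \<in> P" for y
      using that P.rcos_const by simp
    interpret M: coxeter ?M n "\<lambda>i. ?r (x i)"
    proof (intro coxeter.intro coxeter_axioms.intro group_M)
      show "?r (x i) \<in> carrier ?M" if "i \<in> {1..<n}" for i using that r.hom_closed by simp
      show "?r (x i) \<otimes>\<^bsub>?M\<^esub> ?r (x i) = \<one>\<^bsub>?M\<^esub>" if "i \<in> {1..<n}" for i
        using that sq_P[of i] by (simp only: r_mult x_closed r_one)
      show "?r (x i) \<otimes>\<^bsub>?M\<^esub> ?r (x j) = ?r (x j) \<otimes>\<^bsub>?M\<^esub> ?r (x i)"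
        if "1 \<le> i" "i + 1 < j" "j < n" for i j
        using that far[of i j] by (simp only: r_mult x_closed atLeastLessThan_iff x_carrier)
      show "?r (x i) \<otimes>\<^bsub>?M\<^esub> ?r (x (i + 1)) \<otimes>\<^bsub>?M\<^esub> ?r (x i)
          = ?r (x (i + 1)) \<otimes>\<^bsub>?M\<^esub> ?r (x i) \<otimes>\<^bsub>?M\<^esub> ?r (x (i + 1))"
        if "1 \<le> i" "i + 1 < n" for i
        using that braid[of i] by (simp add: r_mult del: mult_FactGroup r.hom_mult)
    qed
    have one: "\<pi> p = \<one>\<^bsub>sym_group n\<^esub>" if "p \<in> P" for p
      using that by (simp add: perm_P sym_group_one)
    note v = induced_map_coset[OF P_normal perm_hom sym_group_is_group one]
    have "?r ` (generate G (x ` {1..<n})) = generate ?M (?r ` (x ` {1..<n}))"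
      by (rule r.generate_img[symmetric]) auto
    then have "?r g \<in> generate ?M ((\<lambda>i. ?r (x i)) ` {1..<n})"
      using g generated by (auto simp: image_image)
    then have "?r g = \<one>\<^bsub>?M\<^esub>"
      using g by (intro M.trivial_kernel[OF induced_map_hom[OF P_normal perm_hom sym_group_is_group one], of n])
        (auto simp: v perm_x)
    then have "?r g = P" by simp
    then show "g \<in> P" using g rcos_self[OF g(1) P.subgroup_axioms] by auto
  qed
qed

lemma perm_degree_kernel: "kernel G (sym_group n) \<pi> \<inter> kernel G integer_group \<delta> = P0"
proof
  show "P0 \<subseteq> kernel G (sym_group n) \<pi> \<inter> kernel G integer_group \<delta>"
    unfolding perm_kernel using P0_subset_P degree_P0 P0.subset by (auto simp: kernel_def)
  show "kernel G (sym_group n) \<pi> \<inter> kernel G integer_group \<delta> \<subseteq> P0"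
  proof
    fix g assume g: "g \<in> kernel G (sym_group n) \<pi> \<inter> kernel G integer_group \<delta>"
    then obtain q m where q: "q \<in> P0" "g = q \<otimes> (x 1 \<otimes> x 1) [^] (m::int)"
      unfolding perm_kernel using P_decomp by auto
    then have "m = 0" using g degree_P[of q m] by (simp add: kernel_def)
    then show "g \<in> P0" using q P0.mem_carrier by simp
  qed
qed

end

section \<open>The pure subgroup is commutative modulo \<open>c\<close>\<close>

context tilde_braid_maps
begin

text \<open>All \<open>u i\<close> are conjugates of \<open>u 1\<close>, and \<open>c\<close> is the
  commutator of \<open>u 1\<close> and \<open>u 2\<close>. Later inclusions of \<open>P0\<close> in
  a normal subgroup are reduced to \<open>u 1\<close> in this way.\<close>

lemma P0_minimal:
  assumes "R \<lhd> G" "u 1 \<in> R"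
  shows "P0 \<subseteq> R"
proof -
  interpret R: normal R G by fact
  have uR: "u i \<in> R" if "1 \<le> i" "i < n" for i
    using that
  proof (induction i rule: nat_induct_at_least)
    case base
    then show ?case using assms by simp
  next
    case (Suc i)
    then have "conjg G (u i) (x (i + 1) \<otimes> x i) \<in> R" by (intro R.conjg_mem) auto
    then show ?case using u_step[of i] Suc by simp
  qed
  moreover have "c \<in> R"
    using u_adjacent(5)[of 1] uR[of 1] n R.commutator_mem(1)[of "u 1" "u 2"]
    by (simp add: numeral_2_eq_2)
  ultimately have "P0_gens \<subseteq> R" by (auto simp: P0_gens_def)
  then show ?thesis unfolding P0_def using generate_subgroup_incl R.subgroup_axioms by blast
qed

text \<open>Commutation modulo \<open>{1, c}\<close> is symmetric and multiplicative in either argument, so it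
  can be checked on generators.\<close>

definition comm_mod_c :: "'a \<Rightarrow> 'a \<Rightarrow> bool" where
  "comm_mod_c p q \<longleftrightarrow> p \<otimes> q = q \<otimes> p \<or> p \<otimes> q = c \<otimes> (q \<otimes> p)"

lemma c_cancel [simp]: "z \<in> carrier G \<Longrightarrow> c \<otimes> (c \<otimes> z) = z"
  using c_involution by (simp flip: m_assoc)

lemma comm_mod_c_sym:
  assumes "p \<in> carrier G" "q \<in> carrier G" "comm_mod_c p q"
  shows "comm_mod_c q p"
  using assms by (auto simp: comm_mod_c_def)

lemma comm_mod_cE:
  assumes "p \<in> carrier G" "q \<in> carrier G" "comm_mod_c p q"
  obtains e where "e \<in> {\<one>, c}" "p \<otimes> q = e \<otimes> (q \<otimes> p)"
proof (cases "p \<otimes> q = q \<otimes> p")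
  case True
  show ?thesis by (rule that[of \<one>]) (use True assms in simp_all)
next
  case False
  show ?thesis by (rule that[of c]) (use False assms in \<open>simp_all add: comm_mod_c_def\<close>)
qed

lemma comm_mod_cI:
  assumes "p \<in> carrier G" "q \<in> carrier G" "e \<in> {\<one>, c}" "p \<otimes> q = e \<otimes> (q \<otimes> p)"
  shows "comm_mod_c p q"
proof (cases "e = \<one>")
  case True
  then show ?thesis using assms by (simp add: comm_mod_c_def)
next
  case False
  then show ?thesis using assms(3,4) by (simp add: comm_mod_c_def)
qed

lemma comm_mod_c_mult:
  assumes "p \<in> carrier G" "q \<in> carrier G" "r \<in> carrier G" "comm_mod_c p q" "comm_mod_c p r"
  shows "comm_mod_c p (q \<otimes> r)"
proof -
  obtain e where e: "e \<in> {\<one>, c}" "p \<otimes> q = e \<otimes> (q \<otimes> p)"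
    using comm_mod_cE assms by blast
  obtain f where f: "f \<in> {\<one>, c}" "p \<otimes> r = f \<otimes> (r \<otimes> p)"
    using comm_mod_cE assms by blast
  have ec: "e \<in> carrier G" "f \<in> carrier G" using e f by auto
  have "p \<otimes> (q \<otimes> r) = (p \<otimes> q) \<otimes> r" using assms by (simp add: m_assoc)
  also have "\<dots> = e \<otimes> (q \<otimes> (p \<otimes> r))" unfolding e(2) using assms ec by (simp add: m_assoc)
  also have "\<dots> = e \<otimes> (q \<otimes> (f \<otimes> (r \<otimes> p)))" by (simp add: f(2))
  also have "q \<otimes> (f \<otimes> (r \<otimes> p)) = f \<otimes> (q \<otimes> (r \<otimes> p))"
    using f(1) assms c_moves[of q] by auto
  finally have "p \<otimes> (q \<otimes> r) = e \<otimes> f \<otimes> (q \<otimes> r \<otimes> p)" using assms ec by (simp add: m_assoc)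
  moreover have "e \<otimes> f \<in> {\<one>, c}" using e(1) f(1) c_involution by auto
  ultimately show ?thesis using assms by (intro comm_mod_cI) auto
qed

lemma comm_mod_c_inv:
  assumes "p \<in> carrier G" "q \<in> carrier G" "comm_mod_c p q"
  shows "comm_mod_c p (inv q)"
proof -
  obtain e where e: "e \<in> {\<one>, c}" "q \<otimes> p = e \<otimes> (p \<otimes> q)"
    using comm_mod_cE[OF _ _ comm_mod_c_sym[OF assms]] assms by blast
  have ec: "e \<in> carrier G" using e(1) by auto
  have "inv q \<otimes> (q \<otimes> p) \<otimes> inv q = inv q \<otimes> (e \<otimes> p)"
    unfolding e(2) using ec assms by (simp add: m_assoc)
  also have "\<dots> = e \<otimes> (inv q \<otimes> p)"
    using e(1) assms c_moves[of "inv q"] by auto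
  finally have "p \<otimes> inv q = e \<otimes> (inv q \<otimes> p)" using assms by (simp add: m_assoc)
  then show ?thesis using e(1) assms by (intro comm_mod_cI) auto
qed

lemma comm_mod_c_subgroup:
  assumes "p \<in> carrier G"
  shows "subgroup {q \<in> carrier G. comm_mod_c p q} G"
proof (rule subgroupI)
  have "comm_mod_c p \<one>" using assms by (simp add: comm_mod_c_def)
  then show "{q \<in> carrier G. comm_mod_c p q} \<noteq> {}" by auto
qed (use assms comm_mod_c_mult comm_mod_c_inv in auto)

lemma comm_mod_c_conjg:
  assumes "p \<in> carrier G" "q \<in> carrier G" "g \<in> carrier G" "comm_mod_c p q"
  shows "comm_mod_c (conjg G p g) (conjg G q g)"
proof -
  have "conjg G p g \<otimes> conjg G q g = conjg G (p \<otimes> q) g"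
    "conjg G q g \<otimes> conjg G p g = conjg G (q \<otimes> p) g"
    "conjg G (c \<otimes> (q \<otimes> p)) g = c \<otimes> conjg G (q \<otimes> p) g"
    using assms by (simp_all add: conjg_mult conjg_c)
  then show ?thesis using assms(4) unfolding comm_mod_c_def by auto
qed

lemma comm_mod_c_generate:
  assumes "p \<in> carrier G" "S \<subseteq> carrier G" "\<And>q. q \<in> S \<Longrightarrow> comm_mod_c p q" "q \<in> generate G S"
  shows "comm_mod_c p q"
proof -
  have "S \<subseteq> {q \<in> carrier G. comm_mod_c p q}" using assms by auto
  then show ?thesis
    using generate_subgroup_incl[OF _ comm_mod_c_subgroup[OF assms(1)]] assms(4) by blast
qed

lemma comm_mod_c_c: "p \<in> carrier G \<Longrightarrow> comm_mod_c p c"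
  by (simp add: comm_mod_c_def c_central)

lemma comm_mod_c_conjg_fixed:
  assumes "p \<in> carrier G" "q \<in> carrier G" "conjg G q p = q \<or> conjg G q p = c \<otimes> q"
  shows "comm_mod_c p q"
proof -
  have 1: "p \<otimes> conjg G q p = q \<otimes> p"
    using assms(1,2) by (simp add: conjg_def m_assoc)
  have 2: "p \<otimes> (c \<otimes> q) = c \<otimes> (p \<otimes> q)"
    using assms(1,2) by (rule c_moves)
  have "q \<otimes> p = p \<otimes> q \<or> q \<otimes> p = c \<otimes> (p \<otimes> q)"
    using assms(3)
  proof
    assume "conjg G q p = q"
    with 1 show ?thesis by simp
  next
    assume "conjg G q p = c \<otimes> q"
    then have "q \<otimes> p = p \<otimes> (c \<otimes> q)" using 1 by simp
    then show ?thesis unfolding 2 by (rule disjI2)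
  qed
  then have "comm_mod_c q p" unfolding comm_mod_c_def .
  then show ?thesis by (rule comm_mod_c_sym[OF assms(2,1)])
qed

text \<open>The centraliser of \<open>P0\<close> modulo \<open>c\<close>. It is normal, so
  \<open>P0_minimal\<close> can be applied to it.\<close>

definition cent_mod_c where "cent_mod_c = {p \<in> carrier G. \<forall>q \<in> P0. comm_mod_c p q}"

lemma cent_mod_c_normal: "cent_mod_c \<lhd> G"
proof (rule normalI_conjg)
  have c: "comm_mod_c q p" if "p \<in> cent_mod_c" "q \<in> P0" for p q
    using that comm_mod_c_sym[of p q] P0.mem_carrier unfolding cent_mod_c_def by blast
  have memI: "p \<in> cent_mod_c" if "p \<in> carrier G" "\<And>q. q \<in> P0 \<Longrightarrow> comm_mod_c q p" for p
    using that comm_mod_c_sym[of _ p] P0.mem_carrier unfolding cent_mod_c_def by blast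
  have Ec: "cent_mod_c \<subseteq> carrier G" by (auto simp: cent_mod_c_def)
  show "subgroup cent_mod_c G"
  proof (rule subgroupI)
    show "cent_mod_c \<subseteq> carrier G" by fact
    have "comm_mod_c q \<one>" if "q \<in> P0" for q
      using P0.mem_carrier[OF that] by (simp add: comm_mod_c_def)
    then show "cent_mod_c \<noteq> {}" using memI[of \<one>] by auto
  next
    fix p assume p: "p \<in> cent_mod_c"
    then have "p \<in> carrier G" using Ec by auto
    then show "inv p \<in> cent_mod_c" using c[OF p] P0.mem_carrier by (intro memI comm_mod_c_inv) auto
    fix p' assume p': "p' \<in> cent_mod_c"
    then have "p' \<in> carrier G" using Ec by auto
    then show "p \<otimes> p' \<in> cent_mod_c" using \<open>p \<in> carrier G\<close> c[OF p] c[OF p'] P0.mem_carrier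
      by (intro memI comm_mod_c_mult) auto
  qed
  show "conjg G p g \<in> cent_mod_c" if "p \<in> cent_mod_c" "g \<in> carrier G" for p g
  proof (rule memI)
    have pc: "p \<in> carrier G" using that Ec by auto
    show "conjg G p g \<in> carrier G" using pc that by simp
    fix q assume q: "q \<in> P0"
    then have "conjg G q (inv g) \<in> P0" using that P0.conjg_mem by simp
    then have "comm_mod_c (conjg G (conjg G q (inv g)) g) (conjg G p g)"
      using c[OF that(1)] that pc P0.mem_carrier by (intro comm_mod_c_conjg) auto
    then show "comm_mod_c q (conjg G p g)" using q P0.mem_carrier that by simp
  qed
qed

text \<open>\<open>x 1 x 1\<close> fixes every generator of \<open>P0\<close> except
  \<open>u 2\<close>, which it multiplies by \<open>c\<close>; the other squares are conjugates of
  the first.\<close>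

lemma sq_cent: "1 \<le> i \<Longrightarrow> i < n \<Longrightarrow> x i \<otimes> x i \<in> cent_mod_c"
proof (induction i rule: nat_induct_at_least)
  case base
  have [simp]: "x 1 \<in> carrier G" "x (Suc 0) \<in> carrier G" using n by auto
  then have X: "x 1 \<otimes> x 1 \<in> carrier G" by simp
  have "comm_mod_c (x 1 \<otimes> x 1) q" if qg: "q \<in> P0_gens" for q
  proof -
    have u1: "conjg G (u 1) (x 1 \<otimes> x 1) = u 1"
    proof -
      have [simp]: "u 1 \<in> carrier G" "u (Suc 0) \<in> carrier G" using n by simp_all
      have u: "conjg G (u 1) (x 1) = c \<otimes> inv (u 1)" using u_self[of 1] n by simp
      have "conjg G (u 1) (x 1 \<otimes> x 1) = conjg G (conjg G (u 1) (x 1)) (x 1)"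
        by (rule conjg_conjg[symmetric]) simp_all
      also have "\<dots> = conjg G c (x 1) \<otimes> conjg G (inv (u 1)) (x 1)"
        unfolding u by (rule conjg_mult) simp_all
      also have "\<dots> = c \<otimes> inv (c \<otimes> inv (u 1))"
        by (simp only: conjg_c conjg_inv u \<open>x 1 \<in> carrier G\<close> \<open>u 1 \<in> carrier G\<close>)
      also have "\<dots> = c \<otimes> (u 1 \<otimes> c)" by (simp add: inv_mult_group)
      also have "u 1 \<otimes> c = c \<otimes> u 1" by (simp add: c_central)
      also have "c \<otimes> (c \<otimes> u 1) = u 1" by simp
      finally show ?thesis .
    qed
    have u2: "conjg G (u 2) (x 1 \<otimes> x 1) = c \<otimes> u 2"
    proof -
      have [simp]: "u 1 \<in> carrier G" "u (Suc 0) \<in> carrier G" "u 2 \<in> carrier G" using n by simp_all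
      have u: "conjg G (u 1) (x 1) = c \<otimes> inv (u 1)" "conjg G (u 2) (x 1) = u 1 \<otimes> u 2"
        using u_self[of 1] u_adjacent(3)[of 1] n by (simp_all add: numeral_2_eq_2)
      have "conjg G (u 2) (x 1 \<otimes> x 1) = conjg G (conjg G (u 2) (x 1)) (x 1)"
        by (rule conjg_conjg[symmetric]) simp_all
      also have "\<dots> = conjg G (u 1 \<otimes> u 2) (x 1)" unfolding u(2) by (rule HOL.refl)
      also have "\<dots> = conjg G (u 1) (x 1) \<otimes> conjg G (u 2) (x 1)"
        by (rule conjg_mult) simp_all
      also have "\<dots> = c \<otimes> inv (u 1) \<otimes> (u 1 \<otimes> u 2)" unfolding u by (rule HOL.refl)
      also have "\<dots> = c \<otimes> u 2" by (simp add: m_assoc)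
      finally show ?thesis .
    qed
    have ui: "conjg G (u i) (x 1 \<otimes> x 1) = u i" if "3 \<le> i" "i < n" for i
      using that u_far[of i 1] n by (simp flip: conjg_conjg)
    consider "q = c" | "q = u 1" | "q = u 2" | i where "q = u i" "3 \<le> i" "i < n"
    proof (cases "q = c")
      case False
      then obtain i where i: "q = u i" "1 \<le> i" "i < n" using qg by (auto simp: P0_gens_def)
      then consider "i = 1" | "i = 2" | "3 \<le> i" by linarith
      then show ?thesis using i that by cases auto
    qed (use that in auto)
    then show ?thesis
    proof cases
      case 1
      then show ?thesis using comm_mod_c_c[OF X] by simp
    next
      case 2
      then show ?thesis using u1 n comm_mod_c_conjg_fixed[OF X, of q] by simp
    next
      case 3
      then show ?thesis using u2 n comm_mod_c_conjg_fixed[OF X, of q] by simp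
    next
      case 4
      then show ?thesis using ui n comm_mod_c_conjg_fixed[OF X, of q] by simp
    qed
  qed
  then have "comm_mod_c (x 1 \<otimes> x 1) q" if "q \<in> P0" for q
    using comm_mod_c_generate[OF X gens_carrier(1) _ that[unfolded P0_def]] by blast
  then show ?case by (simp add: cent_mod_c_def)
next
  case (Suc i)
  interpret E: normal cent_mod_c G by (rule cent_mod_c_normal)
  have "conjg G (conjg G (x i) (x (i + 1))) (x i) = x (i + 1)"
    using Suc braid_conjg(1)[of "x i" "x (i + 1)"] braid[of i] by simp
  then have "conjg G (x i \<otimes> x i) (x (i + 1) \<otimes> x i) = x (i + 1) \<otimes> x (i + 1)"
    using Suc by (simp add: conjg_mult flip: conjg_conjg)
  then show ?case using Suc E.conjg_mem[of "x i \<otimes> x i" "x (i + 1) \<otimes> x i"] by simp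
qed

text \<open>\<open>u 1\<close> is a commutator with \<open>x 2 x 2\<close>, so it lies in
  \<open>cent_mod_c\<close> together with that square, and by minimality so does all of
  \<open>P0\<close>. What remains is \<open>x 1 x 1\<close> against itself.\<close>

lemma P_commute:
  assumes "p \<in> P" "q \<in> P"
  shows "comm_mod_c p q"
proof -
  let ?X = "x 1 \<otimes> x 1"
  have X: "?X \<in> carrier G" using n by simp
  have uE: "u 1 \<in> cent_mod_c"
  proof -
    interpret E: normal cent_mod_c G by (rule cent_mod_c_normal)
    show ?thesis using u_right[of 1] n sq_cent[of 2] E.commutator_mem(2)[of "x 2 \<otimes> x 2"]
      by (simp add: numeral_2_eq_2)
  qed
  then have P0E: "P0 \<subseteq> cent_mod_c" by (rule P0_minimal[OF cent_mod_c_normal])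
  have XE: "?X \<in> cent_mod_c" using sq_cent[of 1] n by simp
  have "P_gens \<subseteq> cent_mod_c"
    using P0E XE unfolding P_gens_def P0_def using generate.incl[of _ P0_gens G] by auto
  then have PE: "P \<subseteq> cent_mod_c"
    unfolding P_def using generate_subgroup_incl normal_imp_subgroup[OF cent_mod_c_normal] by blast
  have gens: "q = ?X \<or> q \<in> P0" if "q \<in> P_gens" for q
    using that unfolding P_gens_def P0_def using generate.incl[of _ P0_gens G] by auto
  have XP: "comm_mod_c ?X r" if "r \<in> P" for r
  proof (rule comm_mod_c_generate[OF X gens_carrier(2)])
    show "r \<in> generate G P_gens" using that by (simp add: P_def)
    show "comm_mod_c ?X q" if "q \<in> P_gens" for q
      using gens[OF that] XE by (auto simp: cent_mod_c_def comm_mod_c_def)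
  qed
  show ?thesis
  proof (rule comm_mod_c_generate[OF _ gens_carrier(2)])
    show p: "p \<in> carrier G" using assms P.mem_carrier by simp
    show "q \<in> generate G P_gens" using assms by (simp add: P_def)
    show "comm_mod_c p q" if "q \<in> P_gens" for q
      using gens[OF that] PE assms XP[of p] comm_mod_c_sym[OF X p] by (auto simp: cent_mod_c_def)
  qed
qed

lemma commutator_P: "p \<in> P \<Longrightarrow> q \<in> P \<Longrightarrow> commutator G p q \<in> {\<one>, c}"
proof -
  assume "p \<in> P" "q \<in> P"
  then have pq: "comm_mod_c p q" "p \<in> carrier G" "q \<in> carrier G" by (auto simp: P_commute)
  then obtain e where e: "e \<in> {\<one>, c}" "p \<otimes> q = e \<otimes> (q \<otimes> p)" using comm_mod_cE by blast
  have ec: "e \<in> carrier G" using e(1) by auto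
  have "commutator G p q = (p \<otimes> q) \<otimes> (inv p \<otimes> inv q)"
    using pq by (simp add: commutator_def m_assoc)
  also have "\<dots> = e" unfolding e(2) using pq ec by (simp add: m_assoc)
  finally show ?thesis using e(1) by simp
qed

end

section \<open>Presented groups\<close>

lemma word_eq_lists:
  "word_eq S R v w \<Longrightarrow> v \<in> lists (S \<times> UNIV) \<and> w \<in> lists (S \<times> UNIV)"
  by (induction rule: word_eq.induct) auto

lemma word_eq_context:
  assumes "word_eq S R v w" "p \<in> lists (S \<times> UNIV)" "q \<in> lists (S \<times> UNIV)"
  shows "word_eq S R (p @ v @ q) (p @ w @ q)"
  using assms
proof (induction rule: word_eq.induct)
  case (refl v)
  then show ?case by (intro word_eq.refl) auto
next
  case (sym v w)
  then show ?case by (blast intro: word_eq.sym)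
next
  case (trans v w z)
  then show ?case by (blast intro: word_eq.trans)
next
  case (cancel p' q' s e)
  then show ?case using word_eq.cancel[of "p @ p'" S "q' @ q" s R e] by auto
next
  case (relation p' q' v w)
  then show ?case using word_eq.relation[of "p @ p'" S "q' @ q" v w R] by auto
qed

lemma word_eq_append:
  assumes "word_eq S R v v'" "word_eq S R w w'"
  shows "word_eq S R (v @ w) (v' @ w')"
  using word_eq_context[OF assms(1), of "[]" w] word_eq_context[OF assms(2), of v' "[]"]
    word_eq_lists[OF assms(1)] word_eq_lists[OF assms(2)]
  by (auto intro: word_eq.trans)

lemma word_class_eq_iff:
  assumes "w \<in> lists (S \<times> UNIV)"
  shows "word_class S R v = word_class S R w \<longleftrightarrow> word_eq S R v w"
proof
  assume "word_class S R v = word_class S R w"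
  moreover have "w \<in> word_class S R w" using assms by (simp add: word_class_def word_eq.refl)
  ultimately show "word_eq S R v w" by (auto simp: word_class_def)
qed (auto simp: word_class_def intro: word_eq.trans word_eq.sym)

lemma carrier_presented_group:
  "carrier (presented_group S R) = word_class S R ` lists (S \<times> UNIV)"
  by (simp add: presented_group_def)

lemma one_presented_group: "\<one>\<^bsub>presented_group S R\<^esub> = word_class S R []"
  by (simp add: presented_group_def)

text \<open>The product is a union over all representatives; as \<open>word_eq\<close> is a
  congruence, all classes in this union coincide.\<close>

lemma mult_presented_group:
  assumes "v \<in> lists (S \<times> UNIV)" "w \<in> lists (S \<times> UNIV)"
  shows "word_class S R v \<otimes>\<^bsub>presented_group S R\<^esub> word_class S R w = word_class S R (v @ w)"
proof -
  have "word_class S R (v' @ w') = word_class S R (v @ w)"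
    if "v' \<in> word_class S R v" "w' \<in> word_class S R w" for v' w'
    using that assms word_eq_append[of S R v v' w w']
    by (subst word_class_eq_iff) (auto simp: word_class_def intro: word_eq.sym)
  moreover have "v \<in> word_class S R v" "w \<in> word_class S R w"
    using assms by (auto simp: word_class_def word_eq.refl)
  ultimately have "(\<Union>v' \<in> word_class S R v. \<Union>w' \<in> word_class S R w. word_class S R (v' @ w'))
      = word_class S R (v @ w)"
    by blast
  then show ?thesis by (simp add: presented_group_def)
qed

definition inverse_word :: "'g word \<Rightarrow> 'g word" where
  "inverse_word w = rev (map (\<lambda>(s, e). (s, \<not> e)) w)"

lemma inverse_word_lists: "w \<in> lists (S \<times> UNIV) \<Longrightarrow> inverse_word w \<in> lists (S \<times> UNIV)"
  by (auto simp: inverse_word_def)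

lemma inverse_word_cancel:
  "w \<in> lists (S \<times> UNIV) \<Longrightarrow> word_eq S R (inverse_word w @ w) []"
proof (induction w)
  case Nil
  then show ?case by (simp add: inverse_word_def word_eq.refl)
next
  case (Cons l w)
  obtain s e where l: "l = (s, e)" by (cases l)
  have "word_eq S R (inverse_word w @ [(s, \<not> e), (s, \<not> \<not> e)] @ w) (inverse_word w @ w)"
    using Cons l inverse_word_lists[of w S] by (intro word_eq.cancel) auto
  then show ?case
    using Cons l by (auto simp: inverse_word_def intro: word_eq.trans)
qed

lemma group_presented_group: "group (presented_group S R)"
proof (rule groupI)
  let ?P = "presented_group S R"
  show "\<one>\<^bsub>?P\<^esub> \<in> carrier ?P" by (auto simp: carrier_presented_group one_presented_group)
  fix x assume x: "x \<in> carrier ?P"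
  then obtain v where v: "v \<in> lists (S \<times> UNIV)" "x = word_class S R v"
    by (auto simp: carrier_presented_group)
  show "\<one>\<^bsub>?P\<^esub> \<otimes>\<^bsub>?P\<^esub> x = x"
    using mult_presented_group[of "[]" S v R] v by (simp add: one_presented_group)
  have "word_class S R (inverse_word v) \<otimes>\<^bsub>?P\<^esub> x = \<one>\<^bsub>?P\<^esub>"
    using v inverse_word_lists[of v S] inverse_word_cancel[of v S R]
    by (simp add: mult_presented_group one_presented_group word_class_eq_iff)
  then show "\<exists>y \<in> carrier ?P. y \<otimes>\<^bsub>?P\<^esub> x = \<one>\<^bsub>?P\<^esub>"
    using v inverse_word_lists[of v S] by (auto simp: carrier_presented_group)
  fix y assume "y \<in> carrier ?P"
  then obtain w where w: "w \<in> lists (S \<times> UNIV)" "y = word_class S R w"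
    by (auto simp: carrier_presented_group)
  show "x \<otimes>\<^bsub>?P\<^esub> y \<in> carrier ?P"
    using v w by (auto simp: mult_presented_group carrier_presented_group)
  fix z assume "z \<in> carrier ?P"
  then obtain t where t: "t \<in> lists (S \<times> UNIV)" "z = word_class S R t"
    by (auto simp: carrier_presented_group)
  show "x \<otimes>\<^bsub>?P\<^esub> y \<otimes>\<^bsub>?P\<^esub> z = x \<otimes>\<^bsub>?P\<^esub> (y \<otimes>\<^bsub>?P\<^esub> z)"
    using v w t mult_presented_group[of "v @ w" S t R] mult_presented_group[of v S "w @ t" R]
    by (simp add: mult_presented_group)
qed

context group
begin

lemma eval_word_closed [simp]:
  "f \<in> S \<rightarrow> carrier G \<Longrightarrow> w \<in> lists (S \<times> UNIV) \<Longrightarrow> eval_word G f w \<in> carrier G"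
proof (induction w)
  case (Cons l w)
  then have "f (fst l) \<in> carrier G" by auto
  then show ?case using Cons by (cases l) auto
qed simp

lemma eval_word_append:
  assumes "f \<in> S \<rightarrow> carrier G" "v \<in> lists (S \<times> UNIV)" "w \<in> lists (S \<times> UNIV)"
  shows "eval_word G f (v @ w) = eval_word G f v \<otimes> eval_word G f w"
  using assms(2)
proof (induction v)
  case Nil
  then show ?case using assms by simp
next
  case (Cons l v)
  then have "f (fst l) \<in> carrier G" using assms(1) by auto
  then show ?case using Cons assms by (cases l) (auto simp: m_assoc)
qed

lemma eval_word_respects:
  assumes f: "f \<in> S \<rightarrow> carrier G"
    and R: "\<And>v w. (v, w) \<in> R \<Longrightarrow> eval_word G f v = eval_word G f w"
    and "word_eq S R v w"
  shows "eval_word G f v = eval_word G f w"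
  using assms(3)
proof (induction rule: word_eq.induct)
  case (cancel p q s e)
  have "f s \<in> carrier G" using cancel f by auto
  then have "eval_word G f ([(s, e), (s, \<not> e)] @ q) = eval_word G f q"
    using cancel f by (cases e) simp_all
  then show ?case
    using cancel f eval_word_append[OF f, of p "[(s, e), (s, \<not> e)] @ q"] eval_word_append[OF f, of p q]
    by simp
next
  case (relation p q v w)
  then have vw: "eval_word G f (v @ q) = eval_word G f (w @ q)"
    using R[of v w] by (simp add: eval_word_append[OF f])
  show ?case
    using relation vw eval_word_append[OF f, of p "v @ q"] eval_word_append[OF f, of p "w @ q"] by simp
qed auto

lemma induced_map_word_class:
  assumes f: "f \<in> S \<rightarrow> carrier G"
    and R: "\<And>v w. (v, w) \<in> R \<Longrightarrow> eval_word G f v = eval_word G f w"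
    and w: "w \<in> lists (S \<times> UNIV)"
  shows "induced_map (eval_word G f) (word_class S R w) = eval_word G f w"
proof -
  have "w \<in> word_class S R w" using w by (simp add: word_class_def word_eq.refl)
  then have "word_class S R w \<noteq> {}" by auto
  moreover have "eval_word G f w' = eval_word G f w" if "w' \<in> word_class S R w" for w'
  proof -
    have "word_eq S R w w'" using that by (simp add: word_class_def)
    then show ?thesis using eval_word_respects[OF f] R by metis
  qed
  ultimately show ?thesis unfolding induced_map_def by (rule the_elem_image_unique)
qed

lemma induced_map_presented_hom:
  assumes f: "f \<in> S \<rightarrow> carrier G"
    and R: "\<And>v w. (v, w) \<in> R \<Longrightarrow> eval_word G f v = eval_word G f w"
  shows "induced_map (eval_word G f) \<in> hom (presented_group S R) G"
proof (rule homI)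
  note v = induced_map_word_class[OF assms]
  fix x y assume "x \<in> carrier (presented_group S R)" "y \<in> carrier (presented_group S R)"
  then obtain p q where "x = word_class S R p" "p \<in> lists (S \<times> UNIV)"
      "y = word_class S R q" "q \<in> lists (S \<times> UNIV)"
    by (auto simp: carrier_presented_group)
  moreover have "p @ q \<in> lists (S \<times> UNIV)" using calculation by auto
  ultimately show "induced_map (eval_word G f) x \<in> carrier G"
    "induced_map (eval_word G f) (x \<otimes>\<^bsub>presented_group S R\<^esub> y)
      = induced_map (eval_word G f) x \<otimes> induced_map (eval_word G f) y"
    using f by (simp_all add: v mult_presented_group eval_word_append[OF f])
qed

end

lemma inv_word_class_gen:
  assumes "s \<in> S"
  shows "inv\<^bsub>presented_group S R\<^esub> (word_class S R [(s, True)]) = word_class S R [(s, False)]"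
proof -
  interpret group "presented_group S R" by (rule group_presented_group)
  have "word_eq S R ([] @ [(s, False), (s, \<not> False)] @ []) ([] @ [])"
    using assms by (intro word_eq.cancel) auto
  then have "word_class S R [(s, False)] \<otimes>\<^bsub>presented_group S R\<^esub> word_class S R [(s, True)]
      = \<one>\<^bsub>presented_group S R\<^esub>"
    using assms by (simp add: mult_presented_group one_presented_group word_class_eq_iff)
  then show ?thesis
    using assms by (intro inv_equality) (auto simp: carrier_presented_group)
qed

lemma presented_group_generated:
  "carrier (presented_group S R)
    = generate (presented_group S R) ((\<lambda>s. word_class S R [(s, True)]) ` S)"
proof -
  let ?P = "presented_group S R" and ?g = "\<lambda>s. word_class S R [(s, True)]"
  interpret group ?P by (rule group_presented_group)
  have "word_class S R w \<in> generate ?P (?g ` S)" if "w \<in> lists (S \<times> UNIV)" for w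
    using that
  proof (induction w)
    case Nil
    then show ?case using generate.one[of ?P] by (simp add: one_presented_group)
  next
    case (Cons l w)
    obtain s e where l: "l = (s, e)" by (cases l)
    then have s: "s \<in> S" using Cons by auto
    have "word_class S R [l] \<in> generate ?P (?g ` S)"
      using s l inv_word_class_gen[OF s, of R] generate.incl[of "?g s" "?g ` S" ?P]
        generate.inv[of "?g s" "?g ` S" ?P]
      by (cases e) auto
    moreover have "word_class S R (l # w) = word_class S R [l] \<otimes>\<^bsub>?P\<^esub> word_class S R w"
      using Cons s l by (subst mult_presented_group) auto
    ultimately show ?case using Cons by (auto intro: generate.eng)
  qed
  moreover have "?g ` S \<subseteq> carrier ?P" by (auto simp: carrier_presented_group)
  then have "generate ?P (?g ` S) \<subseteq> carrier ?P" using generate_in_carrier by auto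
  ultimately show ?thesis by (auto simp: carrier_presented_group)
qed

section \<open>The group \<open>\<tilde>B\<^sub>n\<close>\<close>

context group
begin

lemma normal_closure_subset: "S \<subseteq> normal_closure G S"
  by (auto simp: normal_closure_def)

lemma normal_closure_minimal: "N \<lhd> G \<Longrightarrow> S \<subseteq> N \<Longrightarrow> normal_closure G S \<subseteq> N"
  by (auto simp: normal_closure_def)

lemma normal_closure_normal:
  assumes "S \<subseteq> carrier G"
  shows "normal_closure G S \<lhd> G"
proof (rule normalI_conjg)
  show "subgroup (normal_closure G S) G"
    unfolding normal_closure_def
    using assms normal_self by (intro subgroups_Inter) (auto dest: normal_imp_subgroup)
  show "conjg G h g \<in> normal_closure G S" if "h \<in> normal_closure G S" "g \<in> carrier G" for h g
    using that by (auto simp: normal_closure_def intro: normal.conjg_mem)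
qed

lemma conjg_eqI:
  "b \<in> carrier G \<Longrightarrow> g \<in> carrier G \<Longrightarrow> t \<in> carrier G \<Longrightarrow> g \<otimes> t = b \<otimes> g \<Longrightarrow> conjg G b g = t"
  by (metis conjg_def inv_cancel_left(1) inv_closed m_assoc)

end

text \<open>Far commutation is stated for \<open>i\<close> to the left of \<open>j\<close> only, the
  other order being symmetric, although \<open>braid_relations\<close> lists both.\<close>

definition braid_images :: "('a, 'b) monoid_scheme \<Rightarrow> nat \<Rightarrow> (nat \<Rightarrow> 'a) \<Rightarrow> bool" where
  "braid_images K n f \<longleftrightarrow> f \<in> {1..<n} \<rightarrow> carrier K \<and>
    (\<forall>i j. 1 \<le> i \<and> i + 1 < j \<and> j < n \<longrightarrow> f i \<otimes>\<^bsub>K\<^esub> f j = f j \<otimes>\<^bsub>K\<^esub> f i) \<and>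
    (\<forall>i. 1 \<le> i \<and> i + 1 < n \<longrightarrow>
      f i \<otimes>\<^bsub>K\<^esub> f (i + 1) \<otimes>\<^bsub>K\<^esub> f i = f (i + 1) \<otimes>\<^bsub>K\<^esub> f i \<otimes>\<^bsub>K\<^esub> f (i + 1))"

lemma eval_braid_relations:
  assumes "group K" "braid_images K n f" "(v, w) \<in> braid_relations n"
  shows "eval_word K f v = eval_word K f w"
proof -
  interpret group K by fact
  have [simp]: "f i \<in> carrier K" if "1 \<le> i" "i < n" for i
    using assms(2) that by (auto simp: braid_images_def)
  from assms(3) consider i j where "v = [(i, True), (j, True)]" "w = [(j, True), (i, True)]"
      "1 \<le> i" "i < n" "1 \<le> j" "j < n" "i + 1 < j \<or> j + 1 < i"
    | i where "v = [(i, True), (i + 1, True), (i, True)]" "w = [(i + 1, True), (i, True), (i + 1, True)]"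
      "1 \<le> i" "i + 1 < n"
    unfolding braid_relations_def by (auto simp: abs_if split: if_splits)
  then show ?thesis
  proof cases
    case 1
    then have "f i \<otimes>\<^bsub>K\<^esub> f j = f j \<otimes>\<^bsub>K\<^esub> f i"
      using assms(2) unfolding braid_images_def by metis
    then show ?thesis using 1 by simp
  next
    case 2
    then have "f i \<otimes>\<^bsub>K\<^esub> f (i + 1) \<otimes>\<^bsub>K\<^esub> f i = f (i + 1) \<otimes>\<^bsub>K\<^esub> f i \<otimes>\<^bsub>K\<^esub> f (i + 1)"
      using assms(2) unfolding braid_images_def by blast
    then show ?thesis using 2 by (simp add: m_assoc)
  qed
qed

lemma group_braid_group: "group (braid_group n)"
  unfolding braid_group_def by (rule group_presented_group)

lemma braid_gen_closed: "i \<in> {1..<n} \<Longrightarrow> braid_gen n i \<in> carrier (braid_group n)"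
  by (auto simp: braid_gen_def braid_group_def carrier_presented_group)

lemma braid_hom:
  assumes "group K" "braid_images K n f"
  shows "induced_map (eval_word K f) \<in> hom (braid_group n) K"
    and "i \<in> {1..<n} \<Longrightarrow> induced_map (eval_word K f) (braid_gen n i) = f i"
proof -
  interpret group K by fact
  have f: "f \<in> {1..<n} \<rightarrow> carrier K" using assms(2) by (simp add: braid_images_def)
  note R = eval_braid_relations[OF assms]
  show "induced_map (eval_word K f) \<in> hom (braid_group n) K"
    unfolding braid_group_def using f R by (rule induced_map_presented_hom)
  assume i: "i \<in> {1..<n}"
  then have "f i \<in> carrier K" using f by auto
  then show "induced_map (eval_word K f) (braid_gen n i) = f i"
    unfolding braid_gen_def using i by (subst induced_map_word_class[OF f R]) auto
qed

lemma braid_images_braid_gen: "braid_images (braid_group n) n (braid_gen n)"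
proof -
  let ?S = "{1..<n}" and ?R = "braid_relations n"
  have rel: "word_class ?S ?R v = word_class ?S ?R w"
    if "(v, w) \<in> ?R" "v \<in> lists (?S \<times> UNIV)" "w \<in> lists (?S \<times> UNIV)" for v w
    using that word_eq.relation[of "[]" ?S "[]" v w ?R] by (simp add: word_class_eq_iff)
  have far: "([(i, True), (j, True)], [(j, True), (i, True)]) \<in> ?R" if "1 \<le> i" "i + 1 < j" "j < n" for i j
    using that unfolding braid_relations_def by auto
  have braid: "([(i, True), (i + 1, True), (i, True)], [(i + 1, True), (i, True), (i + 1, True)]) \<in> ?R"
    if "1 \<le> i" "i + 1 < n" for i
    using that unfolding braid_relations_def by auto
  show ?thesis
    unfolding braid_images_def
  proof (intro conjI allI impI)
    show "braid_gen n \<in> ?S \<rightarrow> carrier (braid_group n)" using braid_gen_closed by auto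
    show "braid_gen n i \<otimes>\<^bsub>braid_group n\<^esub> braid_gen n j = braid_gen n j \<otimes>\<^bsub>braid_group n\<^esub> braid_gen n i"
      if "1 \<le> i \<and> i + 1 < j \<and> j < n" for i j
      using that rel[OF far[of i j]] by (simp add: braid_gen_def braid_group_def mult_presented_group)
    show "braid_gen n i \<otimes>\<^bsub>braid_group n\<^esub> braid_gen n (i + 1) \<otimes>\<^bsub>braid_group n\<^esub> braid_gen n i
        = braid_gen n (i + 1) \<otimes>\<^bsub>braid_group n\<^esub> braid_gen n i \<otimes>\<^bsub>braid_group n\<^esub> braid_gen n (i + 1)"
      if "1 \<le> i \<and> i + 1 < n" for i
      using that rel[OF braid[of i]] by (simp add: braid_gen_def braid_group_def mult_presented_group)
  qed
qed

lemma braid_group_generated: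
  "carrier (braid_group n) = generate (braid_group n) (braid_gen n ` {1..<n})"
  using presented_group_generated[of "{1..<n}" "braid_relations n"]
  unfolding braid_group_def braid_gen_def .

definition transversal_images :: "('a, 'b) monoid_scheme \<Rightarrow> (nat \<Rightarrow> 'a) \<Rightarrow> bool" where
  "transversal_images K f \<longleftrightarrow>
    f 2 \<otimes>\<^bsub>K\<^esub> conjg K (f 2) (f 1 \<otimes>\<^bsub>K\<^esub> f 3) = conjg K (f 2) (f 1 \<otimes>\<^bsub>K\<^esub> f 3) \<otimes>\<^bsub>K\<^esub> f 2"

lemma Bt_kernel_normal:
  assumes "4 \<le> n"
  shows "Bt_kernel n \<lhd> braid_group n"
proof -
  interpret group "braid_group n" by (rule group_braid_group)
  have "braid_gen n i \<in> carrier (braid_group n)" if "i \<in> {1, 2, 3}" for i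
    using that assms by (auto intro!: braid_gen_closed)
  then show ?thesis
    unfolding Bt_kernel_def Let_def by (intro normal_closure_normal) auto
qed

lemma Bt_kernel_trivial:
  assumes "4 \<le> n" "group K" "braid_images K n f" "transversal_images K f" "g \<in> Bt_kernel n"
  shows "induced_map (eval_word K f) g = \<one>\<^bsub>K\<^esub>"
proof -
  interpret B: group "braid_group n" by (rule group_braid_group)
  interpret K: group K by fact
  interpret h: group_hom "braid_group n" K "induced_map (eval_word K f)"
    by (intro group_hom.intro group_hom_axioms.intro group_braid_group assms(2) braid_hom(1)[OF assms(2,3)])
  note val = braid_hom(2)[OF assms(2,3)]
  have x: "braid_gen n i \<in> carrier (braid_group n)" if "i \<in> {1, 2, 3}" for i
    using that assms by (auto intro!: braid_gen_closed)
  have f: "f i \<in> carrier K" if "i \<in> {1, 2, 3}" for i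
    using that assms(1,3) by (auto simp: braid_images_def)
  let ?r = "commutator (braid_group n) (braid_gen n 2)
    (conjg (braid_group n) (braid_gen n 2) (braid_gen n 1 \<otimes>\<^bsub>braid_group n\<^esub> braid_gen n 3))"
  have "induced_map (eval_word K f) ?r = commutator K (f 2) (conjg K (f 2) (f 1 \<otimes>\<^bsub>K\<^esub> f 3))"
    using x assms(1) by (simp add: h.hom_commutator h.hom_conjg val)
  also have "\<dots> = \<one>\<^bsub>K\<^esub>"
    using assms(4) f by (simp add: transversal_images_def commutator_def K.m_assoc)
  finally have "{?r} \<subseteq> kernel (braid_group n) K (induced_map (eval_word K f))"
    using x by (simp add: kernel_def)
  then have "Bt_kernel n \<subseteq> kernel (braid_group n) K (induced_map (eval_word K f))"
    unfolding Bt_kernel_def Let_def by (rule B.normal_closure_minimal[OF h.normal_kernel])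
  then show ?thesis using assms(5) by (auto simp: kernel_def)
qed

text \<open>The universal property of \<open>Bt n\<close>. It supplies the permutation, the degree
  and the two representations that detect the lattice and \<open>c\<close>.\<close>

lemma Bt_hom:
  assumes "4 \<le> n" "group K" "braid_images K n f" "transversal_images K f"
  shows "induced_map (induced_map (eval_word K f)) \<in> hom (Bt n) K"
    and "i \<in> {1..<n} \<Longrightarrow> induced_map (induced_map (eval_word K f)) (Bt_gen n i) = f i"
proof -
  show "induced_map (induced_map (eval_word K f)) \<in> hom (Bt n) K"
    unfolding Bt_def
    using Bt_kernel_normal[OF assms(1)] braid_hom(1)[OF assms(2,3)] assms(2) Bt_kernel_trivial[OF assms]
    by (rule induced_map_hom)
  assume i: "i \<in> {1..<n}"
  show "induced_map (induced_map (eval_word K f)) (Bt_gen n i) = f i"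
    unfolding Bt_gen_def
    using induced_map_coset[OF Bt_kernel_normal[OF assms(1)] braid_hom(1)[OF assms(2,3)] assms(2)
        Bt_kernel_trivial[OF assms] braid_gen_closed[OF i]] braid_hom(2)[OF assms(2,3) i]
    by simp
qed

lemma group_Bt: "4 \<le> n \<Longrightarrow> group (Bt n)"
  unfolding Bt_def using Bt_kernel_normal by (rule normal.factorgroup_is_group)

lemma tilde_braid_Bt:
  assumes n: "5 \<le> n"
  shows "tilde_braid (Bt n) n (Bt_gen n)"
proof -
  let ?B = "braid_group n" and ?N = "Bt_kernel n"
  interpret N: normal ?N ?B using Bt_kernel_normal n by simp
  interpret M: group "Bt n" using group_Bt n by simp
  let ?r = "\<lambda>g. ?N #>\<^bsub>?B\<^esub> g"
  interpret r: group_hom ?B "Bt n" ?r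
    using N.r_coset_hom_Mod M.group_axioms N.group_axioms
    by (simp add: group_hom_def group_hom_axioms_def Bt_def)
  have gen: "Bt_gen n i = ?r (braid_gen n i)" for i by (simp add: Bt_gen_def)
  have x: "braid_gen n i \<in> carrier ?B" if "1 \<le> i" "i < n" for i
    using that by (intro braid_gen_closed) auto
  note b = braid_images_braid_gen[of n, unfolded braid_images_def]
  have mult: "?r y \<otimes>\<^bsub>Bt n\<^esub> ?r z = ?r (y \<otimes>\<^bsub>?B\<^esub> z)" if "y \<in> carrier ?B" "z \<in> carrier ?B" for y z
    using that by simp
  show ?thesis
  proof (intro tilde_braid.intro tilde_braid_axioms.intro M.group_axioms n)
    show "Bt_gen n i \<in> carrier (Bt n)" if "i \<in> {1..<n}" for i
      using that x r.hom_closed by (simp add: gen)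
    show "Bt_gen n i \<otimes>\<^bsub>Bt n\<^esub> Bt_gen n j = Bt_gen n j \<otimes>\<^bsub>Bt n\<^esub> Bt_gen n i"
      if "1 \<le> i" "i + 1 < j" "j < n" for i j
    proof -
      have "braid_gen n i \<otimes>\<^bsub>?B\<^esub> braid_gen n j = braid_gen n j \<otimes>\<^bsub>?B\<^esub> braid_gen n i"
        using b that by blast
      moreover have "i < n" "1 \<le> j" using that by auto
      ultimately show ?thesis unfolding gen using that x mult by metis
    qed
    show "Bt_gen n i \<otimes>\<^bsub>Bt n\<^esub> Bt_gen n (i + 1) \<otimes>\<^bsub>Bt n\<^esub> Bt_gen n i
        = Bt_gen n (i + 1) \<otimes>\<^bsub>Bt n\<^esub> Bt_gen n i \<otimes>\<^bsub>Bt n\<^esub> Bt_gen n (i + 1)"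
      if "1 \<le> i" "i + 1 < n" for i
    proof -
      have "braid_gen n i \<otimes>\<^bsub>?B\<^esub> braid_gen n (i + 1) \<otimes>\<^bsub>?B\<^esub> braid_gen n i
          = braid_gen n (i + 1) \<otimes>\<^bsub>?B\<^esub> braid_gen n i \<otimes>\<^bsub>?B\<^esub> braid_gen n (i + 1)"
        using b that by blast
      moreover have "braid_gen n i \<in> carrier ?B" "braid_gen n (i + 1) \<in> carrier ?B"
        using that by (auto intro!: x)
      ultimately show ?thesis unfolding gen using mult N.m_closed by (metis N.is_group group.is_monoid monoid.m_closed)
    qed
    show "carrier (Bt n) = generate (Bt n) (Bt_gen n ` {1..<n})"
    proof -
      have "carrier (Bt n) = ?r ` carrier ?B" by (simp add: Bt_def carrier_FactGroup)
      also have "\<dots> = generate (Bt n) (?r ` braid_gen n ` {1..<n})"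
        unfolding braid_group_generated[of n]
        by (rule r.generate_img[symmetric]) (auto intro: x)
      finally show ?thesis by (simp add: image_image gen)
    qed
    have x': "braid_gen n i \<in> carrier ?B" if "i \<in> {1, 2, 3}" for i
      using that n by (auto intro!: x)
    let ?y = "conjg ?B (braid_gen n 2) (braid_gen n 1 \<otimes>\<^bsub>?B\<^esub> braid_gen n 3)"
    have y: "?y \<in> carrier ?B" using x' by simp
    have "commutator ?B (braid_gen n 2) ?y \<in> ?N"
      unfolding Bt_kernel_def Let_def using N.normal_closure_subset by blast
    then have "?r (commutator ?B (braid_gen n 2) ?y) = \<one>\<^bsub>Bt n\<^esub>"
      using N.rcos_const by (simp add: Bt_def)
    moreover have "?r (commutator ?B (braid_gen n 2) ?y) = commutator (Bt n) (?r (braid_gen n 2)) (?r ?y)"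
      by (rule r.hom_commutator) (use x' y in auto)
    ultimately have "commutator (Bt n) (?r (braid_gen n 2)) (?r ?y) = \<one>\<^bsub>Bt n\<^esub>" by simp
    moreover have ry: "?r ?y = conjg (Bt n) (Bt_gen n 2) (Bt_gen n 1 \<otimes>\<^bsub>Bt n\<^esub> Bt_gen n 3)"
      using x' by (simp add: gen r.hom_conjg)
    ultimately have "commutator (Bt n) (Bt_gen n 2)
        (conjg (Bt n) (Bt_gen n 2) (Bt_gen n 1 \<otimes>\<^bsub>Bt n\<^esub> Bt_gen n 3)) = \<one>\<^bsub>Bt n\<^esub>"
      unfolding gen by simp
    moreover have "s \<otimes>\<^bsub>Bt n\<^esub> t = t \<otimes>\<^bsub>Bt n\<^esub> s"
      if "commutator (Bt n) s t = \<one>\<^bsub>Bt n\<^esub>" "s \<in> carrier (Bt n)" "t \<in> carrier (Bt n)" for s t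
    proof -
      have "commutator (Bt n) s t \<otimes>\<^bsub>Bt n\<^esub> (t \<otimes>\<^bsub>Bt n\<^esub> s) = t \<otimes>\<^bsub>Bt n\<^esub> s" using that by simp
      then show ?thesis using that by (simp add: commutator_def M.m_assoc)
    qed
    moreover have "Bt_gen n 2 \<in> carrier (Bt n)" using x' r.hom_closed unfolding gen by blast
    moreover have "conjg (Bt n) (Bt_gen n 2) (Bt_gen n 1 \<otimes>\<^bsub>Bt n\<^esub> Bt_gen n 3) \<in> carrier (Bt n)"
      unfolding ry[symmetric] by (rule r.hom_closed[OF y])
    ultimately show "Bt_gen n 2 \<otimes>\<^bsub>Bt n\<^esub> conjg (Bt n) (Bt_gen n 2) (Bt_gen n 1 \<otimes>\<^bsub>Bt n\<^esub> Bt_gen n 3)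
        = conjg (Bt n) (Bt_gen n 2) (Bt_gen n 1 \<otimes>\<^bsub>Bt n\<^esub> Bt_gen n 3) \<otimes>\<^bsub>Bt n\<^esub> Bt_gen n 2"
      by blast
  qed
qed

lemma braid_images_sym: "braid_images (sym_group n) n (\<lambda>i. transpose i (i + 1))"
  unfolding braid_images_def
  by (auto simp: sym_group_carrier sym_group_mult fun_eq_iff transpose_def intro!: permutes_swap_id)

text \<open>Conjugating the transposition (2 3) by (1 2)(3 4) gives (1 4), which is disjoint from (2
  3).\<close>

lemma transversal_images_sym:
  assumes "4 \<le> n"
  shows "transversal_images (sym_group n) (\<lambda>i. transpose i (i + 1))"
proof -
  interpret group "sym_group n" by (rule sym_group_is_group)
  have c: "transpose i j \<in> carrier (sym_group n)" if "i \<in> {1..4}" "j \<in> {1..4}" for i j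
    using assms that by (auto simp: sym_group_carrier intro!: permutes_swap_id)
  have "conjg (sym_group n) (transpose 2 (2 + 1)) (transpose 1 (1 + 1) \<otimes>\<^bsub>sym_group n\<^esub> transpose 3 (3 + 1))
      = transpose 1 4"
    using c[of 2 3] c[of 1 4] m_closed[OF c[of 1 "1 + 1"] c[of 3 "3 + 1"]]
    by (intro conjg_eqI) (auto simp: sym_group_mult fun_eq_iff transpose_def)
  then show ?thesis
    unfolding transversal_images_def by (auto simp: sym_group_mult fun_eq_iff transpose_def)
qed

lemma braid_images_degree: "braid_images integer_group n (\<lambda>i. 1)"
  by (simp add: braid_images_def)

lemma transversal_images_degree: "transversal_images integer_group (\<lambda>i. 1)"
  by (simp add: transversal_images_def)

lemma tilde_braid_maps_Bt:
  assumes n: "5 \<le> n"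
  shows "tilde_braid_maps (Bt n) n (Bt_gen n) (psi n) (Bt_degree n)"
proof -
  have n4: "4 \<le> n" using n by simp
  note s = Bt_hom[OF n4 sym_group_is_group braid_images_sym transversal_images_sym[OF n4]]
  note d = Bt_hom[OF n4 group_integer_group braid_images_degree transversal_images_degree]
  show ?thesis
    using s d unfolding psi_def braid_perm_def Bt_degree_def braid_degree_def
    by (intro tilde_braid_maps.intro tilde_braid_maps_axioms.intro tilde_braid_Bt n) auto
qed

lemma u_elt_eq:
  assumes n: "5 \<le> n"
  shows "u_elt n = tilde_braid.u (Bt n) (Bt_gen n) 1"
proof -
  interpret tilde_braid "Bt n" n "Bt_gen n" by (rule tilde_braid_Bt[OF n])
  let ?x = "Bt_gen n"
  have [simp]: "?x 1 \<in> carrier (Bt n)" "?x (Suc 0) \<in> carrier (Bt n)" "?x 2 \<in> carrier (Bt n)"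
    using n by auto
  have sq: "y [^]\<^bsub>Bt n\<^esub> (2::int) = y \<otimes>\<^bsub>Bt n\<^esub> y" if "y \<in> carrier (Bt n)" for y
    using that int_pow_mult[of y 1 1] by simp
  have sqi: "y [^]\<^bsub>Bt n\<^esub> (-2::int) = inv\<^bsub>Bt n\<^esub> (y \<otimes>\<^bsub>Bt n\<^esub> y)" if "y \<in> carrier (Bt n)" for y
    using that int_pow_neg[of y 2] by (simp add: sq)
  have "conjg (Bt n) (?x 1) (inv\<^bsub>Bt n\<^esub> ?x 2) = conjg (Bt n) (?x 2) (?x 1)"
    using braid_conjg(2)[of "?x 1" "?x 2"] braid[of 1] n by (simp add: numeral_2_eq_2)
  then show ?thesis
    using n by (simp add: u_elt_def sq sqi conjg_mult u_right)
      (simp add: commutator_def conjg_def m_assoc numeral_2_eq_2)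
qed

lemma c_elt_eq:
  assumes n: "5 \<le> n"
  shows "c_elt n = tilde_braid.c (Bt n) (Bt_gen n)"
proof -
  interpret tilde_braid "Bt n" n "Bt_gen n" by (rule tilde_braid_Bt[OF n])
  have sq: "y [^]\<^bsub>Bt n\<^esub> (2::int) = y \<otimes>\<^bsub>Bt n\<^esub> y" if "y \<in> carrier (Bt n)" for y
    using that int_pow_mult[of y 1 1] by simp
  show ?thesis using n by (simp add: c_elt_def c_def sq)
qed

lemma Pt0_eq:
  assumes n: "5 \<le> n"
  shows "Pt0 n = tilde_braid_maps.P0 (Bt n) n (Bt_gen n)"
  unfolding Pt0_def using tilde_braid_maps.perm_degree_kernel[OF tilde_braid_maps_Bt[OF n]] .

section \<open>Two quotients of \<open>\<tilde>B\<^sub>n\<close>\<close>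

text \<open>The half-twist \<open>x\<^sub>i\<close> acts as \<open>1 + J\<^sub>i\<close>, where the operators \<open>J\<^sub>i\<close> satisfy
  \<open>J\<^sub>i\<^sup>2 = -1\<close>, anticommute for neighbouring indices and commute otherwise. They are
  Pauli strings: for odd \<open>i = 2 k + 1\<close> flips of the bits \<open>k\<close> and \<open>k + 1\<close>, for even \<open>i = 2 k\<close>
  the sign of bit \<open>k\<close>, both times the imaginary unit.\<close>

definition bij_group :: "('a \<Rightarrow> 'a) monoid" where
  "bij_group = \<lparr>carrier = {f. bij f}, monoid.mult = (\<circ>), one = id\<rparr>"

lemma bij_group_simps [simp]:
  "carrier bij_group = {f. bij f}" "f \<otimes>\<^bsub>bij_group\<^esub> g = f \<circ> g" "\<one>\<^bsub>bij_group\<^esub> = id"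
  by (simp_all add: bij_group_def)

lemma group_bij_group: "group bij_group"
proof (rule groupI)
  fix f :: "'a \<Rightarrow> 'a" assume "f \<in> carrier bij_group"
  then show "\<exists>g \<in> carrier bij_group. g \<otimes>\<^bsub>bij_group\<^esub> f = \<one>\<^bsub>bij_group\<^esub>"
    by (intro bexI[of _ "inv' f"]) (auto simp: bij_is_inj bij_imp_bij_inv)
qed (auto simp: bij_comp comp_assoc)

text \<open>Indexing by infinite bit sequences lets one space serve every \<open>n\<close>; the
  proof uses only that the twists are bijections of it, never linearity.\<close>

type_synonym spin_vec = "(nat \<Rightarrow> bool) \<Rightarrow> complex"

definition spin_flip :: "nat \<Rightarrow> (nat \<Rightarrow> bool) \<Rightarrow> nat \<Rightarrow> bool" where
  "spin_flip i s = (if even i then s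
    else s(i div 2 := \<not> s (i div 2), i div 2 + 1 := \<not> s (i div 2 + 1)))"

definition spin_phase :: "nat \<Rightarrow> (nat \<Rightarrow> bool) \<Rightarrow> complex" where
  "spin_phase i s = (if even i \<and> s (i div 2) then - \<i> else \<i>)"

lemma spin_flip_flip [simp]: "spin_flip i (spin_flip i s) = s"
  by (auto simp: spin_flip_def fun_eq_iff)

lemma spin_flip_commute: "spin_flip i (spin_flip j s) = spin_flip j (spin_flip i s)"
  by (auto simp: spin_flip_def fun_eq_iff)

lemma spin_phase_sq [simp]: "spin_phase i s * spin_phase i s = -1"
    "spin_phase i s * (spin_phase i s * z) = - z"
  by (simp_all add: spin_phase_def)

lemma spin_phase_self [simp]: "spin_phase i (spin_flip i s) = spin_phase i s"
  by (simp add: spin_phase_def spin_flip_def)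

lemma spin_phase_far: "i + 1 < j \<or> j + 1 < i \<Longrightarrow> spin_phase i (spin_flip j s) = spin_phase i s"
  by (auto simp: spin_phase_def spin_flip_def elim!: evenE oddE)

lemma spin_phase_adjacent:
  "odd i \<Longrightarrow> spin_phase (Suc i) (spin_flip i s) = - spin_phase (Suc i) s"
  "even i \<Longrightarrow> spin_phase i (spin_flip (Suc i) s) = - spin_phase i s"
  by (auto simp: spin_phase_def spin_flip_def elim!: evenE oddE)

lemma spin_flip_even: "even i \<Longrightarrow> spin_flip i s = s"
  by (simp add: spin_flip_def)

lemma spin_phase_odd: "odd i \<Longrightarrow> spin_phase i s = \<i>"
  by (simp add: spin_phase_def)

definition spin_twist :: "nat \<Rightarrow> spin_vec \<Rightarrow> spin_vec" where
  "spin_twist i f = (\<lambda>s. f s + spin_phase i s * f (spin_flip i s))"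

lemma bij_spin_twist: "bij (spin_twist i)"
\<comment> \<open>As \<open>J_i\<close> has square -1, the inverse of \<open>1 + J_i\<close> is
  \<open>(1 - J_i) / 2\<close>.\<close>
proof (rule bij_betw_byWitness[where f' = "\<lambda>f s. (f s - spin_phase i s * f (spin_flip i s)) / 2"])
  show "\<forall>f \<in> UNIV. (\<lambda>s. (spin_twist i f s - spin_phase i s * spin_twist i f (spin_flip i s)) / 2) = f"
    by (auto simp: spin_twist_def fun_eq_iff algebra_simps)
  show "\<forall>f \<in> UNIV. spin_twist i (\<lambda>s. (f s - spin_phase i s * f (spin_flip i s)) / 2) = f"
    by (auto simp: spin_twist_def fun_eq_iff field_simps)
qed auto

lemma braid_images_spin: "braid_images bij_group n spin_twist"
  unfolding braid_images_def
proof (intro conjI allI impI)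
  show "spin_twist i \<otimes>\<^bsub>bij_group\<^esub> spin_twist j = spin_twist j \<otimes>\<^bsub>bij_group\<^esub> spin_twist i"
    if "1 \<le> i \<and> i + 1 < j \<and> j < n" for i j
    using that
    by (auto simp: fun_eq_iff spin_twist_def spin_phase_far spin_flip_commute[of i j] algebra_simps)
  show "spin_twist i \<otimes>\<^bsub>bij_group\<^esub> spin_twist (i + 1) \<otimes>\<^bsub>bij_group\<^esub> spin_twist i
      = spin_twist (i + 1) \<otimes>\<^bsub>bij_group\<^esub> spin_twist i \<otimes>\<^bsub>bij_group\<^esub> spin_twist (i + 1)" for i
    by (cases "even i")
      (auto simp: fun_eq_iff spin_twist_def spin_phase_adjacent spin_flip_even spin_phase_odd algebra_simps)
qed (auto simp: bij_spin_twist)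

lemma transversal_images_spin: "transversal_images bij_group spin_twist"
proof -
  interpret group "bij_group :: (spin_vec \<Rightarrow> spin_vec) monoid" by (rule group_bij_group)
  have [simp]: "spin_flip 2 s = s" for s by (simp add: spin_flip_def)
  have [simp]: "spin_phase 2 (spin_flip 1 s) = - spin_phase 2 s" "spin_phase 2 (spin_flip (Suc 0) s) = - spin_phase 2 s"
    "spin_phase 2 (spin_flip 3 s) = - spin_phase 2 s"
    "spin_phase 1 (spin_flip 3 s) = spin_phase 1 s" "spin_phase (Suc 0) (spin_flip 3 s) = spin_phase (Suc 0) s"
    "spin_phase 3 (spin_flip 1 s) = spin_phase 3 s" "spin_phase 3 (spin_flip (Suc 0) s) = spin_phase 3 s" for s
    using spin_phase_adjacent[of 1 s] spin_phase_adjacent[of 2 s] spin_phase_far[of 1 3 s] spin_phase_far[of 3 1 s]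
    by (simp_all add: numeral_2_eq_2 numeral_3_eq_3)
  have fl: "spin_flip 3 (spin_flip 1 s) = spin_flip 1 (spin_flip 3 s)" for s
    by (rule spin_flip_commute)
  \<comment> \<open>\<kappa> is the phase of \<open>J_1 J_3 J_2\<close>, and \<open>t\<close> is
    \<open>1 + J_1 J_3 J_2\<close>, the conjugate of \<open>1 + J_2\<close>. The product has square
    -1 and commutes with \<open>J_2\<close>, because \<open>J_2\<close> anticommutes with both
    \<open>J_1\<close> and \<open>J_3\<close>.\<close>
  define \<kappa> where "\<kappa> s = spin_phase 1 s * spin_phase 3 s * spin_phase 2 s" for s
  define t :: "spin_vec \<Rightarrow> spin_vec" where "t f = (\<lambda>s. f s + \<kappa> s * f (spin_flip 1 (spin_flip 3 s)))" for f
  have \<kappa>: "\<kappa> (spin_flip 1 (spin_flip 3 s)) = \<kappa> s" "\<kappa> s * \<kappa> s = -1" "\<kappa> s * (\<kappa> s * z) = - z" for s z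
    by (simp_all add: \<kappa>_def algebra_simps)
  have ff: "spin_flip 1 (spin_flip 3 (spin_flip 1 (spin_flip 3 s))) = s" for s
    using spin_flip_commute[of 1 3] by simp
  have bt: "bij t"
  proof (rule bij_betw_byWitness[where f' = "\<lambda>f s. (f s - \<kappa> s * f (spin_flip 1 (spin_flip 3 s))) / 2"])
    show "\<forall>f \<in> UNIV. (\<lambda>s. (t f s - \<kappa> s * t f (spin_flip 1 (spin_flip 3 s))) / 2) = f"
      by (auto simp: t_def fun_eq_iff \<kappa> ff algebra_simps simp del: One_nat_def)
    show "\<forall>f \<in> UNIV. t (\<lambda>s. (f s - \<kappa> s * f (spin_flip 1 (spin_flip 3 s))) / 2) = f"
      by (auto simp: t_def fun_eq_iff \<kappa> ff field_simps simp del: One_nat_def)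
  qed auto
  have "conjg bij_group (spin_twist 2) (spin_twist 1 \<otimes>\<^bsub>bij_group\<^esub> spin_twist 3) = t"
  proof (rule conjg_eqI)
    show "spin_twist 1 \<otimes>\<^bsub>bij_group\<^esub> spin_twist 3 \<otimes>\<^bsub>bij_group\<^esub> t
        = spin_twist 2 \<otimes>\<^bsub>bij_group\<^esub> (spin_twist 1 \<otimes>\<^bsub>bij_group\<^esub> spin_twist 3)"
      by (simp add: fun_eq_iff t_def spin_twist_def \<kappa>_def fl algebra_simps del: One_nat_def)
  qed (simp_all add: bt bij_spin_twist bij_comp)
  moreover have "spin_twist 2 \<circ> t = t \<circ> spin_twist 2"
    by (simp add: fun_eq_iff t_def spin_twist_def \<kappa>_def algebra_simps del: One_nat_def)
  ultimately show ?thesis by (simp add: transversal_images_def)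
qed

lemma (in group) commutator_eqI:
  assumes "x \<in> carrier G" "y \<in> carrier G" "t \<in> carrier G" "x \<otimes> y = t \<otimes> (y \<otimes> x)"
  shows "commutator G x y = t"
proof -
  have "commutator G x y = (x \<otimes> y) \<otimes> (inv x \<otimes> inv y)"
    using assms(1,2) by (simp add: commutator_def m_assoc)
  also have "\<dots> = t" unfolding assms(4) using assms(1-3) by (simp add: m_assoc)
  finally show ?thesis .
qed

definition spin_neg :: "spin_vec \<Rightarrow> spin_vec" where
  "spin_neg f = (\<lambda>s. - f s)"

lemma spin_neg_facts: "bij spin_neg" "spin_neg \<circ> spin_neg = id" "spin_neg \<noteq> id"
proof -
  show 1: "spin_neg \<circ> spin_neg = id" by (auto simp: spin_neg_def fun_eq_iff)
  then show "bij spin_neg" using o_bij by blast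
  have "spin_neg (\<lambda>_. 1) \<noteq> id (\<lambda>_. 1)" by (simp add: spin_neg_def fun_eq_iff)
  then show "spin_neg \<noteq> id" by metis
qed

text \<open>Since \<open>(1 + J)^2 = 2 J\<close>, the squares of \<open>x 1\<close> and
  \<open>x 2\<close> become multiples of the anticommuting \<open>J_1\<close> and
  \<open>J_2\<close>, and \<open>c\<close> becomes -1. Likewise \<open>u\<close> goes to
  \<open>(1 + J_1)^-1 (1 - J_1) = - J_1\<close>, whose square is -1.\<close>

lemma spin_representation:
  assumes n: "5 \<le> n"
  obtains h :: "nat word set set \<Rightarrow> spin_vec \<Rightarrow> spin_vec" where
    "h \<in> hom (Bt n) bij_group" "h (c_elt n) = spin_neg" "h (u_elt n) \<circ> h (u_elt n) = spin_neg"
proof -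
  have n4: "4 \<le> n" using n by simp
  interpret K: group "bij_group :: (spin_vec \<Rightarrow> spin_vec) monoid" by (rule group_bij_group)
  interpret tilde_braid "Bt n" n "Bt_gen n" by (rule tilde_braid_Bt[OF n])
  define h where "h = induced_map (induced_map (eval_word bij_group spin_twist))"
  have h: "h \<in> hom (Bt n) bij_group" "\<And>i. i \<in> {1..<n} \<Longrightarrow> h (Bt_gen n i) = spin_twist i"
    unfolding h_def using Bt_hom[OF n4 group_bij_group braid_images_spin transversal_images_spin] by auto
  interpret h: group_hom "Bt n" bij_group h
    by (simp add: group_hom_def group_hom_axioms_def h(1) K.group_axioms is_group)
  let ?x = "Bt_gen n"
  have [simp]: "?x 1 \<in> carrier (Bt n)" "?x (Suc 0) \<in> carrier (Bt n)" "?x 2 \<in> carrier (Bt n)"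
    using n by auto
  have val: "h (?x 1) = spin_twist 1" "h (?x 2) = spin_twist 2" using h(2) n by auto
  have [simp]: "spin_flip 2 s = s" for s by (simp add: spin_flip_def)
  have [simp]: "spin_phase 2 (spin_flip 1 s) = - spin_phase 2 s" for s
    using spin_phase_adjacent[of 1 s] by (simp add: numeral_2_eq_2)
  have hc: "h (c_elt n) = commutator bij_group (spin_twist 1 \<circ> spin_twist 1) (spin_twist 2 \<circ> spin_twist 2)"
    unfolding c_elt_eq[OF n] c_def by (simp add: h.hom_commutator val del: One_nat_def)
  have hneg: "h (c_elt n) = spin_neg"
    unfolding hc
    by (rule K.commutator_eqI)
      (simp_all add: bij_comp bij_spin_twist spin_neg_facts fun_eq_iff spin_neg_def spin_twist_def
        algebra_simps del: One_nat_def)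
  \<comment> \<open>This is \<open>- J_1\<close>, the expected image of \<open>u\<close>.\<close>
  define t :: "spin_vec \<Rightarrow> spin_vec" where "t f = (\<lambda>s. - (spin_phase 1 s * f (spin_flip 1 s)))" for f
  have tt: "t \<circ> t = spin_neg"
    by (simp add: t_def spin_neg_def fun_eq_iff del: One_nat_def)
  have bt: "bij t"
  proof (rule o_bij)
    show "spin_neg \<circ> t \<circ> t = id" "t \<circ> (spin_neg \<circ> t) = id"
      using tt spin_neg_facts(2)
      by (simp_all add: comp_assoc) (simp add: t_def spin_neg_def fun_eq_iff del: One_nat_def)
  qed
  have "h (u_elt n) = commutator bij_group (inv\<^bsub>bij_group\<^esub> (spin_twist 1)) (spin_twist 2 \<circ> spin_twist 2)"
    unfolding u_elt_eq[OF n] using u_right[of 1] n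
    by (simp add: h.hom_commutator val numeral_2_eq_2[symmetric] del: One_nat_def u.simps)
  also have "\<dots> = t"
  proof (rule K.commutator_eqI)
    let ?a = "spin_twist 1"
    define b where "b = spin_twist 2 \<circ> spin_twist 2"
    have A: "b \<circ> ?a = ?a \<circ> t \<circ> b"
      by (simp add: b_def fun_eq_iff t_def spin_twist_def algebra_simps del: One_nat_def)
    have m: "?a \<in> carrier bij_group" "b \<in> carrier bij_group" "t \<in> carrier bij_group"
      by (simp_all add: b_def bij_comp bij_spin_twist bt del: One_nat_def)
    have "inv\<^bsub>bij_group\<^esub> ?a \<otimes>\<^bsub>bij_group\<^esub> b
        = inv\<^bsub>bij_group\<^esub> ?a \<otimes>\<^bsub>bij_group\<^esub> (b \<otimes>\<^bsub>bij_group\<^esub> ?a) \<otimes>\<^bsub>bij_group\<^esub> inv\<^bsub>bij_group\<^esub> ?a"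
      using m by (simp add: K.m_assoc del: bij_group_simps)
    also have "b \<otimes>\<^bsub>bij_group\<^esub> ?a = ?a \<otimes>\<^bsub>bij_group\<^esub> t \<otimes>\<^bsub>bij_group\<^esub> b" using A by simp
    finally have "inv\<^bsub>bij_group\<^esub> ?a \<otimes>\<^bsub>bij_group\<^esub> b = t \<otimes>\<^bsub>bij_group\<^esub> (b \<otimes>\<^bsub>bij_group\<^esub> inv\<^bsub>bij_group\<^esub> ?a)"
      using m by (simp add: K.m_assoc del: bij_group_simps)
    then show "inv\<^bsub>bij_group\<^esub> ?a \<otimes>\<^bsub>bij_group\<^esub> (spin_twist 2 \<circ> spin_twist 2)
        = t \<otimes>\<^bsub>bij_group\<^esub> ((spin_twist 2 \<circ> spin_twist 2) \<otimes>\<^bsub>bij_group\<^esub> inv\<^bsub>bij_group\<^esub> ?a)"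
      unfolding b_def .
    show "inv\<^bsub>bij_group\<^esub> ?a \<in> carrier bij_group" "spin_twist 2 \<circ> spin_twist 2 \<in> carrier bij_group"
      "t \<in> carrier bij_group"
      using m[unfolded b_def] K.inv_closed by blast+
  qed
  finally have "h (u_elt n) \<circ> h (u_elt n) = spin_neg" using tt by simp
  with hneg show ?thesis using that h(1) by blast
qed

text \<open>The wreath product \<open>\<int> \<wr> S\<^sub>n\<close>; the vector is indexed by the source of the permutation,
  so that \<open>(v, p)\<close> acts on \<open>\<nat> \<times> \<int>\<close> by \<open>(i, m) \<mapsto> (p i, m + v i)\<close>.\<close>

definition wreath :: "nat \<Rightarrow> ((nat \<Rightarrow> int) \<times> (nat \<Rightarrow> nat)) monoid" where
  "wreath n = \<lparr>carrier = UNIV \<times> {p. p permutes {1..n}},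
     monoid.mult = (\<lambda>(v, p) (w, r). (\<lambda>i. v (r i) + w i, p \<circ> r)), one = (\<lambda>_. 0, id)\<rparr>"

lemma wreath_simps [simp]:
  "z \<in> carrier (wreath n) \<longleftrightarrow> snd z permutes {1..n}"
  "(v, p) \<otimes>\<^bsub>wreath n\<^esub> (w, r) = (\<lambda>i. v (r i) + w i, p \<circ> r)"
  "\<one>\<^bsub>wreath n\<^esub> = (\<lambda>_. 0, id)"
  by (auto simp: wreath_def mem_Times_iff)

lemma group_wreath: "group (wreath n)"
proof (rule groupI)
  fix x assume x: "x \<in> carrier (wreath n)"
  obtain v p where vp: "x = (v, p)" by (cases x)
  then have p: "p permutes {1..n}" using x by simp
  have "(\<lambda>i. - v (inv' p i), inv' p) \<otimes>\<^bsub>wreath n\<^esub> x = \<one>\<^bsub>wreath n\<^esub>"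
    using p by (simp add: vp fun_eq_iff permutes_inverses)
  then show "\<exists>y \<in> carrier (wreath n). y \<otimes>\<^bsub>wreath n\<^esub> x = \<one>\<^bsub>wreath n\<^esub>"
    using p by (intro bexI[of _ "(\<lambda>i. - v (inv' p i), inv' p)"]) (auto simp: permutes_inv)
qed (auto simp: permutes_compose permutes_id fun_eq_iff)

lemma wreath_conjg:
  assumes "r permutes {1..n}"
  shows "conjg (wreath n) (v, id) (w, r) = (\<lambda>i. v (r i), id)"
proof -
  interpret group "wreath n" by (rule group_wreath)
  show ?thesis using assms by (intro conjg_eqI) (auto simp: permutes_id fun_eq_iff)
qed

lemma wreath_inv_pure: "inv\<^bsub>wreath n\<^esub> (v, id) = (\<lambda>i. - v i, id)"
proof -
  interpret group "wreath n" by (rule group_wreath)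
  show ?thesis by (intro inv_equality) (auto simp: permutes_id fun_eq_iff)
qed

text \<open>The single 1 on one of the two exchanged strands makes the square equal to
  \<open>e_i + e_(i+1)\<close>; with the bare transposition the squares, and with them the lattice,
  would disappear.\<close>

definition wreath_twist :: "nat \<Rightarrow> (nat \<Rightarrow> int) \<times> (nat \<Rightarrow> nat)" where
  "wreath_twist i = (\<lambda>j. if j = i + 1 then 1 else 0, transpose i (i + 1))"

lemma transpose_permutes: "1 \<le> i \<Longrightarrow> i < n \<Longrightarrow> transpose i (Suc i) permutes {Suc 0..n}"
  by (rule permutes_swap_id) auto

lemma braid_images_wreath: "braid_images (wreath n) n wreath_twist"
  unfolding braid_images_def
proof (intro conjI)
  show "wreath_twist \<in> {1..<n} \<rightarrow> carrier (wreath n)"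
    by (auto simp: wreath_twist_def transpose_permutes)
qed (auto simp: wreath_twist_def fun_eq_iff transpose_def)

lemma transversal_images_wreath:
  assumes "4 \<le> n"
  shows "transversal_images (wreath n) wreath_twist"
proof -
  interpret group "wreath n" by (rule group_wreath)
  \<comment> \<open>Found by solving the conjugation equation. Its vector and its permutation live
    on 1 and 4, so it commutes with the twist on 2 and 3.\<close>
  define t :: "(nat \<Rightarrow> int) \<times> (nat \<Rightarrow> nat)" where
    "t = (\<lambda>j. if j = 4 then 2 else if j = 1 then - 1 else 0, transpose 1 4)"
  have w: "wreath_twist i \<in> carrier (wreath n)" if "1 \<le> i" "i < n" for i
    using that by (simp add: wreath_twist_def transpose_permutes)
  have "t \<in> carrier (wreath n)"
    using assms by (auto simp: t_def intro!: permutes_swap_id)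
  moreover have "wreath_twist 1 \<otimes>\<^bsub>wreath n\<^esub> wreath_twist 3 \<otimes>\<^bsub>wreath n\<^esub> t
      = wreath_twist 2 \<otimes>\<^bsub>wreath n\<^esub> (wreath_twist 1 \<otimes>\<^bsub>wreath n\<^esub> wreath_twist 3)"
    by (simp add: wreath_twist_def t_def fun_eq_iff transpose_def)
  ultimately have "conjg (wreath n) (wreath_twist 2) (wreath_twist 1 \<otimes>\<^bsub>wreath n\<^esub> wreath_twist 3) = t"
    using w[of 1] w[of 2] w[of 3] assms by (intro conjg_eqI m_closed) auto
  then show ?thesis
    unfolding transversal_images_def by (simp add: wreath_twist_def t_def fun_eq_iff transpose_def)
qed

text \<open>Elements with trivial permutation multiply by adding vectors, so the commutator
  \<open>c\<close> of two squares dies. \<open>u 1\<close> becomes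
  \<open>(e_1 + e_3) - (e_2 + e_3)\<close>, and the later \<open>u i\<close> arise by permuting
  coordinates.\<close>

lemma wreath_representation:
  assumes n: "5 \<le> n"
  obtains h where "h \<in> hom (Bt n) (wreath n)"
    "h (tilde_braid.c (Bt n) (Bt_gen n)) = (\<lambda>_. 0, id)"
    "\<And>i. i \<in> {1..<n} \<Longrightarrow> h (tilde_braid.u (Bt n) (Bt_gen n) i)
      = (\<lambda>k. (if k = i then 1 else 0) - (if k = i + 1 then 1 else 0), id)"
proof -
  have n4: "4 \<le> n" using n by simp
  interpret K: group "wreath n" by (rule group_wreath)
  interpret tilde_braid "Bt n" n "Bt_gen n" by (rule tilde_braid_Bt[OF n])
  let ?x = "Bt_gen n"
  define h where "h = induced_map (induced_map (eval_word (wreath n) wreath_twist))"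
  have h: "h \<in> hom (Bt n) (wreath n)" "\<And>i. i \<in> {1..<n} \<Longrightarrow> h (?x i) = wreath_twist i"
    unfolding h_def using Bt_hom[OF n4 group_wreath braid_images_wreath transversal_images_wreath[OF n4]] by auto
  interpret h: group_hom "Bt n" "wreath n" h
    by (simp add: group_hom_def group_hom_axioms_def h(1) K.group_axioms is_group)
  have [simp]: "?x 1 \<in> carrier (Bt n)" "?x (Suc 0) \<in> carrier (Bt n)" "?x 2 \<in> carrier (Bt n)"
    using n by auto
  have sq: "h (?x i \<otimes>\<^bsub>Bt n\<^esub> ?x i) = (\<lambda>k. (if k = i then 1 else 0) + (if k = i + 1 then 1 else 0), id)"
    if "i \<in> {1..<n}" for i
    using that h(2)[OF that] by (simp add: wreath_twist_def fun_eq_iff transpose_def)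
  have hc: "h c = (\<lambda>_. 0, id)"
  proof -
    have "h c = commutator (wreath n) (h (?x 1 \<otimes>\<^bsub>Bt n\<^esub> ?x 1)) (h (?x 2 \<otimes>\<^bsub>Bt n\<^esub> ?x 2))"
      unfolding c_def by (rule h.hom_commutator) simp_all
    also have "\<dots> = (\<lambda>_. 0, id)"
      using sq[of 1] sq[of 2] n
      by (simp add: commutator_def wreath_inv_pure fun_eq_iff del: h.hom_mult)
    finally show ?thesis .
  qed
  have hu: "h (u i) = (\<lambda>k. (if k = i then 1 else 0) - (if k = i + 1 then 1 else 0), id)"
    if "1 \<le> i" "i < n" for i
    using that
  proof (induction i rule: nat_induct_at_least)
    case base
    have "u 1 = conjg (Bt n) (?x 2 \<otimes>\<^bsub>Bt n\<^esub> ?x 2) (?x 1) \<otimes>\<^bsub>Bt n\<^esub> inv\<^bsub>Bt n\<^esub> (?x 2 \<otimes>\<^bsub>Bt n\<^esub> ?x 2)"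
      using u_right[of 1] n by (simp add: commutator_def conjg_def m_assoc numeral_2_eq_2)
    then have "h (u 1) = conjg (wreath n) (h (?x 2 \<otimes>\<^bsub>Bt n\<^esub> ?x 2)) (h (?x 1))
        \<otimes>\<^bsub>wreath n\<^esub> inv\<^bsub>wreath n\<^esub> (h (?x 2 \<otimes>\<^bsub>Bt n\<^esub> ?x 2))"
      by (simp add: h.hom_conjg del: u.simps)
    also have "h (?x 1) = (\<lambda>j. if j = 2 then 1 else 0, transpose 1 2)"
      using h(2)[of 1] n by (simp add: wreath_twist_def numeral_2_eq_2)
    also have "h (?x 2 \<otimes>\<^bsub>Bt n\<^esub> ?x 2) = (\<lambda>k. (if k = 2 then 1 else 0) + (if k = 3 then 1 else 0), id)"
      using sq[of 2] n by simp
    also have "conjg (wreath n) (\<lambda>k. (if k = 2 then 1 else 0) + (if k = 3 then 1 else 0), id)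
        (\<lambda>j. if j = 2 then 1 else 0, transpose 1 2)
        = (\<lambda>k. (if transpose 1 2 k = 2 then 1 else 0) + (if transpose 1 2 k = 3 then 1 else 0), id)"
      by (rule wreath_conjg) (use n in \<open>auto intro!: permutes_swap_id\<close>)
    finally have "h (u 1) = (\<lambda>k. (if k = 1 then 1 else 0) - (if k = 2 then 1 else 0), id)"
      unfolding wreath_inv_pure by (simp add: fun_eq_iff transpose_def del: u.simps)
    then show ?case by (simp add: numeral_2_eq_2 id_def del: u.simps)
  next
    case (Suc i)
    have "h (?x (i + 1) \<otimes>\<^bsub>Bt n\<^esub> ?x i) = wreath_twist (i + 1) \<otimes>\<^bsub>wreath n\<^esub> wreath_twist i"
      using h(2)[of i] h(2)[of "i + 1"] Suc by simp
    \<comment> \<open>The vector \<open>w\<close> is left unspecified: conjugating an element with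
      trivial permutation depends only on the permutation of the conjugator.\<close>
    then obtain w where w: "h (?x (i + 1) \<otimes>\<^bsub>Bt n\<^esub> ?x i) = (w, transpose (i + 1) (i + 2) \<circ> transpose i (i + 1))"
      by (auto simp: wreath_twist_def)
    have r: "transpose (i + 1) (i + 2) \<circ> transpose i (i + 1) permutes {1..n}"
      using Suc transpose_permutes[of i n] transpose_permutes[of "i + 1" n] by (simp add: permutes_compose)
    have "h (u (i + 1)) = conjg (wreath n) (h (u i)) (h (?x (i + 1) \<otimes>\<^bsub>Bt n\<^esub> ?x i))"
      using u_step[of i] Suc by (simp add: h.hom_conjg del: h.hom_mult u.simps)
    also have "h (u i) = (\<lambda>k. (if k = i then 1 else 0) - (if k = i + 1 then 1 else 0), id)"
      using Suc by (simp add: id_def)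
    finally have "h (u (i + 1)) = (\<lambda>k. (if k = i + 1 then 1 else 0) - (if k = i + 2 then 1 else 0), id)"
      unfolding w wreath_conjg[OF r] by (simp add: fun_eq_iff transpose_def del: u.simps)
    then show ?case by (simp add: id_def del: u.simps)
  qed
  show ?thesis by (rule that[of h]) (use h(1) hc hu in auto)
qed

section \<open>The semidirect product as a fibre product\<close>


context tilde_braid_maps
begin

definition S where "S = semidirect_product (G\<lparr>carrier := P0\<rparr>) G (conjg G)"

text \<open>With \<open>(g, \<beta>)\<close> standing for \<open>g \<beta>\<close>, both \<open>proj\<close> and \<open>snd\<close> are homomorphisms to \<open>G\<close>, and together
  they embed \<open>S\<close> in \<open>G \<times> G\<close>.\<close>

definition proj where "proj = (\<lambda>(g, \<beta>). g \<otimes> \<beta>)"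

lemma carrier_S: "carrier S = P0 \<times> carrier G"
  by (simp add: S_def semidirect_product_def)

lemma S_simps [simp]:
  "(g, \<beta>) \<in> carrier S \<longleftrightarrow> g \<in> P0 \<and> \<beta> \<in> carrier G"
  "\<one>\<^bsub>S\<^esub> = (\<one>, \<one>)"
  "(g, \<beta>) \<otimes>\<^bsub>S\<^esub> (h, \<gamma>) = (g \<otimes> conjg G h (inv \<beta>), \<beta> \<otimes> \<gamma>)"
  "proj (g, \<beta>) = g \<otimes> \<beta>"
  by (simp_all add: S_def semidirect_product_def proj_def)

lemma group_S: "group S"
proof (rule groupI)
  fix s assume s: "s \<in> carrier S"
  obtain g \<beta> where gb: "s = (g, \<beta>)" "g \<in> P0" "\<beta> \<in> carrier G" using s by (auto simp: carrier_S)
  show "\<one>\<^bsub>S\<^esub> \<otimes>\<^bsub>S\<^esub> s = s" using gb by simp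
  show "\<exists>t \<in> carrier S. t \<otimes>\<^bsub>S\<^esub> s = \<one>\<^bsub>S\<^esub>"
  proof (rule bexI)
    show "(conjg G (inv g) \<beta>, inv \<beta>) \<otimes>\<^bsub>S\<^esub> s = \<one>\<^bsub>S\<^esub>"
      using gb by (simp add: conjg_inv)
    show "(conjg G (inv g) \<beta>, inv \<beta>) \<in> carrier S" using gb by (simp add: P0.conjg_mem)
  qed
  fix t assume "t \<in> carrier S"
  then obtain h \<gamma> where hc: "t = (h, \<gamma>)" "h \<in> P0" "\<gamma> \<in> carrier G"
    by (auto simp: carrier_S)
  show "s \<otimes>\<^bsub>S\<^esub> t \<in> carrier S" using gb hc by (simp add: P0.conjg_mem)
  fix r assume "r \<in> carrier S"
  then obtain k \<rho> where kr: "r = (k, \<rho>)" "k \<in> P0" "\<rho> \<in> carrier G"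
    by (auto simp: carrier_S)
  have "k \<in> carrier G" "h \<in> carrier G" "g \<in> carrier G" using gb hc kr by auto
  then show "s \<otimes>\<^bsub>S\<^esub> t \<otimes>\<^bsub>S\<^esub> r = s \<otimes>\<^bsub>S\<^esub> (t \<otimes>\<^bsub>S\<^esub> r)"
    using gb hc kr by (simp add: m_assoc conjg_mult conjg_conjg inv_mult_group)
qed simp

sublocale S: group S by (rule group_S)

lemma proj_hom: "proj \<in> hom S G"
proof (rule homI)
  fix s t assume "s \<in> carrier S" "t \<in> carrier S"
  then obtain g \<beta> h \<gamma> where "s = (g, \<beta>)" "g \<in> P0" "\<beta> \<in> carrier G" "t = (h, \<gamma>)" "h \<in> P0" "\<gamma> \<in> carrier G"
    by (auto simp: carrier_S)
  moreover then have "g \<in> carrier G" "h \<in> carrier G" by auto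
  ultimately show "proj (s \<otimes>\<^bsub>S\<^esub> t) = proj s \<otimes> proj t" "proj s \<in> carrier G"
    by (simp_all add: conjg_def m_assoc)
qed

lemma snd_hom: "snd \<in> hom S G"
  by (rule homI) (auto simp: carrier_S)

sublocale proj: group_hom S G proj
  by (simp add: group_hom_def group_hom_axioms_def proj_hom is_group group_S)

sublocale snd: group_hom S G snd
  by (simp add: group_hom_def group_hom_axioms_def snd_hom is_group group_S)

lemma S_eqI:
  assumes "s \<in> carrier S" "t \<in> carrier S" "proj s = proj t" "snd s = snd t"
  shows "s = t"
proof -
  obtain g \<beta> h \<gamma> where "s = (g, \<beta>)" "g \<in> P0" "\<beta> \<in> carrier G" "t = (h, \<gamma>)" "h \<in> P0" "\<gamma> \<in> carrier G"
    using assms(1,2) by (auto simp: carrier_S)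
  then show ?thesis using assms(3,4) P0.mem_carrier[of g] P0.mem_carrier[of h] by simp
qed

lemma proj_P0_iff: "s \<in> carrier S \<Longrightarrow> proj s \<in> P0 \<longleftrightarrow> snd s \<in> P0"
proof -
  assume "s \<in> carrier S"
  then obtain g \<beta> where s: "s = (g, \<beta>)" "g \<in> P0" "\<beta> \<in> carrier G"
    by (auto simp: carrier_S)
  then have g: "g \<in> carrier G" by simp
  show ?thesis
  proof
    assume "proj s \<in> P0"
    then have "inv g \<otimes> (g \<otimes> \<beta>) \<in> P0" using s by (intro P0.m_closed[OF P0.m_inv_closed]) simp_all
    then show "snd s \<in> P0" using s g by simp
  qed (use s in simp)
qed

lemma proj_P: "s \<in> carrier S \<Longrightarrow> snd s \<in> P \<Longrightarrow> proj s \<in> P"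
  using P0_subset_P by (cases s) auto

text \<open>\<open>W\<close> and \<open>W1\<close> lie over \<open>H0\<close> and \<open>H\<close>:
  their images in the quotient are identified in \<open>H0_eq\<close> and
  \<open>H_eq\<close>.\<close>

definition W where "W = P0 \<times> P0"
definition W1 where "W1 = P0 \<times> P"

lemma W_subset: "W \<subseteq> W1" "W1 \<subseteq> carrier S"
  using P0_subset_P P.subset by (auto simp: W_def W1_def carrier_S)

lemma subgroup_vimage:
  assumes "group_hom A B f" "subgroup H B"
  shows "subgroup {x \<in> carrier A. f x \<in> H} A"
proof -
  interpret group_hom A B f by fact
  interpret H: subgroup H B by fact
  show ?thesis by (rule G.subgroupI) (auto intro!: exI[of _ "\<one>\<^bsub>A\<^esub>"])
qed

lemma normal_vimage:
  assumes "group_hom A B f" "H \<lhd> B"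
  shows "{x \<in> carrier A. f x \<in> H} \<lhd> A"
proof -
  interpret group_hom A B f by fact
  interpret H: normal H B by fact
  show ?thesis
    by (rule G.normalI_conjg)
      (auto simp: hom_conjg H.conjg_mem intro: subgroup_vimage assms(1) H.subgroup_axioms)
qed

lemma W_eq: "W = {s \<in> carrier S. snd s \<in> P0}" and W1_eq: "W1 = {s \<in> carrier S. snd s \<in> P}"
  by (auto simp: W_def W1_def carrier_S)

lemma W_normal: "W \<lhd> S" and W1_normal: "W1 \<lhd> S"
  unfolding W_eq W1_eq
  using normal_vimage[OF snd.group_hom_axioms P0_normal] normal_vimage[OF snd.group_hom_axioms P_normal]
  by simp_all

text \<open>Under \<open>snd\<close> and under \<open>proj\<close> the commutator becomes one of two
  pure elements, hence 1 or \<open>c\<close> by \<open>commutator_P\<close>; the first component is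
  recovered as the quotient of the two values.\<close>

lemma commutator_W1:
  assumes "s \<in> W1" "t \<in> W1"
  shows "commutator S s t \<in> {\<one>, c} \<times> {\<one>, c}"
proof -
  have st: "s \<in> carrier S" "t \<in> carrier S" using assms W_subset by auto
  have P: "snd s \<in> P" "snd t \<in> P" using assms by (auto simp: W1_def)
  obtain g \<beta> where gb: "commutator S s t = (g, \<beta>)" "g \<in> P0" "\<beta> \<in> carrier G"
    using S.commutator_closed[OF st] by (auto simp: carrier_S)
  have "\<beta> = commutator G (snd s) (snd t)" "g \<otimes> \<beta> = commutator G (proj s) (proj t)"
    using gb snd.hom_commutator[OF st] proj.hom_commutator[OF st] by simp_all
  then have \<beta>: "\<beta> \<in> {\<one>, c}" and gb': "g \<otimes> \<beta> \<in> {\<one>, c}"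
    using commutator_P P proj_P st by simp_all
  have "g \<in> carrier G" using gb by simp
  then have "g = g \<otimes> \<beta> \<otimes> \<beta>" using \<beta> by (auto simp: m_assoc c_involution)
  then have "g \<in> {\<one>, c}" using \<beta> gb' c_involution by auto
  then show ?thesis unfolding gb(1) using \<beta> by blast
qed

lemma S_conjg_right:
  "g \<in> P0 \<Longrightarrow> y \<in> carrier G \<Longrightarrow> conjg S (g, \<one>) (\<one>, y) = (conjg G g y, \<one>)"
  "\<beta> \<in> carrier G \<Longrightarrow> y \<in> carrier G \<Longrightarrow> conjg S (\<one>, \<beta>) (\<one>, y) = (\<one>, conjg G \<beta> y)"
  using P0.mem_carrier[of g]
  by (auto intro!: S_eqI simp: proj.hom_conjg snd.hom_conjg P0.conjg_mem simp del: P0.mem_carrier)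

lemma S_mult_special:
  "g \<in> P0 \<Longrightarrow> h \<in> P0 \<Longrightarrow> (g, \<one>) \<otimes>\<^bsub>S\<^esub> (h, \<one>) = (g \<otimes> h, \<one>)"
  "\<beta> \<in> carrier G \<Longrightarrow> \<gamma> \<in> carrier G \<Longrightarrow> (\<one>, \<beta>) \<otimes>\<^bsub>S\<^esub> (\<one>, \<gamma>) = (\<one>, \<beta> \<otimes> \<gamma>)"
  "g \<in> P0 \<Longrightarrow> \<beta> \<in> carrier G \<Longrightarrow> (g, \<one>) \<otimes>\<^bsub>S\<^esub> (\<one>, \<beta>) = (g, \<beta>)"
  by simp_all

lemma left_hom: "(\<lambda>g. (g, \<one>)) \<in> hom (G\<lparr>carrier := P0\<rparr>) S"
  by (rule homI) simp_all

lemma right_hom: "(\<lambda>\<beta>. (\<one>, \<beta>)) \<in> hom G S"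
  by (rule homI) simp_all

text \<open>For either factor, the elements whose copy is a product of commutators form a normal
  subgroup of \<open>G\<close>, so by \<open>P0_minimal\<close> it suffices to reach
  \<open>u 1\<close>. In the right factor it is itself a commutator. In the left factor no
  \<open>x i\<close> is available, so commutators with the right factor are used.\<close>

lemma W_derived: "W \<subseteq> derived S (carrier S)"
proof -
  let ?D = "derived S (carrier S)"
  interpret D: normal ?D S by (rule S.derived_self_is_normal)
  have comm: "commutator S s t \<in> ?D" if "s \<in> carrier S" "t \<in> carrier S" for s t
    unfolding derived_def using that by (intro generate.incl) (auto simp: commutator_def simp del: S_simps)
  have uP: "u 1 \<in> P0" "u 2 \<in> P0" "c \<in> P0" using n by (auto intro: u_P0 c_P0)
  have xc: "x 1 \<in> carrier G" "x 2 \<in> carrier G" using n by simp_all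
  interpret right: group_hom G S "\<lambda>\<beta>. (\<one>, \<beta>)"
    by (simp add: group_hom_def group_hom_axioms_def right_hom is_group group_S)
  interpret left: group_hom "G\<lparr>carrier := P0\<rparr>" S "\<lambda>g. (g, \<one>)"
    by (simp add: group_hom_def group_hom_axioms_def left_hom group_S P0.subgroup_is_group[OF is_group])
  note right.hom_mult [simp del] left.hom_mult [simp del]
  define R1 where "R1 = {p \<in> P0. (p, \<one>) \<in> ?D}"
  define R2 where "R2 = {p \<in> carrier G. (\<one>, p) \<in> ?D}"
  have R2: "R2 \<lhd> G" unfolding R2_def
    by (rule normal_vimage[OF right.group_hom_axioms D.normal_axioms])
  have R1: "R1 \<lhd> G"
  proof (rule normalI_conjg)
    have "subgroup R1 (G\<lparr>carrier := P0\<rparr>)"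
      using subgroup_vimage[OF left.group_hom_axioms D.subgroup_axioms] by (simp add: R1_def)
    then show "subgroup R1 G"
      using P0.subgroup_axioms incl_subgroup by blast
    show "conjg G h g \<in> R1" if "h \<in> R1" "g \<in> carrier G" for h g
    proof -
      have "conjg S (h, \<one>) (\<one>, g) \<in> ?D" using that by (intro D.conjg_mem) (auto simp: R1_def)
      then show ?thesis using that by (simp add: R1_def S_conjg_right P0.conjg_mem)
    qed
  qed
  note R1_sub = normal_imp_subgroup[OF R1]
  have "(\<one>, u 1) = commutator S (\<one>, inv (x 1)) (\<one>, x 2 \<otimes> x 2)"
    using right.hom_commutator[of "inv (x 1)" "x 2 \<otimes> x 2"] u_right[of 1] n xc by (simp add: numeral_2_eq_2)
  also have "\<dots> \<in> ?D" using xc by (intro comm) simp_all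
  finally have "u 1 \<in> R2" using n by (simp add: R2_def)
  then have sub2: "P0 \<subseteq> R2" by (rule P0_minimal[OF R2])
  have c1: "(c, \<one>) = commutator S (u 1, \<one>) (u 2, \<one>)"
  proof (rule S_eqI)
    show "proj (c, \<one>) = proj (commutator S (u 1, \<one>) (u 2, \<one>))"
      using uP u_adjacent(5)[of 1] n by (simp add: proj.hom_commutator numeral_2_eq_2)
    show "snd (c, \<one>) = snd (commutator S (u 1, \<one>) (u 2, \<one>))"
      using uP by (simp add: snd.hom_commutator) (simp add: commutator_def)
  qed (use uP in \<open>auto intro!: S.commutator_closed simp del: S_simps(3)\<close>)
  have "(c, \<one>) \<in> ?D" unfolding c1 using uP by (intro comm) simp_all
  then have cR: "c \<in> R1" using c_P0 by (simp add: R1_def)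
  \<comment> \<open>Acting by \<open>inv (x 2)\<close> on the left copy of \<open>inv (u 1)\<close>
    moves it by \<open>c u 2\<close>, so \<open>u 2\<close>, and with it the conjugate
    \<open>u 1\<close>, becomes a commutator modulo \<open>c\<close>.\<close>
  have cu: "(c \<otimes> u 2, \<one>) = commutator S (inv (u 1), \<one>) (\<one>, inv (x 2))"
  proof (rule S_eqI)
    have "commutator G (inv (u 1)) (inv (x 2)) = inv (u 1) \<otimes> conjg G (u 1) (x 2)"
      using n xc by (simp add: commutator_def conjg_def m_assoc)
    also have "conjg G (u 1) (x 2) = c \<otimes> (u 1 \<otimes> u 2)"
      using u_adjacent(1)[of 1] n by (simp add: numeral_2_eq_2)
    also have "inv (u 1) \<otimes> (c \<otimes> (u 1 \<otimes> u 2)) = c \<otimes> (inv (u 1) \<otimes> (u 1 \<otimes> u 2))"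
      using n by (intro c_moves) auto
    also have "\<dots> = c \<otimes> u 2" using n by simp
    finally show "proj (c \<otimes> u 2, \<one>) = proj (commutator S (inv (u 1), \<one>) (\<one>, inv (x 2)))"
      using uP xc by (simp add: proj.hom_commutator)
    show "snd (c \<otimes> u 2, \<one>) = snd (commutator S (inv (u 1), \<one>) (\<one>, inv (x 2)))"
      using uP xc by (simp add: snd.hom_commutator) (simp add: commutator_def)
  qed (use uP xc in \<open>auto intro!: S.commutator_closed simp del: S_simps(3)\<close>)
  have "(c \<otimes> u 2, \<one>) \<in> ?D" unfolding cu using uP xc by (intro comm) simp_all
  then have "c \<otimes> u 2 \<in> R1" using uP by (simp add: R1_def)
  then have "inv c \<otimes> (c \<otimes> u 2) \<in> R1" 
    by (rule subgroup.m_closed[OF R1_sub subgroup.m_inv_closed[OF R1_sub cR]])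
  then have "u 2 \<in> R1" using n by simp
  then have "conjg G (u 2) (inv (x 2 \<otimes> x 1)) \<in> R1" using xc by (intro normal.conjg_mem[OF R1]) auto
  moreover have "u 2 = conjg G (u 1) (x 2 \<otimes> x 1)" using u_step[of 1] by (simp add: numeral_2_eq_2)
  ultimately have "u 1 \<in> R1" using n xc by simp
  then have sub1: "P0 \<subseteq> R1" by (rule P0_minimal[OF R1])
  show ?thesis
  proof
    fix s assume "s \<in> W"
    then obtain g \<beta> where s: "s = (g, \<beta>)" "g \<in> P0" "\<beta> \<in> P0" by (auto simp: W_def)
    then have "(g, \<one>) \<otimes>\<^bsub>S\<^esub> (\<one>, \<beta>) \<in> ?D"
      using sub1 sub2 by (intro D.m_closed) (auto simp: R1_def R2_def)
    then show "s \<in> ?D" using s by simp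
  qed
qed

end

section \<open>The quotient \<open>G(a, b)\<close>\<close>

lemma (in group) conjg_int_pow:
  assumes "p \<in> carrier G" "g \<in> carrier G"
  shows "conjg G (p [^] (k::int)) g = conjg G p g [^] k"
proof -
  have "(\<lambda>p. conjg G p g) \<in> hom G G"
    using assms by (intro homI) (simp_all add: conjg_mult)
  then interpret h: group_hom G G "\<lambda>p. conjg G p g"
    by (simp add: group_hom_def group_hom_axioms_def is_group)
  show ?thesis using h.hom_int_pow assms by simp
qed

locale tilde_braid_quotient = tilde_braid_maps +
  fixes a b :: int
begin

definition B11 where "B11 = (u 1, \<one>)"
definition \<tau> where "\<tau> = (c, \<one>)"
definition U where "U = (\<one>, u 1)"
definition C where "C = (\<one>, c)"

definition n1 where "n1 = B11 [^]\<^bsub>S\<^esub> b \<otimes>\<^bsub>S\<^esub> U [^]\<^bsub>S\<^esub> (2 - b) \<otimes>\<^bsub>S\<^esub> C \<otimes>\<^bsub>S\<^esub> (C \<otimes>\<^bsub>S\<^esub> \<tau>) [^]\<^bsub>S\<^esub> lam (b + 1)"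
definition n2 where "n2 = (C \<otimes>\<^bsub>S\<^esub> \<tau>) [^]\<^bsub>S\<^esub> b"
definition n3 where "n3 = (B11 \<otimes>\<^bsub>S\<^esub> inv\<^bsub>S\<^esub> U) [^]\<^bsub>S\<^esub> (a - b) \<otimes>\<^bsub>S\<^esub> inv\<^bsub>S\<^esub> U \<otimes>\<^bsub>S\<^esub> C
  \<otimes>\<^bsub>S\<^esub> (C \<otimes>\<^bsub>S\<^esub> \<tau>) [^]\<^bsub>S\<^esub> lam (b - a + 1)"
definition n4 where "n4 = (B11 \<otimes>\<^bsub>S\<^esub> inv\<^bsub>S\<^esub> U) [^]\<^bsub>S\<^esub> (a - b) \<otimes>\<^bsub>S\<^esub> inv\<^bsub>S\<^esub> U \<otimes>\<^bsub>S\<^esub> \<tau>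
  \<otimes>\<^bsub>S\<^esub> (C \<otimes>\<^bsub>S\<^esub> \<tau>) [^]\<^bsub>S\<^esub> lam (b - a)"

definition N where "N = normal_closure S {n1, n2, n3, n4}"

lemma u1 [simp]: "u 1 \<in> P0" "u (Suc 0) \<in> P0" "u 2 \<in> P0" "c \<in> P0"
  using n by (auto intro: u_P0 c_P0)

lemma gens_W: "B11 \<in> W" "\<tau> \<in> W" "U \<in> W" "C \<in> W"
  by (simp_all add: B11_def \<tau>_def U_def C_def W_def)

sublocale W: normal W S by (rule W_normal)

lemma gens_S [simp]: "B11 \<in> carrier S" "\<tau> \<in> carrier S" "U \<in> carrier S" "C \<in> carrier S"
  using gens_W by simp_all

lemma W_pow: "s \<in> W \<Longrightarrow> s [^]\<^bsub>S\<^esub> (k::int) \<in> W"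
  by (rule S.subgroup_int_pow_closed[OF W.subgroup_axioms])

lemma N_gens_W: "n1 \<in> W" "n2 \<in> W" "n3 \<in> W" "n4 \<in> W"
  unfolding n1_def n2_def n3_def n4_def
  by (intro W.m_closed W_pow W.m_inv_closed gens_W)+

lemma N_normal: "N \<lhd> S"
  unfolding N_def using N_gens_W W.subset by (intro S.normal_closure_normal) auto

sublocale N: normal N S by (rule N_normal)

lemma N_gens: "n1 \<in> N" "n2 \<in> N" "n3 \<in> N" "n4 \<in> N"
  using S.normal_closure_subset[of "{n1, n2, n3, n4}"] by (auto simp: N_def)

lemma N_W: "N \<subseteq> W"
  unfolding N_def using N_gens_W by (intro S.normal_closure_minimal[OF W_normal]) auto

lemma N_minimal: "R \<lhd> S \<Longrightarrow> n1 \<in> R \<Longrightarrow> n2 \<in> R \<Longrightarrow> n3 \<in> R \<Longrightarrow> n4 \<in> R \<Longrightarrow> N \<subseteq> R"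
  unfolding N_def by (intro S.normal_closure_minimal) auto

lemma proj_gens: "proj B11 = u 1" "proj \<tau> = c" "proj U = u 1" "proj C = c"
  using n by (simp_all add: B11_def \<tau>_def U_def C_def)

lemma snd_gens: "snd B11 = \<one>" "snd \<tau> = \<one>" "snd U = u 1" "snd C = c"
  by (simp_all add: B11_def \<tau>_def U_def C_def)

lemma proj_pow: "s \<in> carrier S \<Longrightarrow> proj (s [^]\<^bsub>S\<^esub> (k::int)) = proj s [^] k"
  by (rule proj.hom_int_pow)

lemma snd_pow: "s \<in> carrier S \<Longrightarrow> snd (s [^]\<^bsub>S\<^esub> (k::int)) = snd s [^] k"
  by (rule snd.hom_int_pow)

lemma proj_n:
  "proj n1 = u 1 [^] b \<otimes> u 1 [^] (2 - b) \<otimes> c" "proj n2 = \<one>"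
  "proj n3 = inv (u 1) \<otimes> c" "proj n4 = inv (u 1) \<otimes> c"
proof -
  have [simp]: "u 1 \<in> carrier G" "u (Suc 0) \<in> carrier G" using n by simp_all
  show "proj n1 = u 1 [^] b \<otimes> u 1 [^] (2 - b) \<otimes> c" "proj n2 = \<one>"
    "proj n3 = inv (u 1) \<otimes> c" "proj n4 = inv (u 1) \<otimes> c"
    unfolding n1_def n2_def n3_def n4_def
    by (simp_all add: proj_pow proj_gens c_involution del: u.simps)
qed

lemma snd_n:
  "snd n1 = u 1 [^] (2 - b) \<otimes> c \<otimes> c [^] lam (b + 1)" "snd n2 = c [^] b"
  "snd n3 = inv (u 1) [^] (a - b) \<otimes> inv (u 1) \<otimes> c \<otimes> c [^] lam (b - a + 1)"
  "snd n4 = inv (u 1) [^] (a - b) \<otimes> inv (u 1) \<otimes> c [^] lam (b - a)"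
proof -
  have [simp]: "u 1 \<in> carrier G" "u (Suc 0) \<in> carrier G" using n by simp_all
  show "snd n1 = u 1 [^] (2 - b) \<otimes> c \<otimes> c [^] lam (b + 1)" "snd n2 = c [^] b"
  "snd n3 = inv (u 1) [^] (a - b) \<otimes> inv (u 1) \<otimes> c \<otimes> c [^] lam (b - a + 1)"
  "snd n4 = inv (u 1) [^] (a - b) \<otimes> inv (u 1) \<otimes> c [^] lam (b - a)"
    unfolding n1_def n2_def n3_def n4_def
    by (simp_all add: snd_pow snd_gens del: u.simps)
qed

lemma c_pow: "c [^] (k::int) = (if even k then \<one> else c)"
proof -
  have even: "c [^] (2 * m) = \<one>" for m :: int
  proof -
    have "c [^] (2::int) = \<one>" using int_pow_mult[of c 1 1] c_involution by simp
    then show ?thesis using int_pow_pow[of c 2 m] by (simp add: int_pow_one)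
  qed
  show ?thesis
  proof (cases "even k")
    case True
    then show ?thesis using even by auto
  next
    case False
    then obtain m where "k = 2 * m + 1" by (elim oddE)
    then show ?thesis using even[of m] False int_pow_mult[of c "2 * m" 1] by simp
  qed
qed

lemma commutator_proj_n3: "commutator G (proj n3) (u 2) = c"
proof -
  have [simp]: "u 1 \<in> carrier G" "u 2 \<in> carrier G" using n by simp_all
  have "commutator G (inv (u 1)) (u 2) = conjg G (inv (commutator G (u 1) (u 2))) (u 1)"
    by (simp add: commutator_def conjg_def m_assoc inv_mult_group)
  also have "commutator G (u 1) (u 2) = c"
    using u_adjacent(5)[of 1] n by (simp add: numeral_2_eq_2)
  finally have k: "commutator G (inv (u 1)) (u 2) = c" by (simp add: conjg_c)
  have "commutator G (inv (u 1) \<otimes> c) (u 2) = commutator G (inv (u 1)) (u 2)"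
    by (rule commutator_mult_left(1)) (simp_all add: c_central)
  then show ?thesis using k by (simp add: proj_n del: One_nat_def)
qed

text \<open>Taking the commutator with \<open>(u 2, \<one>)\<close>, which is trivial under
  \<open>snd\<close>, isolates the \<open>proj\<close> coordinate, where \<open>n3\<close> is
  \<open>u^-1 c\<close>.\<close>

lemma \<tau>_N: "\<tau> \<in> N"
proof -
  have [simp]: "u 2 \<in> carrier G" using n by simp
  have n3: "n3 \<in> carrier S" using N_gens by simp
  have "\<tau> = commutator S n3 (u 2, \<one>)"
  proof (rule S_eqI)
    show "proj \<tau> = proj (commutator S n3 (u 2, \<one>))"
      using n3 commutator_proj_n3 by (simp add: proj.hom_commutator proj_gens)
    show "snd \<tau> = snd (commutator S n3 (u 2, \<one>))"
      using n3 by (simp add: snd.hom_commutator snd_gens) (simp add: commutator_def)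
  qed (use n3 in simp_all)
  then show ?thesis using N_gens(3) by (auto intro: N.commutator_mem)
qed

text \<open>In the coordinates (\<open>proj\<close>, \<open>snd\<close>), \<tau> is
  \<open>(c, 1)\<close> and \<open>C\<close> is \<open>(c, c)\<close>. For odd b, \<open>n2\<close>
  is \<open>(1, c)\<close> and its product with \<tau> is \<open>C\<close>. Otherwise a and b are
  even, so \<open>snd n3\<close> is an odd power of \<open>inv (u 1)\<close> up to \<open>c\<close>,
  and the commutator of \<open>n3\<close> with \<open>(\<one>, u 2)\<close> is \<open>c\<close> in
  both coordinates.\<close>

lemma C_N:
  assumes "\<not> (even b \<and> odd a)"
  shows "C \<in> N"
proof -
  have [simp]: "u 1 \<in> carrier G" "u 2 \<in> carrier G" using n by simp_all
  show ?thesis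
  proof (cases "even b")
    case False
    have "C = n2 \<otimes>\<^bsub>S\<^esub> \<tau>"
      using False N_gens \<tau>_N by (intro S_eqI) (simp_all add: proj_gens snd_gens proj_n snd_n c_pow)
    then show ?thesis using N_gens \<tau>_N by simp
  next
    case True
    then have ab: "odd (a - b + 1)" using assms by auto
    have n3: "n3 \<in> carrier S" using N_gens by simp
    let ?k = "a - b + 1" and ?v = "inv (u 1)"
    have "u 1 \<otimes> u 2 = c \<otimes> (u 2 \<otimes> u 1)"
    proof -
      have "commutator G (u 1) (u 2) \<otimes> (u 2 \<otimes> u 1) = u 1 \<otimes> u 2"
        by (simp add: commutator_def m_assoc)
      then show ?thesis using u_adjacent(5)[of 1] n by (simp add: numeral_2_eq_2)
    qed
    then have "conjg G (u 1) (u 2) = inv (u 2) \<otimes> (c \<otimes> (u 2 \<otimes> u 1))"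
      by (simp add: conjg_def m_assoc)
    also have "\<dots> = c \<otimes> (inv (u 2) \<otimes> (u 2 \<otimes> u 1))" by (rule c_moves) simp_all
    finally have "conjg G (u 1) (u 2) = c \<otimes> u 1" by simp
    then have "conjg G ?v (u 2) = c \<otimes> ?v"
      using c_central[of ?v] by (simp add: conjg_inv inv_mult_group del: One_nat_def)
    then have "conjg G (?v [^] ?k) (u 2) = (c \<otimes> ?v) [^] ?k" by (simp add: conjg_int_pow del: One_nat_def)
    also have "\<dots> = c [^] ?k \<otimes> ?v [^] ?k"
      using c_central[of ?v] by (intro int_pow_mult_distrib) (simp_all del: One_nat_def)
    finally have k: "conjg G (?v [^] ?k) (u 2) = c \<otimes> ?v [^] ?k" using ab by (simp add: c_pow)
    have "?v [^] (a - b) \<otimes> ?v = ?v [^] ?k" using int_pow_mult[of ?v "a - b" 1] by (simp del: One_nat_def)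
    then have sn: "snd n3 = ?v [^] ?k \<otimes> c [^] (1 + lam (b - a + 1))"
      unfolding snd_n using int_pow_mult[of c 1 "lam (b - a + 1)"] by (simp add: m_assoc del: One_nat_def)
    define e where "e = c [^] (1 + lam (b - a + 1))"
    have e: "e \<in> {\<one>, c}" by (simp add: e_def c_pow)
    have "conjg G (snd n3) (u 2) = c \<otimes> snd n3"
      unfolding sn e_def[symmetric] using k e
      by (auto simp: conjg_mult conjg_c m_assoc simp del: One_nat_def)
    then have "snd n3 \<otimes> u 2 = u 2 \<otimes> (c \<otimes> snd n3)"
      by (metis N_gens(3) N.mem_carrier \<open>u 2 \<in> carrier G\<close> conjg_def inv_cancel_left(2) inv_closed m_assoc m_closed snd.hom_closed)
    also have "\<dots> = c \<otimes> (u 2 \<otimes> snd n3)" using n3 by (intro c_moves) auto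
    finally have "commutator G (snd n3) (u 2) = c"
      using n3 by (intro commutator_eqI) auto
    then have "C = commutator S n3 (\<one>, u 2)"
      using n3 commutator_proj_n3
      by (intro S_eqI) (simp_all add: proj.hom_commutator snd.hom_commutator proj_gens snd_gens)
    then show ?thesis using N_gens(3) by (auto intro: N.commutator_mem)
  qed
qed

text \<open>As \<tau> is already in \<open>N\<close>, only the \<open>snd\<close> coordinate can
  detect \<open>C\<close>. For b even and a odd every relator is there an even power of
  \<open>u 1\<close> times a power of \<open>c\<close>, and \<open>h\<close> sends it to a
  sign.\<close>

lemma C_not_N:
  assumes ab: "even b" "odd a"
    and h: "h \<in> hom G (bij_group :: (spin_vec \<Rightarrow> spin_vec) monoid)"
      "h c = spin_neg" "h (u 1) \<circ> h (u 1) = spin_neg"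
  shows "C \<notin> N"
proof
  interpret K: group "bij_group :: (spin_vec \<Rightarrow> spin_vec) monoid" by (rule group_bij_group)
  interpret h: group_hom G bij_group h
    by (simp add: group_hom_def group_hom_axioms_def h(1) K.group_axioms is_group)
  have [simp]: "u 1 \<in> carrier G" using n by simp
  \<comment> \<open>Each \<open>u^2\<close> contributes -1, and so does each \<open>c\<close>; the
    sign is the parity of \<open>m + k\<close>.\<close>
  have pow: "h (u 1 [^] (2 * m) \<otimes> c [^] k) = id" if "even (m + k)" for m k :: int
  proof -
    have "h (u 1 [^] (2::int)) = h c"
      using int_pow_mult[of "u 1" 1 1] h(2,3) by simp
    then have "h (u 1 [^] (2 * m)) = h (c [^] m)"
      using int_pow_pow[of "u 1" 2 m] h.hom_int_pow[of "u 1 [^] (2::int)" m] h.hom_int_pow[of c m]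
      by (simp del: h.hom_int_pow bij_group_simps One_nat_def)
    then have "h (u 1 [^] (2 * m) \<otimes> c [^] k) = h (c [^] (m + k))"
      using int_pow_mult[of c m k] by (simp del: bij_group_simps One_nat_def h.hom_int_pow)
    then show ?thesis using that by (simp add: c_pow)
  qed
  let ?R = "{s \<in> carrier S. snd s \<in> kernel G bij_group h}"
  have R: "?R \<lhd> S" by (rule normal_vimage[OF snd.group_hom_axioms h.normal_kernel])
  obtain \<beta> where \<beta>: "b = 2 * \<beta>" using ab by auto
  have "even (b - a - 1)" using ab by simp
  then obtain m where m: "b - a - 1 = 2 * m" by (elim evenE)
  have inv_pow: "inv (u 1) [^] (a - b) \<otimes> inv (u 1) = u 1 [^] (2 * m)"
  proof -
    have "inv (u 1) [^] (a - b) \<otimes> inv (u 1) = inv (u 1) [^] (a - b + 1)"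
      using int_pow_mult[of "inv (u 1)" "a - b" 1] by (simp del: One_nat_def)
    also have "\<dots> = u 1 [^] (- (a - b + 1))"
      using int_pow_inv[of "u 1" "a - b + 1"] int_pow_neg[of "u 1" "a - b + 1"] by (simp del: One_nat_def)
    also have "- (a - b + 1) = 2 * m" using m by simp
    finally show ?thesis .
  qed
  have cc: "p \<otimes> c \<otimes> c [^] k = p \<otimes> c [^] (1 + k)" if "p \<in> carrier G" for p and k :: int
    using that int_pow_mult[of c 1 k] by (simp add: m_assoc)
  \<comment> \<open>The triangular numbers are expanded in \<beta> = b/2 and m = (b-a-1)/2, so that
    the parity required by \<open>pow\<close> becomes an identity.\<close>
  have l1: "lam (b + 1) = (2 * \<beta> + 1) * \<beta>" unfolding lam_def \<beta> by simp
  have ba: "b - a = 2 * m + 1" using m by simp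
  have l2: "lam (b - a + 1) = (m + 1) * (2 * m + 1)" "lam (b - a) = (2 * m + 1) * m"
  proof -
    have "(2 * m + 1 + 1) * (2 * m + 1 + 1 - 1) = 2 * ((m + 1) * (2 * m + 1))"
      "(2 * m + 1) * (2 * m + 1 - 1) = 2 * ((2 * m + 1) * m)"
      by (simp_all add: algebra_simps)
    then show "lam (b - a + 1) = (m + 1) * (2 * m + 1)" "lam (b - a) = (2 * m + 1) * m"
      unfolding lam_def ba by simp_all
  qed
  have "h (snd n1) = id" "h (snd n2) = id" "h (snd n3) = id" "h (snd n4) = id"
  proof -
    show "h (snd n1) = id"
      unfolding snd_n cc[OF int_pow_closed[OF \<open>u 1 \<in> carrier G\<close>]] l1
      using pow[of "1 - \<beta>" "1 + (2 * \<beta> + 1) * \<beta>"] by (simp add: \<beta> algebra_simps del: One_nat_def)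
    show "h (snd n2) = id" unfolding snd_n using ab by (simp add: c_pow)
    show "h (snd n3) = id"
      unfolding snd_n inv_pow cc[OF int_pow_closed[OF \<open>u 1 \<in> carrier G\<close>]] l2 by (rule pow) simp
    show "h (snd n4) = id"
      unfolding snd_n inv_pow l2 by (rule pow) simp
  qed
  then have "N \<subseteq> ?R"
    using N_gens_W by (intro N_minimal R) (auto simp: kernel_def)
  moreover assume "C \<in> N"
  ultimately have "h (snd C) = id" by (auto simp: kernel_def)
  then show False using h(2) spin_neg_facts(3) by (simp add: snd_gens)
qed

end

section \<open>The subgroups \<open>H\<close> and \<open>H0\<close> and their derived groups\<close>

context tilde_braid_quotient
begin

definition Q where "Q = S Mod N"
definition r where "r s = N #>\<^bsub>S\<^esub> s"
definition H where "H = kernel Q (sym_group n) (induced_map (\<lambda>(\<alpha>, \<beta>). \<pi> \<beta>))"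
definition H0 where "H0 = kernel (Q\<lparr>carrier := H\<rparr>) (abelianization Q) (abelianization_map Q)"

lemma group_Q: "group Q"
  unfolding Q_def by (rule N.factorgroup_is_group)

sublocale Q: group Q by (rule group_Q)

lemma r_hom: "r \<in> hom S Q"
  using N.r_coset_hom_Mod unfolding Q_def r_def .

sublocale r: group_hom S Q r
  by (simp add: group_hom_def group_hom_axioms_def r_hom group_Q group_S)

lemma carrier_Q: "carrier Q = r ` carrier S"
  by (simp add: Q_def r_def carrier_FactGroup)

lemma one_Q: "\<one>\<^bsub>Q\<^esub> = N"
  by (simp add: Q_def)

lemma r_eq_one_iff: "s \<in> carrier S \<Longrightarrow> r s = \<one>\<^bsub>Q\<^esub> \<longleftrightarrow> s \<in> N"
  unfolding one_Q r_def
  using S.coset_join1[OF _ _ N.subgroup_axioms] S.coset_join2[OF _ N.subgroup_axioms] by blast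

lemma r_eq_iff:
  assumes "s \<in> carrier S" "t \<in> carrier S"
  shows "r s = r t \<longleftrightarrow> s \<otimes>\<^bsub>S\<^esub> inv\<^bsub>S\<^esub> t \<in> N"
proof -
  have "r s = r t \<longleftrightarrow> r s \<otimes>\<^bsub>Q\<^esub> inv\<^bsub>Q\<^esub> r t = \<one>\<^bsub>Q\<^esub>"
    using assms by (metis Q.inv_equality Q.inv_inv Q.inv_closed Q.r_inv r.hom_closed)
  also have "\<dots> \<longleftrightarrow> s \<otimes>\<^bsub>S\<^esub> inv\<^bsub>S\<^esub> t \<in> N"
    using assms r_eq_one_iff[of "s \<otimes>\<^bsub>S\<^esub> inv\<^bsub>S\<^esub> t"] by simp
  finally show ?thesis .
qed

lemma S_one [simp]: "s \<in> carrier S \<Longrightarrow> s \<otimes>\<^bsub>S\<^esub> (\<one>, \<one>) = s" "s \<in> carrier S \<Longrightarrow> (\<one>, \<one>) \<otimes>\<^bsub>S\<^esub> s = s"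
  using S.r_one S.l_one by simp_all

text \<open>\<open>N\<close> lies in \<open>P0 \<times> P0\<close>, so a map killing
  \<open>P0\<close> descends through \<open>snd\<close>. This serves for \<pi> and for
  \<delta>.\<close>

lemma induced_hom:
  assumes "f \<in> hom G K" "group K" "\<And>p. p \<in> P0 \<Longrightarrow> f p = \<one>\<^bsub>K\<^esub>"
  shows "induced_map (\<lambda>(\<alpha>, \<beta>). f \<beta>) \<in> hom Q K"
    and "s \<in> carrier S \<Longrightarrow> induced_map (\<lambda>(\<alpha>, \<beta>). f \<beta>) (r s) = f (snd s)"
proof -
  have e: "(\<lambda>(\<alpha>, \<beta>). f \<beta>) = f \<circ> snd" by (simp add: fun_eq_iff)
  have f: "f \<circ> snd \<in> hom S K" using Group.hom_compose[OF snd_hom assms(1)] .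
  have one: "(f \<circ> snd) s = \<one>\<^bsub>K\<^esub>" if "s \<in> N" for s
    using that N_W assms(3) by (auto simp: W_def)
  show "induced_map (\<lambda>(\<alpha>, \<beta>). f \<beta>) \<in> hom Q K"
    unfolding e Q_def by (rule induced_map_hom[OF N_normal f assms(2) one])
  show "s \<in> carrier S \<Longrightarrow> induced_map (\<lambda>(\<alpha>, \<beta>). f \<beta>) (r s) = f (snd s)"
    unfolding e r_def by (simp add: induced_map_coset[OF N_normal f assms(2) one])
qed

lemma H_eq: "H = r ` W1"
proof -
  have one: "\<pi> p = \<one>\<^bsub>sym_group n\<^esub>" if "p \<in> P0" for p
    using that P0_subset_P by (auto simp: perm_P sym_group_one)
  have ker: "\<pi> \<beta> = \<one>\<^bsub>sym_group n\<^esub> \<longleftrightarrow> \<beta> \<in> P" if "\<beta> \<in> carrier G" for \<beta>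
    using that unfolding perm_kernel[symmetric] kernel_def by simp
  note v = induced_hom(2)[OF perm_hom sym_group_is_group one]
  have "H = {X \<in> r ` carrier S. induced_map (\<lambda>(\<alpha>, \<beta>). \<pi> \<beta>) X = \<one>\<^bsub>sym_group n\<^esub>}"
    by (simp add: H_def kernel_def carrier_Q)
  also have "\<dots> = r ` {s \<in> carrier S. \<pi> (snd s) = \<one>\<^bsub>sym_group n\<^esub>}"
    using v by force
  also have "{s \<in> carrier S. \<pi> (snd s) = \<one>\<^bsub>sym_group n\<^esub>} = W1"
    using ker by (auto simp: W1_def carrier_S)
  finally show ?thesis .
qed

definition deg where "deg = induced_map (\<lambda>(\<alpha> :: 'a, \<beta>). \<delta> \<beta>)"

lemma deg_hom: "deg \<in> hom Q integer_group"
  and deg_r: "s \<in> carrier S \<Longrightarrow> deg (r s) = \<delta> (snd s)"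
  using induced_hom[OF degree_hom group_integer_group] degree_P0 by (simp_all add: deg_def)

sublocale deg: group_hom Q integer_group deg
  by (simp add: group_hom_def group_hom_axioms_def deg_hom group_Q)

lemma W1_degree_W:
  assumes "s \<in> W1" "\<delta> (snd s) = 0"
  shows "s \<in> W"
proof -
  have "snd s \<in> kernel G (sym_group n) \<pi> \<inter> kernel G integer_group \<delta>"
    unfolding perm_kernel using assms by (auto simp: W1_def kernel_def)
  then show ?thesis using assms unfolding perm_degree_kernel by (auto simp: W1_def W_def)
qed

text \<open>\<open>H0\<close> is the intersection of \<open>H\<close> with the derived group of
  \<open>Q\<close>. \<open>W_derived\<close> gives one inclusion; for the other, derived elements
  have degree 0, and an element of \<open>W1\<close> of degree 0 lies in \<open>W\<close>.\<close>

lemma H0_eq: "H0 = r ` W"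
proof -
  let ?D = "derived Q (carrier Q)"
  interpret D: normal ?D Q by (rule Q.derived_self_is_normal)
  have D: "?D = r ` derived S (carrier S)"
    unfolding carrier_Q by (rule r.derived_img) simp
  have "H0 = {X \<in> H. ?D #>\<^bsub>Q\<^esub> X = ?D}"
    by (simp add: H0_def kernel_def abelianization_def abelianization_map_def)
  also have "\<dots> = H \<inter> ?D"
  proof -
    have "?D #>\<^bsub>Q\<^esub> X = ?D \<longleftrightarrow> X \<in> ?D" if "X \<in> H" for X
    proof -
      have "X \<in> carrier Q" using that W_subset by (auto simp: H_eq carrier_Q)
      then show ?thesis
        using Q.coset_join1[OF _ _ D.subgroup_axioms] Q.coset_join2[OF _ D.subgroup_axioms] by auto
    qed
    then show ?thesis by auto
  qed
  also have "\<dots> = r ` W"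
  proof
    show "r ` W \<subseteq> H \<inter> ?D"
      unfolding H_eq D using W_derived W_subset by auto
    show "H \<inter> ?D \<subseteq> r ` W"
    proof
      fix X assume X: "X \<in> H \<inter> ?D"
      then obtain s where s: "s \<in> W1" "X = r s" unfolding H_eq by blast
      have "derived integer_group (deg ` carrier Q) = {0}"
        using comm_group.derived_eq_singleton[OF abelian_integer_group] by simp
      moreover have "deg X \<in> derived integer_group (deg ` carrier Q)"
        using X deg.derived_img[of "carrier Q"] by auto
      ultimately have "\<delta> (snd s) = 0" using s W_subset deg_r[of s] by auto
      then show "X \<in> r ` W" using s W1_degree_W by auto
    qed
  qed
  finally show ?thesis .
qed

lemma H_subgroup: "subgroup H Q" and H0_subgroup: "subgroup H0 Q"
  unfolding H_eq H0_eq
  using r.subgroup_img_is_subgroup[OF normal_imp_subgroup[OF W1_normal]]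
    r.subgroup_img_is_subgroup[OF normal_imp_subgroup[OF W_normal]] by simp_all

lemma H0_subset_H: "H0 \<subseteq> H"
  unfolding H_eq H0_eq using W_subset by auto

lemma degree_W1_even:
  assumes "s \<in> W1"
  obtains m where "\<delta> (snd s) = 2 * m"
proof -
  have "snd s \<in> P" using assms by (auto simp: W1_def)
  then obtain q m where "q \<in> P0" "snd s = q \<otimes> (x 1 \<otimes> x 1) [^] (m::int)"
    by (rule P_decomp)
  then show ?thesis using that degree_P by simp
qed

lemma quotient_H_H0: "Q\<lparr>carrier := H\<rparr> Mod H0 \<cong> integer_group"
proof -
  let ?K = "Q\<lparr>carrier := H\<rparr>"
  \<comment> \<open>Pure elements have even degree, with \<open>x 1 x 1\<close> of degree 2, so half
    the degree is the surjective map.\<close>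
  let ?f = "\<lambda>X. deg X div 2"
  have even_deg: "even (deg X)" if XH: "X \<in> H" for X
  proof -
    obtain s where s: "s \<in> W1" "X = r s" using XH unfolding H_eq by blast
    then obtain m where "\<delta> (snd s) = 2 * m" using degree_W1_even by blast
    then show ?thesis using s W_subset by (auto simp: deg_r)
  qed
  have HQ: "H \<subseteq> carrier Q" using H_subgroup by (rule subgroup.subset)
  have hom: "?f \<in> hom ?K integer_group"
  proof (rule homI)
    fix X Y assume "X \<in> carrier ?K" "Y \<in> carrier ?K"
    then have "X \<in> H" "Y \<in> H" by simp_all
    moreover then have "X \<in> carrier Q" "Y \<in> carrier Q" using HQ by blast+
    then have "deg (X \<otimes>\<^bsub>Q\<^esub> Y) = deg X + deg Y" by simp
    ultimately show "?f (X \<otimes>\<^bsub>?K\<^esub> Y) = ?f X \<otimes>\<^bsub>integer_group\<^esub> ?f Y"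
      using even_deg by (simp add: div_plus_div_distrib_dvd_left)
  qed simp
  interpret f: group_hom ?K integer_group ?f
    by (simp add: group_hom_def group_hom_axioms_def hom Q.subgroup_imp_group H_subgroup)
  have surj: "?f ` carrier ?K = carrier integer_group"
  proof -
    have "m \<in> ?f ` H" for m
    proof -
      let ?p = "(x 1 \<otimes> x 1) [^] m"
      have p: "?p \<in> P"
        using sq_P[of 1] n by (intro subgroup_int_pow_closed P.subgroup_axioms) simp
      then have s: "(\<one>, ?p) \<in> W1" by (simp add: W1_def)
      have "\<delta> ?p = 2 * m" using degree_P[of \<one> m] p P.mem_carrier by simp
      moreover have "(\<one>, ?p) \<in> carrier S" using s W_subset by blast
      ultimately have "?f (r (\<one>, ?p)) = m" by (simp only: deg_r snd_conv)
      moreover have "r (\<one>, ?p) \<in> H" unfolding H_eq using s by (rule imageI)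
      ultimately show ?thesis by (rule image_eqI[OF HOL.sym])
    qed
    then show ?thesis by auto
  qed
  have "kernel ?K integer_group ?f = H0"
  proof
    show "H0 \<subseteq> kernel ?K integer_group ?f"
    proof
      fix X assume "X \<in> H0"
      then obtain s where s: "s \<in> W" "X = r s" unfolding H0_eq by blast
      have "s \<in> carrier S" "snd s \<in> P0" using s(1) unfolding W_eq by simp_all
      then have "deg X = 0" by (simp only: s(2) deg_r degree_P0)
      moreover have "X \<in> H" using \<open>X \<in> H0\<close> H0_subset_H by blast
      ultimately show "X \<in> kernel ?K integer_group ?f" by (simp add: kernel_def)
    qed
    show "kernel ?K integer_group ?f \<subseteq> H0"
    proof
      fix X assume "X \<in> kernel ?K integer_group ?f"
      then have X: "X \<in> H" "deg X div 2 = 0" by (simp_all add: kernel_def)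
      then have "deg X = 0" using even_deg[of X] by auto
      moreover obtain s where s: "s \<in> W1" "X = r s" using X unfolding H_eq by blast
      moreover have "s \<in> carrier S" using s W_subset by blast
      ultimately have "\<delta> (snd s) = 0" using deg_r[of s] by metis
      then have "s \<in> W" using s(1) by (intro W1_degree_W)
      then show "X \<in> H0" unfolding H0_eq s(2) by (rule imageI)
    qed
  qed
  then show ?thesis using f.FactGroup_iso surj by simp
qed

lemma C_involution: "C \<otimes>\<^bsub>S\<^esub> C = \<one>\<^bsub>S\<^esub>"
  by (simp add: C_def c_involution)

definition C_class where "C_class = r C"

lemma C_class_closed [simp]: "C_class \<in> carrier Q"
  by (simp add: C_class_def)

lemma C_class_involution: "C_class \<otimes>\<^bsub>Q\<^esub> C_class = \<one>\<^bsub>Q\<^esub>"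
  unfolding C_class_def using r.hom_mult[of C C] C_involution r.hom_one by (simp del: r.hom_mult S_simps)

lemma C_class_subgroup: "subgroup {\<one>\<^bsub>Q\<^esub>, C_class} Q"
proof -
  have "inv\<^bsub>Q\<^esub> C_class = C_class" by (rule Q.inv_equality) (simp_all add: C_class_involution)
  moreover have "\<one>\<^bsub>Q\<^esub> \<in> carrier Q" by (rule Q.one_closed)
  ultimately show ?thesis
    using C_class_involution C_class_closed by (intro Q.subgroupI) (blast, blast, auto)
qed

lemma r_c_c:
  assumes "s \<in> {\<one>, c} \<times> {\<one>, c}"
  shows "r s \<in> {\<one>\<^bsub>Q\<^esub>, C_class}"
proof -
  obtain g \<beta> where s: "s = (g, \<beta>)" "g \<in> {\<one>, c}" "\<beta> \<in> {\<one>, c}" using assms by auto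
  have gN: "(g, \<one>) \<in> N" using s(2) \<tau>_N N.one_closed by (auto simp: \<tau>_def)
  have b: "r (\<one>, \<beta>) \<in> {\<one>\<^bsub>Q\<^esub>, C_class}"
    using s(3) r.hom_one by (auto simp: C_class_def C_def)
  have gb: "g \<in> P0" "\<beta> \<in> carrier G" using s by auto
  then have "r s = r (g, \<one>) \<otimes>\<^bsub>Q\<^esub> r (\<one>, \<beta>)"
    unfolding s(1) using r.hom_mult[of "(g, \<one>)" "(\<one>, \<beta>)"] by (simp add: S_mult_special)
  also have "r (g, \<one>) = \<one>\<^bsub>Q\<^esub>" using gN gb by (subst r_eq_one_iff) auto
  finally have "r s = r (\<one>, \<beta>)" using gb by simp
  then show ?thesis using b by simp
qed

text \<open>The upper bound comes from \<open>commutator_W1\<close>, the left copy of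
  \<open>c\<close> being trivial in \<open>Q\<close>. For the lower bound, \<open>C\<close> is the
  commutator of the right copies of \<open>u 1\<close> and \<open>u 2\<close>, which already lie in
  \<open>W\<close>.\<close>

lemma derived_H: "derived Q H = {\<one>\<^bsub>Q\<^esub>, C_class}" and derived_H0: "derived Q H0 = {\<one>\<^bsub>Q\<^esub>, C_class}"
proof -
  have "derived Q H \<subseteq> {\<one>\<^bsub>Q\<^esub>, C_class}"
    unfolding derived_def
  proof (rule Q.generate_subgroup_incl[OF _ C_class_subgroup])
    show "derived_set Q H \<subseteq> {\<one>\<^bsub>Q\<^esub>, C_class}"
    proof
      fix Z assume "Z \<in> derived_set Q H"
      then obtain s t where st: "s \<in> W1" "t \<in> W1" "Z = commutator Q (r s) (r t)"
        unfolding H_eq commutator_def by blast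
      then have "Z = r (commutator S s t)" using W_subset r.hom_commutator[of s t] by auto
      then show "Z \<in> {\<one>\<^bsub>Q\<^esub>, C_class}" using r_c_c[OF commutator_W1[OF st(1,2)]] by simp
    qed
  qed
  moreover have "derived Q H0 \<subseteq> derived Q H"
    using H0_subset_H by (rule Q.mono_derived)
  moreover have "{\<one>\<^bsub>Q\<^esub>, C_class} \<subseteq> derived Q H0"
  proof -
    have w: "(\<one>, u 1) \<in> W" "(\<one>, u 2) \<in> W" by (simp_all add: W_def)
    have uc: "u 1 \<in> carrier G" "u 2 \<in> carrier G" using n by simp_all
    have "C = commutator S (\<one>, u 1) (\<one>, u 2)"
      using u_adjacent(5)[of 1] n uc
      by (intro S_eqI) (simp_all add: proj.hom_commutator snd.hom_commutator proj_gens snd_gens numeral_2_eq_2)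
    then have "C_class = commutator Q (r (\<one>, u 1)) (r (\<one>, u 2))"
      unfolding C_class_def using r.hom_commutator[of "(\<one>, u 1)" "(\<one>, u 2)"] uc by simp
    then have "C_class \<in> derived_set Q H0"
      unfolding H0_eq commutator_def using w by blast
    then have "C_class \<in> derived Q H0" unfolding derived_def by (rule generate.incl)
    moreover have "\<one>\<^bsub>Q\<^esub> \<in> derived Q H0" unfolding derived_def by (rule generate.one)
    ultimately show ?thesis by simp
  qed
  ultimately show "derived Q H = {\<one>\<^bsub>Q\<^esub>, C_class}" "derived Q H0 = {\<one>\<^bsub>Q\<^esub>, C_class}" by blast+
qed

lemma C_class_central: "derived Q H \<subseteq> center Q"
proof -
  have "C_class \<otimes>\<^bsub>Q\<^esub> X = X \<otimes>\<^bsub>Q\<^esub> C_class" if X: "X \<in> carrier Q" for X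
  proof -
    obtain s where s: "s \<in> carrier S" "X = r s" using X unfolding carrier_Q by blast
    then have "C \<otimes>\<^bsub>S\<^esub> s = s \<otimes>\<^bsub>S\<^esub> C"
      by (intro S_eqI) (simp_all add: proj_gens snd_gens c_central)
    then have "r (C \<otimes>\<^bsub>S\<^esub> s) = r (s \<otimes>\<^bsub>S\<^esub> C)" by simp
    then show ?thesis using s by (simp add: C_class_def)
  qed
  then show ?thesis by (auto simp: derived_H center_def)
qed

lemma derived_H_trivial: "\<not> (even b \<and> odd a) \<Longrightarrow> derived Q H = {\<one>\<^bsub>Q\<^esub>}"
  using C_N r_eq_one_iff[of C] by (simp add: derived_H C_class_def)

lemma derived_H_Z2:
  assumes "C \<notin> N"
  shows "Q\<lparr>carrier := derived Q H\<rparr> \<cong> Zmod 2"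
proof -
  have ne: "C_class \<noteq> \<one>\<^bsub>Q\<^esub>" using assms r_eq_one_iff[of C] by (simp add: C_class_def)
  let ?f = "\<lambda>X. if X = \<one>\<^bsub>Q\<^esub> then 0 else 1 :: int"
  have "?f \<in> iso (Q\<lparr>carrier := derived Q H\<rparr>) (Zmod 2)"
    unfolding iso_def
  proof (intro CollectI conjI homI)
    show "bij_betw ?f (carrier (Q\<lparr>carrier := derived Q H\<rparr>)) (carrier (Zmod 2))"
      using ne by (auto simp: derived_H Zmod_def carrier_integer_mod_group bij_betw_def)
    fix X Y assume "X \<in> carrier (Q\<lparr>carrier := derived Q H\<rparr>)" "Y \<in> carrier (Q\<lparr>carrier := derived Q H\<rparr>)"
    then have "X = \<one>\<^bsub>Q\<^esub> \<or> X = C_class" "Y = \<one>\<^bsub>Q\<^esub> \<or> Y = C_class" by (simp_all add: derived_H)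
    then show "?f (X \<otimes>\<^bsub>Q\<lparr>carrier := derived Q H\<rparr>\<^esub> Y) = ?f X \<otimes>\<^bsub>Zmod 2\<^esub> ?f Y"
      using ne C_class_involution by (elim disjE) (simp_all add: Zmod_def)
  qed (simp add: Zmod_def carrier_integer_mod_group)
  then show ?thesis by (rule is_isoI)
qed

end

section \<open>Lattice coordinates on \<open>W\<close> and their values on the relators\<close>

locale tilde_braid_wreath = tilde_braid_quotient +
  fixes \<theta>
  assumes \<theta>_hom: "\<theta> \<in> hom G (wreath n)"
    and \<theta>_c: "\<theta> c = (\<lambda>_. 0, id)"
    and \<theta>_u: "i \<in> {1..<n} \<Longrightarrow> \<theta> (u i) = (\<lambda>k. (if k = i then 1 else 0) - (if k = i + 1 then 1 else 0), id)"
begin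

sublocale \<theta>: group_hom G "wreath n" \<theta>
  by (simp add: group_hom_def group_hom_axioms_def \<theta>_hom group_wreath is_group)

definition vec where "vec p = fst (\<theta> p)"

lemma \<theta>_P0: "p \<in> P0 \<Longrightarrow> \<theta> p = (vec p, id)"
proof -
  let ?V = "{z. snd z = id} :: ((nat \<Rightarrow> int) \<times> (nat \<Rightarrow> nat)) set"
  have "subgroup ?V (wreath n)"
  proof (rule \<theta>.H.subgroupI)
    show "?V \<subseteq> carrier (wreath n)" by (auto simp: permutes_id)
    show "?V \<noteq> {}" by auto
    fix z assume "z \<in> ?V"
    then obtain v where z: "z = (v, id)" by (cases z) auto
    then show "inv\<^bsub>wreath n\<^esub> z \<in> ?V" by (simp add: wreath_inv_pure)
    fix y assume "y \<in> ?V"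
    then obtain w where "y = (w, id)" by (cases y) auto
    then show "z \<otimes>\<^bsub>wreath n\<^esub> y \<in> ?V" using z by simp
  qed
  then have "subgroup {p \<in> carrier G. \<theta> p \<in> ?V} G"
    by (rule subgroup_vimage[OF \<theta>.group_hom_axioms])
  moreover have "P0_gens \<subseteq> {p \<in> carrier G. \<theta> p \<in> ?V}"
    using \<theta>_c \<theta>_u gens_carrier by (auto simp: P0_gens_def)
  ultimately have "P0 \<subseteq> {p \<in> carrier G. \<theta> p \<in> ?V}"
    unfolding P0_def using generate_subgroup_incl by blast
  then show "p \<in> P0 \<Longrightarrow> \<theta> p = (vec p, id)" by (auto simp: vec_def prod_eq_iff)
qed

lemma vec_mult: "p \<in> P0 \<Longrightarrow> q \<in> P0 \<Longrightarrow> vec (p \<otimes> q) i = vec p i + vec q i"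
proof -
  assume "p \<in> P0" "q \<in> P0"
  then have "\<theta> (p \<otimes> q) = (vec p, id) \<otimes>\<^bsub>wreath n\<^esub> (vec q, id)"
    by (simp add: \<theta>_P0[symmetric])
  then show ?thesis by (simp add: vec_def)
qed

lemma vec_c: "vec c i = 0"
  by (simp add: vec_def \<theta>_c)

lemma vec_u: "j \<in> {1..<n} \<Longrightarrow> vec (u j) i = (if i = j then 1 else 0) - (if i = j + 1 then 1 else 0)"
  by (simp add: vec_def \<theta>_u)

sublocale G0: group "G\<lparr>carrier := P0\<rparr>"
  by (rule P0.subgroup_is_group[OF is_group])

lemma vec_hom: "(\<lambda>p. vec p i) \<in> hom (G\<lparr>carrier := P0\<rparr>) integer_group"
  by (rule homI) (simp_all add: vec_mult)

lemma vec_one: "vec \<one> i = 0"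
  using vec_mult[of \<one> \<one> i] by simp

lemma vec_inv: "p \<in> P0 \<Longrightarrow> vec (inv p) i = - vec p i"
  using vec_mult[of p "inv p" i] vec_one[of i] by simp

lemma vec_pow: "p \<in> P0 \<Longrightarrow> vec (p [^] (k::int)) i = k * vec p i"
proof -
  assume p: "p \<in> P0"
  interpret h: group_hom "G\<lparr>carrier := P0\<rparr>" integer_group "\<lambda>p. vec p i"
    by (simp add: group_hom_def group_hom_axioms_def vec_hom G0.is_group)
  show ?thesis
    using h.hom_int_pow[of p k] p int_pow_consistent[OF P0.subgroup_axioms p, of k] by simp
qed

lemma vec_conjg:
  assumes "p \<in> P0" "g \<in> carrier G"
  shows "vec (conjg G p g) i = vec p (snd (\<theta> g) i)"
proof -
  have "snd (\<theta> g) permutes {1..n}" using \<theta>.hom_closed[OF assms(2)] by simp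
  then have "\<theta> (conjg G p g) = (\<lambda>i. vec p (snd (\<theta> g) i), id)"
    using assms wreath_conjg[of "snd (\<theta> g)" n "vec p" "fst (\<theta> g)"]
    by (simp add: \<theta>.hom_conjg \<theta>_P0)
  then show ?thesis by (simp add: vec_def)
qed

text \<open>The combination of \<open>proj\<close> and \<open>snd\<close> that vanishes on
  \<open>n3\<close>; on \<open>(g, \<beta>)\<close> it is (a-b+1) times the vector of
  \<open>g\<close> plus (a-b) times that of \<beta>.\<close>

definition cvec where "cvec s i = (a - b + 1) * vec (proj s) i - vec (snd s) i"

lemma W_P0: "s \<in> W \<Longrightarrow> proj s \<in> P0" "s \<in> W \<Longrightarrow> snd s \<in> P0"
  using proj_P0_iff W_subset by (auto simp: W_def)

lemma cvec_mult: "s \<in> W \<Longrightarrow> t \<in> W \<Longrightarrow> cvec (s \<otimes>\<^bsub>S\<^esub> t) i = cvec s i + cvec t i"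
  using W.mem_carrier[of s] W.mem_carrier[of t] W_P0[of s] W_P0[of t]
  by (simp add: cvec_def vec_mult algebra_simps)

lemma cvec_one: "cvec \<one>\<^bsub>S\<^esub> i = 0"
  by (simp add: cvec_def vec_one)

lemma cvec_inv: "s \<in> W \<Longrightarrow> cvec (inv\<^bsub>S\<^esub> s) i = - cvec s i"
  using cvec_mult[of s "inv\<^bsub>S\<^esub> s" i] cvec_one[of i] by (simp del: S_simps(2))

text \<open>The left component of \<open>t\<close> lies in \<open>P0\<close> and has trivial
  permutation, so both projections of \<open>t\<close> permute coordinates in the same way.\<close>

lemma cvec_conjg:
  assumes "s \<in> W" "t \<in> carrier S"
  shows "cvec (conjg S s t) i = cvec s (snd (\<theta> (snd t)) i)"
proof -
  obtain g \<beta> where t: "t = (g, \<beta>)" "g \<in> P0" "\<beta> \<in> carrier G" using assms(2) by (cases t) auto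
  then have "\<theta> (proj t) = (vec g, id) \<otimes>\<^bsub>wreath n\<^esub> \<theta> \<beta>" by (simp add: \<theta>_P0)
  then have "snd (\<theta> (proj t)) = snd (\<theta> (snd t))" using t by (cases "\<theta> \<beta>") simp
  then show ?thesis
    using assms W_P0[of s] W.mem_carrier[of s]
    by (simp add: cvec_def proj.hom_conjg snd.hom_conjg vec_conjg)
qed

text \<open>Conjugation only permutes the entries, so divisibility of all entries defines a normal
  subgroup. It contains the relators: \<open>n1\<close> takes the value -(b-2a) times the vector of
  \<open>u 1\<close>, the other three take 0.\<close>

lemma cvec_N:
  assumes "s \<in> N"
  shows "(b - 2 * a) dvd cvec s i"
proof -
  let ?K = "{s \<in> W. \<forall>i. (b - 2 * a) dvd cvec s i}"
  have "?K \<lhd> S"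
  proof (rule S.normalI_conjg)
    show "subgroup ?K S"
    proof (rule S.subgroupI)
      show "?K \<subseteq> carrier S" using W.subset by auto
      have "\<one>\<^bsub>S\<^esub> \<in> ?K" using W.one_closed by (simp add: cvec_one del: S_simps(2))
      then show "?K \<noteq> {}" by blast
    qed (auto simp: cvec_mult cvec_inv)
    show "conjg S s t \<in> ?K" if "s \<in> ?K" "t \<in> carrier S" for s t
      using that by (auto simp: cvec_conjg W.conjg_mem)
  qed
  moreover have "n1 \<in> ?K" "n2 \<in> ?K" "n3 \<in> ?K" "n4 \<in> ?K"
  proof -
    have [simp]: "u 1 [^] (k::int) \<in> P0" "inv (u 1) [^] (k::int) \<in> P0" "c [^] (k::int) \<in> P0" for k
      by (auto intro!: subgroup_int_pow_closed P0.subgroup_axioms simp del: One_nat_def)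
    have "cvec n1 i = - ((b - 2 * a) * vec (u 1) i)" "cvec n2 i = 0" "cvec n3 i = 0" "cvec n4 i = 0" for i
      unfolding cvec_def proj_n snd_n
      by (simp_all add: vec_mult vec_pow vec_c vec_inv vec_one algebra_simps del: One_nat_def)
    then show "n1 \<in> ?K" "n2 \<in> ?K" "n3 \<in> ?K" "n4 \<in> ?K" using N_gens_W by simp_all
  qed
  ultimately have "N \<subseteq> ?K" by (rule N_minimal)
  then show ?thesis using assms by auto
qed

text \<open>Coordinates with respect to the simple roots \<open>e\<^sub>i - e\<^sub>i\<^sub>+\<^sub>1\<close> are partial sums.\<close>

definition psum where "psum i p = (\<Sum>j = 1..i. vec p j)"
definition coord where "coord i s = (\<Sum>j = 1..i. cvec s j)"

lemma psum_u:
  assumes "i \<in> {1..<n}" "j \<in> {1..<n}"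
  shows "psum i (u j) = (if i = j then 1 else 0)"
  using assms by (simp add: psum_def vec_u sum_subtractf)

lemma psum_c: "psum i c = 0"
  by (simp add: psum_def vec_c)

lemma psum_facts:
  "p \<in> P0 \<Longrightarrow> q \<in> P0 \<Longrightarrow> psum i (p \<otimes> q) = psum i p + psum i q" "psum i \<one> = 0"
  "p \<in> P0 \<Longrightarrow> psum i (inv p) = - psum i p"
  "p \<in> P0 \<Longrightarrow> psum i (p [^] (k::int)) = k * psum i p"
  by (simp_all add: psum_def vec_mult sum.distrib vec_one vec_inv vec_pow sum_negf sum_distrib_left)

lemma coord_eq: "coord i s = (a - b + 1) * psum i (proj s) - psum i (snd s)"
  by (simp add: coord_def psum_def cvec_def sum_subtractf sum_distrib_left)

lemma coord_mult: "s \<in> W \<Longrightarrow> t \<in> W \<Longrightarrow> coord i (s \<otimes>\<^bsub>S\<^esub> t) = coord i s + coord i t"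
  by (simp add: coord_def cvec_mult sum.distrib)

lemma coord_N: "s \<in> N \<Longrightarrow> (b - 2 * a) dvd coord i s"
  unfolding coord_def by (intro dvd_sum cvec_N)

lemma psum_surj: "\<exists>p \<in> P0. \<forall>i \<in> {1..<n}. psum i p = t i" for t :: "nat \<Rightarrow> int"
proof -
  have "\<exists>p \<in> P0. \<forall>i \<in> {1..<n}. psum i p = (if i < l then t i else 0)" for l
  proof (induction l)
    case 0
    show ?case using psum_facts(2) by (intro bexI[of _ \<one>]) simp_all
  next
    case (Suc l)
    then obtain p where p: "p \<in> P0" "\<And>i. i \<in> {1..<n} \<Longrightarrow> psum i p = (if i < l then t i else 0)" by blast
    show ?case
    proof (cases "l \<in> {1..<n}")
      case True
      have ul: "u l \<in> P0" "u l [^] t l \<in> P0"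
        using u_P0[OF True] by (auto intro: subgroup_int_pow_closed P0.subgroup_axioms)
      have "psum i (p \<otimes> u l [^] t l) = (if i < Suc l then t i else 0)" if "i \<in> {1..<n}" for i
        using p(2)[OF that] psum_u[OF that True] p(1) ul by (cases "i = l") (simp_all add: psum_facts)
      moreover have "p \<otimes> u l [^] t l \<in> P0" using p ul by (intro P0.m_closed)
      ultimately show ?thesis by blast
    next
      case False
      then have "(if i < Suc l then t i else 0) = (if i < l then t i else 0)" if "i \<in> {1..<n}" for i
        using that by (cases "i = l") auto
      then show ?thesis using p by (intro bexI[of _ p]) auto
    qed
  qed
  from this[of n] show ?thesis by auto
qed

end

lemma (in group) hom_eq_generate:
  assumes "f \<in> hom G H" "g \<in> hom G H" "group H" "T \<subseteq> carrier G"
    and "\<And>t. t \<in> T \<Longrightarrow> f t = g t" and "p \<in> generate G T"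
  shows "f p = g p"
proof -
  interpret f: group_hom G H f
    using assms(1,3) by (simp add: group_hom_def group_hom_axioms_def is_group)
  interpret g: group_hom G H g
    using assms(2,3) by (simp add: group_hom_def group_hom_axioms_def is_group)
  show ?thesis
    using assms(6)
  proof (induction rule: generate.induct)
    case (inv h)
    then show ?case using assms(4,5) by auto
  next
    case (eng h1 h2)
    then show ?case using generate_in_carrier[OF assms(4)] by simp
  qed (use assms(5) in auto)
qed

section \<open>The abelianisation of \<open>H0\<close>\<close>

context tilde_braid_wreath
begin

definition K where "K = Q\<lparr>carrier := H0\<rparr>"
definition A where "A = abelianization K"
definition cls where "cls s = derived K (carrier K) #>\<^bsub>K\<^esub> r s"

lemma group_K: "group K"
  unfolding K_def by (rule Q.subgroup_imp_group[OF H0_subgroup])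

sublocale K: group K by (rule group_K)

lemma carrier_K: "carrier K = r ` W"
  by (simp add: K_def H0_eq)

lemma derived_K: "derived K (carrier K) = {\<one>\<^bsub>Q\<^esub>, C_class}"
  unfolding K_def using Q.derived_consistent[OF _ H0_subgroup, of H0] by (simp add: derived_H0)

lemma comm_group_A: "comm_group A"
  unfolding A_def abelianization_def by (rule K.derived_quot_is_comm_group)

sublocale A: comm_group A by (rule comm_group_A)

sublocale SW: group "S\<lparr>carrier := W\<rparr>"
  by (rule W.subgroup_is_group[OF group_S])

lemma r_hom_K: "r \<in> hom (S\<lparr>carrier := W\<rparr>) K"
  by (rule homI) (use W.subset in \<open>auto simp: K_def H0_eq\<close>)

lemma cls_hom: "cls \<in> hom (S\<lparr>carrier := W\<rparr>) A"
proof -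
  interpret D: normal "derived K (carrier K)" K by (rule K.derived_self_is_normal)
  have "(\<lambda>X. derived K (carrier K) #>\<^bsub>K\<^esub> X) \<circ> r \<in> hom (S\<lparr>carrier := W\<rparr>) A"
    unfolding A_def abelianization_def
    by (rule Group.hom_compose[OF r_hom_K D.r_coset_hom_Mod])
  moreover have "cls = (\<lambda>X. derived K (carrier K) #>\<^bsub>K\<^esub> X) \<circ> r"
    by (rule ext) (simp add: cls_def)
  ultimately show ?thesis by simp
qed

sublocale cls: group_hom "S\<lparr>carrier := W\<rparr>" A cls
  by (simp add: group_hom_def group_hom_axioms_def cls_hom SW.is_group A.is_group)

lemma cls_one_iff: "s \<in> W \<Longrightarrow> cls s = \<one>\<^bsub>A\<^esub> \<longleftrightarrow> r s \<in> {\<one>\<^bsub>Q\<^esub>, C_class}"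
proof -
  assume s: "s \<in> W"
  interpret D: normal "derived K (carrier K)" K by (rule K.derived_self_is_normal)
  have "r s \<in> carrier K" using s by (simp add: carrier_K)
  then have "cls s = derived K (carrier K) \<longleftrightarrow> r s \<in> derived K (carrier K)"
    unfolding cls_def
    using K.coset_join1[OF _ _ D.subgroup_axioms] K.coset_join2[OF _ D.subgroup_axioms] by blast
  then show ?thesis by (simp add: A_def abelianization_def derived_K)
qed

lemma cls_mult: "s \<in> W \<Longrightarrow> t \<in> W \<Longrightarrow> cls (s \<otimes>\<^bsub>S\<^esub> t) = cls s \<otimes>\<^bsub>A\<^esub> cls t"
  using cls.hom_mult[of s t] by simp

lemma cls_closed: "s \<in> W \<Longrightarrow> cls s \<in> carrier A"
  using cls.hom_closed[of s] by simp

lemma cls_inv: "s \<in> W \<Longrightarrow> cls (inv\<^bsub>S\<^esub> s) = inv\<^bsub>A\<^esub> cls s"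
  using cls.hom_inv[of s] S.m_inv_consistent[OF W.subgroup_axioms] by simp

lemma cls_pow: "s \<in> W \<Longrightarrow> cls (s [^]\<^bsub>S\<^esub> (k::int)) = cls s [^]\<^bsub>A\<^esub> k"
  using cls.hom_int_pow[of s k] S.int_pow_consistent[OF W.subgroup_axioms, of s k] by simp

lemma cls_c: "cls \<tau> = \<one>\<^bsub>A\<^esub>" "cls C = \<one>\<^bsub>A\<^esub>"
  using cls_one_iff[of \<tau>] cls_one_iff[of C] gens_W r_c_c[of \<tau>] r_c_c[of C] c_P0
  by (simp_all add: \<tau>_def C_def)

lemma cls_N: "s \<in> N \<Longrightarrow> cls s = \<one>\<^bsub>A\<^esub>"
  using cls_one_iff[of s] N_W r_eq_one_iff[of s] W.subset by auto

text \<open>The derived group of \<open>K\<close> is central in all of \<open>Q\<close>, so a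
  trivial class stays trivial under every element of \<open>S\<close>, including those outside
  \<open>W\<close> that carry \<open>u i\<close> to \<open>u (i + 1)\<close>.\<close>

lemma cls_conjg_trivial:
  assumes "s \<in> W" "cls s = \<one>\<^bsub>A\<^esub>" "t \<in> carrier S"
  shows "cls (conjg S s t) = \<one>\<^bsub>A\<^esub>"
proof -
  have "r s \<in> {\<one>\<^bsub>Q\<^esub>, C_class}" using assms cls_one_iff by simp
  moreover have "conjg Q X (r t) = X" if "X \<in> {\<one>\<^bsub>Q\<^esub>, C_class}" for X
    using that C_class_central assms(3)
    by (subst Q.conjg_eq_iff_commute) (auto simp: derived_H center_def)
  ultimately have "r (conjg S s t) \<in> {\<one>\<^bsub>Q\<^esub>, C_class}"
    using assms r.hom_conjg[of s t] W.mem_carrier by simp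
  then show ?thesis using assms cls_one_iff W.conjg_mem by simp
qed

text \<open>\<open>n1\<close> and \<open>n3\<close> transported to index \<open>i\<close>, without
  their factors \<tau> and \<open>C\<close>, which are trivial in \<open>A\<close>.\<close>

definition e1 where "e1 i = (u i, \<one>) [^]\<^bsub>S\<^esub> b \<otimes>\<^bsub>S\<^esub> (\<one>, u i) [^]\<^bsub>S\<^esub> (2 - b)"
definition e3 where "e3 i = ((u i, \<one>) \<otimes>\<^bsub>S\<^esub> inv\<^bsub>S\<^esub> (\<one>, u i)) [^]\<^bsub>S\<^esub> (a - b) \<otimes>\<^bsub>S\<^esub> inv\<^bsub>S\<^esub> (\<one>, u i)"

lemma u_W: "i \<in> {1..<n} \<Longrightarrow> (u i, \<one>) \<in> W" "i \<in> {1..<n} \<Longrightarrow> (\<one>, u i) \<in> W"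
  using u_P0 by (simp_all add: W_def)

lemma e_W: "i \<in> {1..<n} \<Longrightarrow> e1 i \<in> W" "i \<in> {1..<n} \<Longrightarrow> e3 i \<in> W"
  unfolding e1_def e3_def by (intro W.m_closed W_pow W.m_inv_closed u_W; assumption)+

lemma cls_e: "1 \<le> i \<Longrightarrow> i < n \<Longrightarrow> cls (e1 i) = \<one>\<^bsub>A\<^esub> \<and> cls (e3 i) = \<one>\<^bsub>A\<^esub>"
proof (induction i rule: nat_induct_at_least)
  case base
  have e: "e1 1 \<in> W" "e3 1 \<in> W" using e_W[of 1] n by simp_all
  have ct: "C \<otimes>\<^bsub>S\<^esub> \<tau> \<in> W" "(C \<otimes>\<^bsub>S\<^esub> \<tau>) [^]\<^bsub>S\<^esub> k \<in> W" for k :: int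
    using gens_W by (auto intro: W_pow)
  have clsk: "cls ((C \<otimes>\<^bsub>S\<^esub> \<tau>) [^]\<^bsub>S\<^esub> k) = \<one>\<^bsub>A\<^esub>" for k :: int
    using ct gens_W by (simp add: cls_pow cls_mult cls_c)
  have n1: "n1 = e1 1 \<otimes>\<^bsub>S\<^esub> C \<otimes>\<^bsub>S\<^esub> (C \<otimes>\<^bsub>S\<^esub> \<tau>) [^]\<^bsub>S\<^esub> lam (b + 1)"
    unfolding n1_def e1_def B11_def U_def ..
  have n3: "n3 = e3 1 \<otimes>\<^bsub>S\<^esub> C \<otimes>\<^bsub>S\<^esub> (C \<otimes>\<^bsub>S\<^esub> \<tau>) [^]\<^bsub>S\<^esub> lam (b - a + 1)"
    unfolding n3_def e3_def B11_def U_def ..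
  have "cls n1 = cls (e1 1)" "cls n3 = cls (e3 1)"
    unfolding n1 n3 using e ct gens_W
    by (simp_all add: cls_mult clsk cls_c cls_closed W.m_closed del: One_nat_def)
  then show ?case using cls_N N_gens by simp
next
  case (Suc i)
  let ?y = "x (i + 1) \<otimes> x i"
  have y: "?y \<in> carrier G" and yS: "(\<one>, ?y) \<in> carrier S" using Suc by auto
  have i: "i \<in> {1..<n}" using Suc by simp
  have us: "(u i, \<one>) \<in> carrier S" "(\<one>, u i) \<in> carrier S"
    using u_W[OF i] W.subset by blast+
  have c: "conjg S (u i, \<one>) (\<one>, ?y) = (u (i + 1), \<one>)" "conjg S (\<one>, u i) (\<one>, ?y) = (\<one>, u (i + 1))"
    using S_conjg_right[of "u i" ?y] u_P0[OF i] y u_step[of i] Suc by simp_all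
  have "conjg S (e1 i) (\<one>, ?y) = e1 (i + 1)" "conjg S (e3 i) (\<one>, ?y) = e3 (i + 1)"
    unfolding e1_def e3_def using us yS
    by (simp_all only: S.conjg_mult S.conjg_int_pow S.conjg_inv c S.m_closed S.inv_closed S.int_pow_closed)
  then show ?case
    using cls_conjg_trivial[OF e_W(1)[OF i] _ yS] cls_conjg_trivial[OF e_W(2)[OF i] _ yS] Suc by simp
qed

definition \<gamma> where "\<gamma> i = cls ((u i, \<one>) \<otimes>\<^bsub>S\<^esub> inv\<^bsub>S\<^esub> (\<one>, u i))"

lemma \<gamma>_closed: "i \<in> {1..<n} \<Longrightarrow> \<gamma> i \<in> carrier A"
  unfolding \<gamma>_def using u_W by (intro cls_closed W.m_closed W.m_inv_closed)

text \<open>\<open>e3\<close> expresses the class of the right copy of \<open>u i\<close> through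
  \<gamma>, the definition of \<gamma> then gives that of the left copy, and \<open>e1\<close>
  becomes the order relation.\<close>

lemma cls_u:
  assumes "i \<in> {1..<n}"
  shows "cls (\<one>, u i) = \<gamma> i [^]\<^bsub>A\<^esub> (a - b)" "cls (u i, \<one>) = \<gamma> i [^]\<^bsub>A\<^esub> (a - b + 1)"
    "\<gamma> i [^]\<^bsub>A\<^esub> (b - 2 * a) = \<one>\<^bsub>A\<^esub>"
proof -
  note w = u_W[OF assms]
  have wi: "(u i, \<one>) \<otimes>\<^bsub>S\<^esub> inv\<^bsub>S\<^esub> (\<one>, u i) \<in> W" using w by simp
  note g [simp] = \<gamma>_closed[OF assms]
  have [simp]: "cls (\<one>, u i) \<in> carrier A" "cls (u i, \<one>) \<in> carrier A" using w by (simp_all add: cls_closed)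
  have "cls (e3 i) = \<gamma> i [^]\<^bsub>A\<^esub> (a - b) \<otimes>\<^bsub>A\<^esub> inv\<^bsub>A\<^esub> cls (\<one>, u i)"
    unfolding e3_def \<gamma>_def using w wi W_pow[OF wi] by (simp only: cls_mult cls_pow cls_inv W.m_inv_closed)
  then have e3: "\<gamma> i [^]\<^bsub>A\<^esub> (a - b) \<otimes>\<^bsub>A\<^esub> inv\<^bsub>A\<^esub> cls (\<one>, u i) = \<one>\<^bsub>A\<^esub>" using cls_e assms by simp
  have "cls (\<one>, u i) = \<gamma> i [^]\<^bsub>A\<^esub> (a - b) \<otimes>\<^bsub>A\<^esub> inv\<^bsub>A\<^esub> cls (\<one>, u i) \<otimes>\<^bsub>A\<^esub> cls (\<one>, u i)"
    unfolding e3 by simp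
  then show 1: "cls (\<one>, u i) = \<gamma> i [^]\<^bsub>A\<^esub> (a - b)" by (simp add: A.m_assoc)
  have "\<gamma> i = cls (u i, \<one>) \<otimes>\<^bsub>A\<^esub> inv\<^bsub>A\<^esub> cls (\<one>, u i)"
    unfolding \<gamma>_def using w by (simp only: cls_mult cls_inv W.m_inv_closed)
  then have "\<gamma> i \<otimes>\<^bsub>A\<^esub> cls (\<one>, u i) = cls (u i, \<one>)" by (simp add: A.m_assoc)
  then show 2: "cls (u i, \<one>) = \<gamma> i [^]\<^bsub>A\<^esub> (a - b + 1)"
    unfolding 1 using A.int_pow_mult[OF g, of 1 "a - b"] by (simp add: add.commute)
  have "cls (e1 i) = cls (u i, \<one>) [^]\<^bsub>A\<^esub> b \<otimes>\<^bsub>A\<^esub> cls (\<one>, u i) [^]\<^bsub>A\<^esub> (2 - b)"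
    unfolding e1_def using w W_pow by (simp only: cls_mult cls_pow)
  also have "\<dots> = \<gamma> i [^]\<^bsub>A\<^esub> ((a - b + 1) * b + (a - b) * (2 - b))"
    unfolding 1 2 using A.int_pow_mult[OF g, of "(a - b + 1) * b" "(a - b) * (2 - b)"]
    by (simp only: A.int_pow_pow[OF g])
  \<comment> \<open>This is, up to sign, the determinant of the relations \<open>e1\<close> and
    \<open>e3\<close> in the two copies of \<open>u i\<close>.\<close>
  also have "(a - b + 1) * b + (a - b) * (2 - b) = - (b - 2 * a)" by (simp add: algebra_simps)
  finally have "inv\<^bsub>A\<^esub> (\<gamma> i [^]\<^bsub>A\<^esub> (b - 2 * a)) = \<one>\<^bsub>A\<^esub>"
    using cls_e assms A.int_pow_neg[OF g, of "b - 2 * a"] by simp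
  then show "\<gamma> i [^]\<^bsub>A\<^esub> (b - 2 * a) = \<one>\<^bsub>A\<^esub>" using g by simp
qed

text \<open>Both sides are homomorphisms on \<open>P0\<close>, and they agree on \<open>c\<close>
  and on each \<open>u j\<close> because \<open>psum\<close> reads off the coefficient of the simple
  root.\<close>

lemma P0_hom_expansion:
  fixes f :: "'a \<Rightarrow> _" and k :: int
  assumes f: "f \<in> hom (G\<lparr>carrier := P0\<rparr>) A" and fc: "f c = \<one>\<^bsub>A\<^esub>"
    and fu: "\<And>i. i \<in> {1..<n} \<Longrightarrow> f (u i) = \<gamma> i [^]\<^bsub>A\<^esub> k" and p: "p \<in> P0"
  shows "f p = (\<Otimes>\<^bsub>A\<^esub>i\<in>{1..<n}. \<gamma> i [^]\<^bsub>A\<^esub> (k * psum i p))"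
proof -
  let ?g = "\<lambda>p. \<Otimes>\<^bsub>A\<^esub>i\<in>{1..<n}. \<gamma> i [^]\<^bsub>A\<^esub> (k * psum i p)"
  have gam: "(\<lambda>i. \<gamma> i [^]\<^bsub>A\<^esub> h i) \<in> {1..<n} \<rightarrow> carrier A" for h :: "nat \<Rightarrow> int"
    using \<gamma>_closed by (auto intro: A.int_pow_closed)
  have g: "?g \<in> hom (G\<lparr>carrier := P0\<rparr>) A"
  proof (rule homI)
    fix p q assume "p \<in> carrier (G\<lparr>carrier := P0\<rparr>)" "q \<in> carrier (G\<lparr>carrier := P0\<rparr>)"
    then have pq: "p \<in> P0" "q \<in> P0" by simp_all
    show "?g p \<in> carrier A" using gam by (rule A.finprod_closed)
    have "?g (p \<otimes> q) = (\<Otimes>\<^bsub>A\<^esub>i\<in>{1..<n}. \<gamma> i [^]\<^bsub>A\<^esub> (k * psum i p) \<otimes>\<^bsub>A\<^esub> \<gamma> i [^]\<^bsub>A\<^esub> (k * psum i q))"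
      using pq \<gamma>_closed
      by (intro A.finprod_cong') (auto simp: psum_facts algebra_simps A.int_pow_mult)
    also have "\<dots> = ?g p \<otimes>\<^bsub>A\<^esub> ?g q" using gam by (intro A.finprod_multf)
    finally show "?g (p \<otimes>\<^bsub>G\<lparr>carrier := P0\<rparr>\<^esub> q) = ?g p \<otimes>\<^bsub>A\<^esub> ?g q" by simp
  qed
  have gens: "f t = ?g t" if "t \<in> P0_gens" for t
  proof -
    consider "t = c" | j where "t = u j" "j \<in> {1..<n}" using \<open>t \<in> P0_gens\<close> by (auto simp: P0_gens_def)
    then show ?thesis
    proof cases
      case 1
      have "?g c = \<one>\<^bsub>A\<^esub>" by (rule A.finprod_one_eqI) (simp add: psum_c)
      then show ?thesis using 1 fc by simp
    next
      case 2
      have "?g (u j) = (\<Otimes>\<^bsub>A\<^esub>i\<in>{1..<n}. if j = i then \<gamma> i [^]\<^bsub>A\<^esub> k else \<one>\<^bsub>A\<^esub>)"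
        using 2 \<gamma>_closed by (intro A.finprod_cong') (auto simp: psum_u)
      also have "\<dots> = \<gamma> j [^]\<^bsub>A\<^esub> k"
        using 2 gam[of "\<lambda>_. k"] by (intro A.finprod_singleton) auto
      finally show ?thesis using 2 fu by simp
    qed
  qed
  have "P0_gens \<subseteq> P0" using c_P0 u_P0 by (auto simp: P0_gens_def)
  moreover have "generate (G\<lparr>carrier := P0\<rparr>) P0_gens = P0"
    using generate_consistent[OF calculation P0.subgroup_axioms] by (simp add: P0_def)
  ultimately show ?thesis
    using G0.hom_eq_generate[OF f g A.is_group _ gens, of P0_gens p] p by simp
qed

text \<open>The two factors of \<open>W\<close> contribute the exponents (a-b+1) and (a-b) from
  \<open>cls_u\<close>; since \<open>psum\<close> of \<open>proj\<close> is the sum over both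
  components, these add up to \<open>coord\<close>.\<close>

lemma cls_expansion:
  assumes "s \<in> W"
  shows "cls s = (\<Otimes>\<^bsub>A\<^esub>i\<in>{1..<n}. \<gamma> i [^]\<^bsub>A\<^esub> coord i s)"
proof -
  obtain g \<beta> where s: "s = (g, \<beta>)" "g \<in> P0" "\<beta> \<in> P0" using assms by (auto simp: W_def)
  have gam: "(\<lambda>i. \<gamma> i [^]\<^bsub>A\<^esub> h i) \<in> {1..<n} \<rightarrow> carrier A" for h :: "nat \<Rightarrow> int"
    using \<gamma>_closed by (auto intro: A.int_pow_closed)
  have memW: "(p, \<one>) \<in> W" "(\<one>, p) \<in> W" if "p \<in> P0" for p using that by (simp_all add: W_def)
  have "(\<lambda>p. cls (p, \<one>)) \<in> hom (G\<lparr>carrier := P0\<rparr>) A"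
  proof (rule homI)
    fix p q assume "p \<in> carrier (G\<lparr>carrier := P0\<rparr>)" "q \<in> carrier (G\<lparr>carrier := P0\<rparr>)"
    then have pq: "p \<in> P0" "q \<in> P0" by simp_all
    show "cls (p, \<one>) \<in> carrier A" using cls_closed memW pq by simp
    show "cls (p \<otimes>\<^bsub>G\<lparr>carrier := P0\<rparr>\<^esub> q, \<one>) = cls (p, \<one>) \<otimes>\<^bsub>A\<^esub> cls (q, \<one>)"
      using cls_mult[of "(p, \<one>)" "(q, \<one>)"] memW pq by (simp add: S_mult_special)
  qed
  then have 1: "cls (g, \<one>) = (\<Otimes>\<^bsub>A\<^esub>i\<in>{1..<n}. \<gamma> i [^]\<^bsub>A\<^esub> ((a - b + 1) * psum i g))"
    using cls_c cls_u s(2) by (intro P0_hom_expansion) (auto simp: \<tau>_def)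
  have "(\<lambda>p. cls (\<one>, p)) \<in> hom (G\<lparr>carrier := P0\<rparr>) A"
  proof (rule homI)
    fix p q assume "p \<in> carrier (G\<lparr>carrier := P0\<rparr>)" "q \<in> carrier (G\<lparr>carrier := P0\<rparr>)"
    then have pq: "p \<in> P0" "q \<in> P0" by simp_all
    show "cls (\<one>, p) \<in> carrier A" using cls_closed memW pq by simp
    show "cls (\<one>, p \<otimes>\<^bsub>G\<lparr>carrier := P0\<rparr>\<^esub> q) = cls (\<one>, p) \<otimes>\<^bsub>A\<^esub> cls (\<one>, q)"
      using cls_mult[of "(\<one>, p)" "(\<one>, q)"] memW pq by (simp add: S_mult_special)
  qed
  then have 2: "cls (\<one>, \<beta>) = (\<Otimes>\<^bsub>A\<^esub>i\<in>{1..<n}. \<gamma> i [^]\<^bsub>A\<^esub> ((a - b) * psum i \<beta>))"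
    using cls_c cls_u s(3) by (intro P0_hom_expansion) (auto simp: C_def)
  have "cls s = cls (g, \<one>) \<otimes>\<^bsub>A\<^esub> cls (\<one>, \<beta>)"
    using cls_mult[of "(g, \<one>)" "(\<one>, \<beta>)"] memW s by (simp add: S_mult_special)
  also have "\<dots> = (\<Otimes>\<^bsub>A\<^esub>i\<in>{1..<n}. \<gamma> i [^]\<^bsub>A\<^esub> ((a - b + 1) * psum i g) \<otimes>\<^bsub>A\<^esub> \<gamma> i [^]\<^bsub>A\<^esub> ((a - b) * psum i \<beta>))"
    unfolding 1 2 using gam by (intro A.finprod_multf[symmetric])
  also have "\<dots> = (\<Otimes>\<^bsub>A\<^esub>i\<in>{1..<n}. \<gamma> i [^]\<^bsub>A\<^esub> coord i s)"
  proof (rule A.finprod_cong')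
    fix i assume i: "i \<in> {1..<n}"
    have "coord i s = (a - b + 1) * psum i g + (a - b) * psum i \<beta>"
      using s by (simp add: coord_eq psum_facts algebra_simps)
    then show "\<gamma> i [^]\<^bsub>A\<^esub> ((a - b + 1) * psum i g) \<otimes>\<^bsub>A\<^esub> \<gamma> i [^]\<^bsub>A\<^esub> ((a - b) * psum i \<beta>) = \<gamma> i [^]\<^bsub>A\<^esub> coord i s"
      using \<gamma>_closed[OF i] by (simp add: A.int_pow_mult)
  qed (use gam in auto)
  finally show ?thesis .
qed

text \<open>The coordinates modulo b-2a are well defined by \<open>coord_N\<close>. Conversely, if
  all of them vanish, then \<open>cls_expansion\<close> and the order relation of \<gamma> make the
  class trivial, so the kernel is exactly the derived group.\<close>

lemma abelianization_H0:
  "abelianization (Q\<lparr>carrier := H0\<rparr>) \<cong> product_group {1..n - 1} (\<lambda>_. Zmod (b - 2 * a))"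
proof -
  \<comment> \<open>For b = 2a this modulus is 0, where \<open>mod\<close> is the identity and
    \<open>Zmod\<close> is the infinite cyclic group, so this case needs no separate
    treatment.\<close>
  let ?I = "{1..n - 1}" and ?k = "int (nat \<bar>b - 2 * a\<bar>)"
  let ?T = "product_group ?I (\<lambda>_. Zmod (b - 2 * a))"
  have I: "?I = {1..<n}" using n by auto
  have group_T: "group ?T" by (rule product_group) (simp add: Zmod_def)
  have mod_mem: "z mod ?k \<in> carrier (Zmod (b - 2 * a))" for z
    by (simp add: Zmod_def carrier_integer_mod_group)
  let ?f = "\<lambda>s. \<lambda>i\<in>?I. coord i s mod ?k"
  have f: "?f \<in> hom (S\<lparr>carrier := W\<rparr>) ?T"
  proof (rule homI)
    fix s t assume "s \<in> carrier (S\<lparr>carrier := W\<rparr>)" "t \<in> carrier (S\<lparr>carrier := W\<rparr>)"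
    then have st: "s \<in> W" "t \<in> W" by simp_all
    show "?f s \<in> carrier ?T" using mod_mem by auto
    show "?f (s \<otimes>\<^bsub>S\<lparr>carrier := W\<rparr>\<^esub> t) = ?f s \<otimes>\<^bsub>?T\<^esub> ?f t"
      using st by (auto simp: Zmod_def coord_mult mod_add_eq intro!: restrict_ext)
  qed
  have fN: "?f s = \<one>\<^bsub>?T\<^esub>" if "s \<in> N" for s
    using coord_N[OF that] by (auto simp: Zmod_def intro!: restrict_ext)
  have NW: "N \<lhd> S\<lparr>carrier := W\<rparr>"
    by (rule S.normal_restrict_supergroup[OF W.subgroup_axioms N_normal N_W])
  have K_eq: "K = S\<lparr>carrier := W\<rparr> Mod N"
  proof -
    have "set_mult (S\<lparr>carrier := W\<rparr>) = set_mult S" by (simp add: fun_eq_iff set_mult_def)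
    then show ?thesis
      by (simp add: K_def H0_eq Q_def FactGroup_def RCOSETS_def r_def image_def) blast
  qed
  define F where "F = induced_map ?f"
  have F: "F \<in> hom K ?T"
    unfolding F_def K_eq by (rule induced_map_hom[OF NW f group_T fN])
  have F_r: "F (r s) = ?f s" if "s \<in> W" for s
    using induced_map_coset[OF NW f group_T fN, of s] that by (simp add: F_def r_def)
  interpret F: group_hom K ?T F
    by (intro group_hom.intro group_hom_axioms.intro K.is_group group_T F)
  have "kernel K ?T F = derived K (carrier K)"
  proof
    show "derived K (carrier K) \<subseteq> kernel K ?T F"
    proof -
      have "C_class \<in> carrier K" unfolding C_class_def carrier_K using gens_W by blast
      moreover have "F C_class = \<one>\<^bsub>?T\<^esub>"
        unfolding C_class_def using F_r[of C] gens_W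
        by (auto simp: Zmod_def coord_eq proj_gens snd_gens psum_c intro!: restrict_ext)
      moreover have "\<one>\<^bsub>Q\<^esub> = \<one>\<^bsub>K\<^esub>" by (simp add: K_def)
      ultimately show ?thesis unfolding derived_K kernel_def using F.hom_one K.one_closed by auto
    qed
    show "kernel K ?T F \<subseteq> derived K (carrier K)"
    proof
      fix X assume "X \<in> kernel K ?T F"
      then have X: "X \<in> r ` W" "F X = \<one>\<^bsub>?T\<^esub>" unfolding kernel_def carrier_K by auto
      then obtain s where s: "s \<in> W" "X = r s" by blast
      have "\<gamma> i [^]\<^bsub>A\<^esub> coord i s = \<one>\<^bsub>A\<^esub>" if i: "i \<in> {1..<n}" for i
      proof -
        have "coord i s mod ?k = 0"
          using X(2) F_r[OF s(1)] i unfolding s(2) I by (auto simp: Zmod_def dest: fun_cong[of _ _ i])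
        then have "(b - 2 * a) dvd coord i s" by (simp add: mod_eq_0_iff_dvd)
        then obtain l where "coord i s = (b - 2 * a) * l" by (elim dvdE)
        then show ?thesis
          using A.int_pow_pow[OF \<gamma>_closed[OF i], of "b - 2 * a" l] cls_u(3)[OF i] by simp
      qed
      then have "cls s = \<one>\<^bsub>A\<^esub>"
        unfolding cls_expansion[OF s(1)] by (intro A.finprod_one_eqI) auto
      then show "X \<in> derived K (carrier K)" using cls_one_iff[OF s(1)] s(2) derived_K by simp
    qed
  qed
  moreover have "F ` carrier K = carrier ?T"
  proof
    show "F ` carrier K \<subseteq> carrier ?T" using F.hom_closed by blast
    show "carrier ?T \<subseteq> F ` carrier K"
    proof
      fix t assume t: "t \<in> carrier ?T"
      obtain p where p: "p \<in> P0" "\<And>i. i \<in> {1..<n} \<Longrightarrow> psum i p = t i" using psum_surj[of t] by blast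
      \<comment> \<open>Under \<open>proj\<close> this element is trivial and under
        \<open>snd\<close> it is \<open>inv p\<close>, so its coordinates are those of
        \<open>p\<close> with coefficient 1.\<close>
      have s: "(p, inv p) \<in> W" using p by (simp add: W_def)
      have "coord i (p, inv p) = t i" if "i \<in> {1..<n}" for i
        using p that by (simp add: coord_eq psum_facts)
      moreover have "t i mod ?k = t i" if "i \<in> {1..<n}" for i
      proof -
        have "t i \<in> carrier (Zmod (b - 2 * a))" using t that unfolding I by auto
        then show ?thesis by (auto simp: Zmod_def carrier_integer_mod_group split: if_splits)
      qed
      ultimately have "F (r (p, inv p)) = t"
        unfolding F_r[OF s] using t unfolding I by (auto simp: fun_eq_iff PiE_def extensional_def)
      then show "t \<in> F ` carrier K" unfolding carrier_K using s by blast
    qed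
  qed
  ultimately show ?thesis
    using F.FactGroup_iso unfolding abelianization_def K_def by simp
qed

end

theorem theorem4p1:
  fixes a b :: int and n :: nat
  assumes "a \<ge> 1" and "b > 1" and "int n = 2 * a * b + b ^ 2"
  defines "G \<equiv> Gab n a b" and "H \<equiv> Hab n a b" and "H0 \<equiv> Hab0 n a b"
  shows "(G\<lparr>carrier := H\<rparr> Mod H0 \<cong> integer_group) \<and>
    (derived G H = derived G H0 \<and>
     (if even b \<and> odd a then G\<lparr>carrier := derived G H\<rparr> \<cong> Zmod 2
      else derived G H = {\<one>\<^bsub>G\<^esub>}) \<and>
     derived G H \<subseteq> center G) \<and>
    (abelianization (G\<lparr>carrier := H0\<rparr>) \<cong> product_group {1..n - 1} (\<lambda>_. Zmod (b - 2 * a)))"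
proof -
  have "1 * 2 \<le> a * b" "2 * 2 \<le> b * b"
    using assms(1,2) by (intro mult_mono; simp)+
  then have "int n \<ge> 8" using assms(3) by (simp add: power2_eq_square)
  then have n: "5 \<le> n" by simp
  obtain \<theta> where \<theta>: "\<theta> \<in> hom (Bt n) (wreath n)"
    "\<theta> (tilde_braid.c (Bt n) (Bt_gen n)) = (\<lambda>_. 0, id)"
    "\<And>i. i \<in> {1..<n} \<Longrightarrow> \<theta> (tilde_braid.u (Bt n) (Bt_gen n) i)
      = (\<lambda>k. (if k = i then 1 else 0) - (if k = i + 1 then 1 else 0), id)"
    by (rule wreath_representation[OF n]) (rule that)
  interpret q: tilde_braid_wreath "Bt n" n "Bt_gen n" "psi n" "Bt_degree n" a b \<theta>
    by (intro tilde_braid_wreath.intro tilde_braid_quotient.intro tilde_braid_wreath_axioms.intro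
        tilde_braid_maps_Bt[OF n] \<theta>)
  have S_eq: "SD n = q.S"
    by (simp add: SD_def q.S_def G0_def Pt0_eq[OF n])
  have N_eq: "N_sub n a b = q.N"
    unfolding N_sub_def q.N_def N_gens_def Let_def S_eq q.n1_def q.n2_def q.n3_def q.n4_def
      q.B11_def q.\<tau>_def q.U_def q.C_def u_elt_eq[OF n] c_elt_eq[OF n]
    by (simp add: G0_def)
  have G: "G = q.Q"
    unfolding G_def Gab_def q.Q_def S_eq N_eq ..
  have H: "H = q.H"
    unfolding H_def Hab_def psi_ab_def q.H_def G[symmetric] G_def ..
  have H0: "H0 = q.H0"
    unfolding H0_def Hab0_def q.H0_def H[symmetric] H_def G[symmetric] G_def ..
  have c2: "if even b \<and> odd a then q.Q\<lparr>carrier := derived q.Q q.H\<rparr> \<cong> Zmod 2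
      else derived q.Q q.H = {\<one>\<^bsub>q.Q\<^esub>}"
  proof (cases "even b \<and> odd a")
    case True
    obtain h :: "nat word set set \<Rightarrow> spin_vec \<Rightarrow> spin_vec" where
      "h \<in> hom (Bt n) bij_group" "h (c_elt n) = spin_neg" "h (u_elt n) \<circ> h (u_elt n) = spin_neg"
      by (rule spin_representation[OF n]) (rule that)
    then have "q.C \<notin> q.N"
      using True unfolding c_elt_eq[OF n] u_elt_eq[OF n] by (intro q.C_not_N) auto
    then show ?thesis using True q.derived_H_Z2 by simp
  next
    case False
    then show ?thesis using q.derived_H_trivial by auto
  qed
  have "derived q.Q q.H = derived q.Q q.H0"
    unfolding q.derived_H q.derived_H0 ..
  then show ?thesis
    unfolding G H H0 by (intro conjI q.quotient_H_H0 c2 q.C_class_central q.abelianization_H0)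
qed

end
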